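(* Let $\varphi:\mathbb{R}^n\to\overline{\mathbb{R}}$ be a proper, lower semicontinuous and weakly convex function. For $(x,v)\in\operatorname{gph}\partial\varphi$, say that $\breve{\partial}^2\varphi(x,v)$ (respectively $\partial^2\varphi(x,v)$) is positive semidefinite if $\langle z,w\rangle\ge 0$ for all $w\in\mathbb{R}^n$ and all $z\in\breve{\partial}^2\varphi(x,v)(w)$ (respectively all $z\in\partial^2\varphi(x,v)(w)$). Then the following assertions are equivalent: (i) $\varphi$ is convex. (ii) For all $(x,v)\in\operatorname{gph}\partial\varphi$, $\breve{\partial}^2\varphi(x,v)$ is positive semidefinite. (iii) For all $(x,v)\in\operatorname{gph}\partial\varphi$ such that $\varphi$ is twice epi-differentiable at $x$ for $v$, $\breve{\partial}^2\varphi(x,v)$ is positive semidefinite. (iv) For all $(x,v)\in\operatorname{gph}\partial\varphi$ such that $\varphi$ is generalized twice differentiable at $x$ for $v$, $\breve{\partial}^2\varphi(x,v)$ is positive semidefinite. (v) For all $(x,v)\in\operatorname{gph}\partial\varphi$, $\partial^2\varphi(x,v)$ is positive semidefinite. (vi) For all $(x,v)\in\operatorname{gph}\partial\varphi$ such that $\varphi$ is twice epi-differentiable at $x$ for $v$, $\partial^2\varphi(x,v)$ is positive semidefinite. (vii) For all $(x,v)\in\operatorname{gph}\partial\varphi$ such that $\varphi$ is generalized twice differentiable at $x$ for $v$, $\partial^2\varphi(x,v)$ is positive semidefinite.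
   Context: $\overline{\mathbb{R}}:=\mathbb{R}\cup\{\infty\}=(-\infty,\infty]$; $\mathbb{R}^n$ carries the Euclidean norm $\|\cdot\|$ and inner product $\langle\cdot,\cdot\rangle$. For $\varphi:\mathbb{R}^n\to\overline{\mathbb{R}}$, $\operatorname{dom}\varphi=\{x\mid\varphi(x)<\infty\}$ and $\operatorname{epi}\varphi=\{(x,\alpha)\in\mathbb{R}^{n+1}\mid\alpha\ge\varphi(x)\}$; $\varphi$ is proper if $\operatorname{dom}\varphi\neq\emptyset$. For $s\in\mathbb{R}$, $\varphi$ is $s$-convex if $\varphi((1-\lambda)x+\lambda y)\le(1-\lambda)\varphi(x)+\lambda\varphi(y)-\frac{s}{2}\lambda(1-\lambda)\|x-y\|^2$ for all $x,y\in\mathbb{R}^n$, $\lambda\in(0,1)$. It is convex if this holds with $s=0$, and weakly convex if it holds for some $s<0$. For $\Omega\subset\mathbb{R}^s$ and $\bar z\in\Omega$: the regular normal cone is $\widehat N_\Omega(\bar z)=\{v\mid\limsup_{z\to\bar z,\,z\in\Omega}\langle v,z-\bar z\rangle/\|z-\bar z\|\le 0\}$; the limiting normal cone is $N_\Omega(\bar z)=\{v\mid\exists\,z_k\to\bar z,\ z_k\in\Omega,\ v_k\to v,\ v_k\in\widehat N_\Omega(z_k)\}$. The limiting subdifferential of $\varphi$ at $x\in\operatorname{dom}\varphi$ is $\partial\varphi(x)=\{v\mid(v,-1)\in N_{\operatorname{epi}\varphi}(x,\varphi(x))\}$ (and $\partial\varphi(x)=\emptyset$ if $x\notin\operatorname{dom}\varphi$);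 $\operatorname{gph}\partial\varphi=\{(x,v)\mid v\in\partial\varphi(x)\}$. For $(x,v)\in\operatorname{gph}\partial\varphi$ and $w\in\mathbb{R}^n$, the combined and limiting second-order subdifferentials are, respectively, $\breve{\partial}^2\varphi(x,v)(w)=\{z\in\mathbb{R}^n\mid(z,-w)\in\widehat N_{\operatorname{gph}\partial\varphi}(x,v)\}$ and $\partial^2\varphi(x,v)(w)=\{z\in\mathbb{R}^n\mid(z,-w)\in N_{\operatorname{gph}\partial\varphi}(x,v)\}$. For $(x,v)\in\operatorname{gph}\partial\varphi$ and $\tau>0$, put $\Delta^2_\tau\varphi(x,v)(u)=\dfrac{\varphi(x+\tau u)-\varphi(x)-\tau\langle v,u\rangle}{\frac12\tau^2}$. The second subderivative is $d^2\varphi(x,v)(w)=\liminf_{\tau\downarrow 0,\,u\to w}\Delta^2_\tau\varphi(x,v)(u)$, which may take extended-real values. $\varphi$ is twice epi-differentiable at $x$ for $v$ if for every $w\in\mathbb{R}^n$ and every sequence $\tau_k\downarrow 0$ there is a sequence $w^k\to w$ with $\Delta^2_{\tau_k}\varphi(x,v)(w^k)\to d^2\varphi(x,v)(w)$. A generalized quadratic form is a function of the form $w\mapsto\langle w,Aw\rangle+\delta_L(w)$, where $A\in\mathbb{R}^{n\times n}$ is symmetric, $L\subset\mathbb{R}^n$ is a linear subspace, and $\delta_L$ is $0$ on $L$ and $\infty$ elsewhere. $\varphi$ is generalized twice differentiable at $x$ for $v\in\partial\varphi(x)$ if it is twice epi-differentiable at $x$ for $v$ and $d^2\varphi(x,v)$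 is a generalized quadratic form. *)

theory Defs
  imports "HOL-Analysis.Analysis"
begin

text \<open>
  Functions with values in \<open>(-\<infinity>, \<infinity>]\<close> are represented as functions into \<^typ>\<open>ereal\<close>; that they
  avoid \<open>-\<infinity>\<close> is a separate hypothesis wherever it is needed. The space \<open>\<real>\<^sup>n\<^sup>+\<^sup>1\<close> containing the
  epigraph is \<open>\<real>\<^sup>n \<times> \<real>\<close>, and graphs live in \<open>\<real>\<^sup>n \<times> \<real>\<^sup>n\<close>; the library norm and inner product on
  products are the Euclidean ones.
\<close>

definition dom_fun :: "('a \<Rightarrow> ereal) \<Rightarrow> 'a set" where
  "dom_fun \<phi> = {x. \<phi> x < \<infinity>}"

definition epi :: "('a \<Rightarrow> ereal) \<Rightarrow> ('a \<times> real) set" where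
  "epi \<phi> = {(x, \<alpha>). \<phi> x \<le> ereal \<alpha>}"

definition proper_fun :: "('a \<Rightarrow> ereal) \<Rightarrow> bool" where
  "proper_fun \<phi> \<longleftrightarrow> dom_fun \<phi> \<noteq> {}"

definition lower_semicontinuous :: "('a::topological_space \<Rightarrow> ereal) \<Rightarrow> bool" where
  "lower_semicontinuous \<phi> \<longleftrightarrow> (\<forall>x. \<phi> x \<le> Liminf (at x) \<phi>)"

definition s_convex :: "real \<Rightarrow> ('a::real_inner \<Rightarrow> ereal) \<Rightarrow> bool" where
  "s_convex s \<phi> \<longleftrightarrow>
     (\<forall>x y. \<forall>l\<in>{0<..<1}.
        \<phi> ((1 - l) *\<^sub>R x + l *\<^sub>R y)
          \<le> ereal (1 - l) * \<phi> x + ereal l * \<phi> y - ereal (s / 2 * l * (1 - l) * (norm (x - y))\<^sup>2))"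

definition convex_fun :: "('a::real_inner \<Rightarrow> ereal) \<Rightarrow> bool" where
  "convex_fun \<phi> \<longleftrightarrow> s_convex 0 \<phi>"

definition weakly_convex :: "('a::real_inner \<Rightarrow> ereal) \<Rightarrow> bool" where
  "weakly_convex \<phi> \<longleftrightarrow> (\<exists>s<0. s_convex s \<phi>)"

text \<open>
  Both normal cones are only meant for base points in \<open>\<Omega>\<close>. At an isolated point of \<open>\<Omega>\<close> the
  filter is trivial, its \<^const>\<open>Limsup\<close> is \<open>-\<infinity>\<close>, and the regular normal cone is the whole space.
\<close>

definition regular_normal_cone :: "'a::real_inner set \<Rightarrow> 'a \<Rightarrow> 'a set" where
  "regular_normal_cone \<Omega> zb =
     {v. Limsup (at zb within \<Omega>) (\<lambda>z. ereal (v \<bullet> (z - zb) / norm (z - zb))) \<le> 0}"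

definition limiting_normal_cone :: "'a::real_inner set \<Rightarrow> 'a \<Rightarrow> 'a set" where
  "limiting_normal_cone \<Omega> zb =
     {v. \<exists>z u. z \<longlonglongrightarrow> zb \<and> (\<forall>k. z k \<in> \<Omega>) \<and> u \<longlonglongrightarrow> v \<and> (\<forall>k. u k \<in> regular_normal_cone \<Omega> (z k))}"

definition limiting_subdifferential :: "('a::real_inner \<Rightarrow> ereal) \<Rightarrow> 'a \<Rightarrow> 'a set" where
  "limiting_subdifferential \<phi> x =
     (if x \<in> dom_fun \<phi>
      then {v. (v, -1) \<in> limiting_normal_cone (epi \<phi>) (x, real_of_ereal (\<phi> x))}
      else {})"

definition gph_subdifferential :: "('a::real_inner \<Rightarrow> ereal) \<Rightarrow> ('a \<times> 'a) set" where
  "gph_subdifferential \<phi> = {(x, v). v \<in> limiting_subdifferential \<phi> x}"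

definition combined_second_subdifferential ::
    "('a::real_inner \<Rightarrow> ereal) \<Rightarrow> 'a \<Rightarrow> 'a \<Rightarrow> 'a \<Rightarrow> 'a set" where
  "combined_second_subdifferential \<phi> x v w =
     {z. (z, - w) \<in> regular_normal_cone (gph_subdifferential \<phi>) (x, v)}"

definition limiting_second_subdifferential ::
    "('a::real_inner \<Rightarrow> ereal) \<Rightarrow> 'a \<Rightarrow> 'a \<Rightarrow> 'a \<Rightarrow> 'a set" where
  "limiting_second_subdifferential \<phi> x v w =
     {z. (z, - w) \<in> limiting_normal_cone (gph_subdifferential \<phi>) (x, v)}"

definition positive_semidefinite_map :: "('a::real_inner \<Rightarrow> 'a set) \<Rightarrow> bool" where
  "positive_semidefinite_map F \<longleftrightarrow> (\<forall>w. \<forall>z\<in>F w. z \<bullet> w \<ge> 0)"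

definition second_diff_quotient ::
    "('a::real_inner \<Rightarrow> ereal) \<Rightarrow> 'a \<Rightarrow> 'a \<Rightarrow> real \<Rightarrow> 'a \<Rightarrow> ereal" where
  "second_diff_quotient \<phi> x v \<tau> u =
     (\<phi> (x + \<tau> *\<^sub>R u) - \<phi> x - ereal (\<tau> * (v \<bullet> u))) / ereal (1 / 2 * \<tau>\<^sup>2)"

text \<open>The lower limit is joint in \<open>\<tau> \<down> 0\<close> and \<open>u \<rightarrow> w\<close>, where \<open>u = w\<close> is allowed.\<close>

definition second_subderivative ::
    "('a::real_inner \<Rightarrow> ereal) \<Rightarrow> 'a \<Rightarrow> 'a \<Rightarrow> 'a \<Rightarrow> ereal" where
  "second_subderivative \<phi> x v w =
     Liminf (at_right 0 \<times>\<^sub>F nhds w) (\<lambda>(\<tau>, u). second_diff_quotient \<phi> x v \<tau> u)"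

text \<open>As usual in variational analysis, \<open>\<tau>\<^sub>k \<down> 0\<close> means \<open>\<tau>\<^sub>k \<rightarrow> 0\<close> with \<open>\<tau>\<^sub>k > 0\<close>, not monotonically.\<close>

definition twice_epi_differentiable ::
    "('a::real_inner \<Rightarrow> ereal) \<Rightarrow> 'a \<Rightarrow> 'a \<Rightarrow> bool" where
  "twice_epi_differentiable \<phi> x v \<longleftrightarrow>
     (\<forall>w. \<forall>\<tau> :: nat \<Rightarrow> real. (\<forall>k. \<tau> k > 0) \<and> \<tau> \<longlonglongrightarrow> 0 \<longrightarrow>
        (\<exists>ws. ws \<longlonglongrightarrow> w \<and>
              (\<lambda>k. second_diff_quotient \<phi> x v (\<tau> k) (ws k)) \<longlonglongrightarrow> second_subderivative \<phi> x v w))"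

definition set_delta :: "'a set \<Rightarrow> 'a \<Rightarrow> ereal" where
  "set_delta L w = (if w \<in> L then 0 else \<infinity>)"

definition generalized_quadratic_form :: "(real ^ 'n \<Rightarrow> ereal) \<Rightarrow> bool" where
  "generalized_quadratic_form q \<longleftrightarrow>
     (\<exists>(A :: real ^ 'n ^ 'n) L. transpose A = A \<and> subspace L \<and>
        q = (\<lambda>w. ereal (w \<bullet> (A *v w)) + set_delta L w))"

definition generalized_twice_differentiable ::
    "(real ^ 'n \<Rightarrow> ereal) \<Rightarrow> real ^ 'n \<Rightarrow> real ^ 'n \<Rightarrow> bool" where
  "generalized_twice_differentiable \<phi> x v \<longleftrightarrow>
     twice_epi_differentiable \<phi> x v \<and> generalized_quadratic_form (second_subderivative \<phi> x v)"

end

theory Submission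
  imports Defs
begin

text \<open>
  If \<open>\<phi>\<close> is \<open>\<rho>\<close>-weakly convex and \<open>\<mu> * \<rho> < 1\<close>, then \<open>gph \<partial>\<phi>\<close> is parametrized by
  \<open>y \<mapsto> (P y, G y)\<close>, where \<open>P\<close> is the (Lipschitz) proximal map with parameter \<open>\<mu>\<close> and
  \<open>G y = (y - P y) / \<mu>\<close> is the gradient of the Moreau envelope.

  For convex \<open>\<phi>\<close> take \<open>\<mu> = 1\<close>: firm nonexpansiveness of \<open>P\<close>, tested along the ray \<open>y + t (z - w)\<close>,
  shows \<open>norm (z - w) \<le> norm (z + w)\<close>, that is \<open>z \<bullet> w \<ge> 0\<close>, for every regular normal \<open>(z, - w)\<close>
  to the graph, and limiting normals inherit this.

  Conversely, by Rademacher's theorem \<open>P\<close> has a derivative \<open>J\<close> at almost every \<open>y\<close>. There \<open>J\<close> and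
  \<open>H = (id - J) / \<mu>\<close> are symmetric, since \<open>H\<close> is the Hessian of the envelope, and the second order
  expansion of the envelope makes \<open>\<phi>\<close> generalized twice differentiable at \<open>P y\<close> for \<open>G y\<close>, with
  second subderivative \<open>J d \<mapsto> H d \<bullet> J d\<close> on the range of \<open>J\<close>. Moreover \<open>(H d, - J d)\<close> is a regular
  normal to the graph, so the weakest condition (iv) yields \<open>H d \<bullet> J d \<ge> 0\<close>. This says that
  \<open>2 P - id\<close> has a nonexpansive derivative almost everywhere, hence is nonexpansive, hence \<open>G\<close> is
  monotone and the envelope is convex. Letting \<open>\<mu> \<rightarrow> 0\<close> gives convexity of \<open>\<phi>\<close>.
\<close>

subsection \<open>Differentiability almost everywhere of Lipschitz functions on the line\<close>

text \<open>Condition (iv) is silent on a null set of parameters \<open>y\<close>, so a.e.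
  information has to be upgraded to all points. This works because \<open>P\<close> is Lipschitz: a
  derivative bound almost everywhere then controls every increment, whereas for merely continuous
  functions it need not (Cantor function). This fact and Rademacher's theorem rest on one estimate
  on the line. After an affine normalization \<open>F\<close> and \<open>id - F\<close> are both
  nondecreasing, so their Stieltjes measures add up to Lebesgue measure. A Vitali covering bounds
  each measure where its own difference quotients are frequently small: two bounds with constants
  summing to less than 1 force a null set, and a single bound controls an increment. The reflection
  \<open>2 P - id\<close> enters because \<open>H d \<bullet> J d \<ge> 0\<close> is the same as
  \<open>norm (2 J d - d) \<le> norm d\<close>. Extended values and limiting normals are removed at
  the outset of the second-order analysis: \<open>gph \<partial>\<phi>\<close> is identified with
  the pairs satisfying a global quadratic minorant inequality for a real function on its domain, and
  minimization of a strongly convex objective then does the rest.\<close>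

definition diff_quot :: "('a::real_vector \<Rightarrow> real) \<Rightarrow> 'a \<Rightarrow> 'a \<Rightarrow> real \<Rightarrow> real" where
  "diff_quot f v x h = (f (x + h *\<^sub>R v) - f x) / h"

lemma diff_quot_uminus: "diff_quot (\<lambda>x. - f x) v x h = - diff_quot f v x h"
  by (simp add: diff_quot_def diff_divide_distrib)

lemma diff_quot_bound:
  fixes f :: "'a::real_normed_vector \<Rightarrow> real"
  assumes "L-lipschitz_on UNIV f"
  shows "\<bar>diff_quot f v x h\<bar> \<le> L * norm v"
proof (cases "h = 0")
  case True
  then show ?thesis using lipschitz_on_nonneg[OF assms] by (simp add: diff_quot_def)
next
  case False
  have "\<bar>f (x + h *\<^sub>R v) - f x\<bar> \<le> L * (\<bar>h\<bar> * norm v)"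
    using lipschitz_onD[OF assms, of "x + h *\<^sub>R v" x] by (simp add: dist_norm)
  then show ?thesis using False by (simp add: diff_quot_def field_simps)
qed

text \<open>A bounded family without a limit has \<open>Liminf\<close> strictly below
  \<open>Limsup\<close>. Taking \<open>p\<close> and \<open>r\<close> rational in that gap prepares
  a countable union.\<close>

lemma not_convergent_imp_frequently:
  fixes q :: "'b \<Rightarrow> real"
  assumes nt: "F \<noteq> bot" and bd: "\<And>h. \<bar>q h\<bar> \<le> K" and no: "\<not> (\<exists>D. (q \<longlongrightarrow> D) F)"
  shows "\<exists>p\<in>\<rat>. \<exists>r\<in>\<rat>. p < r \<and> (\<exists>\<^sub>F h in F. q h < p) \<and> (\<exists>\<^sub>F h in F. r < q h)"
proof -
  let ?q = "\<lambda>h. ereal (q h)"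
  have le: "Liminf F ?q \<le> Limsup F ?q" by (rule Liminf_le_Limsup[OF nt])
  have lo: "ereal (-K) \<le> Liminf F ?q"
    by (rule Liminf_bounded) (use bd in \<open>auto intro!: always_eventually simp: abs_le_iff, smt (verit)\<close>)
  have hi: "Limsup F ?q \<le> ereal K"
    by (rule Limsup_bounded) (use bd in \<open>auto intro!: always_eventually simp: abs_le_iff\<close>)
  have "Liminf F ?q \<noteq> Limsup F ?q"
  proof
    assume eq: "Liminf F ?q = Limsup F ?q"
    obtain D where D: "Limsup F ?q = ereal D"
      using lo hi eq by (cases "Limsup F ?q") auto
    have "(?q \<longlongrightarrow> ereal D) F"
      by (rule Liminf_eq_Limsup[OF nt]) (use eq D in auto)
    with no show False by auto
  qed
  with le have lt: "Liminf F ?q < Limsup F ?q" by simp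
  obtain b where b: "Liminf F ?q < ereal b" "ereal b < Limsup F ?q"
    using ereal_dense2[OF lt] by blast
  obtain b' where b': "ereal b < ereal b'" "ereal b' < Limsup F ?q"
    using ereal_dense2[OF b(2)] by blast
  obtain p where p: "p \<in> \<rat>" "b < p" "p < b'" using Rats_dense_in_real[of b b'] b' by auto
  obtain r where r: "r \<in> \<rat>" "p < r" "r < b'" using Rats_dense_in_real[of p b'] p by auto
  have "\<exists>\<^sub>F h in F. q h < p"
  proof (rule ccontr)
    assume "\<not> ?thesis"
    then have "\<forall>\<^sub>F h in F. ereal p \<le> ?q h" by (simp add: not_frequently not_less)
    then have "ereal p \<le> Liminf F ?q" by (rule Liminf_bounded)
    then have "ereal p < ereal b" using b(1) by (rule le_less_trans)
    then show False using p by simp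
  qed
  moreover have "\<exists>\<^sub>F h in F. r < q h"
  proof (rule ccontr)
    assume "\<not> ?thesis"
    then have "\<forall>\<^sub>F h in F. ?q h \<le> ereal r" by (simp add: not_frequently not_less)
    then have "Limsup F ?q \<le> ereal r" by (rule Limsup_bounded)
    then have "ereal b' < ereal r" using b'(2) by (rule less_le_trans[rotated])
    then show False using r by simp
  qed
  ultimately show ?thesis using p r by blast
qed

text \<open>For fixed \<open>h\<close> the quotient is continuous in \<open>x\<close>, so each
  uncountable union over \<open>h\<close> is open; only the radii \<open>1 / Suc n\<close> have to
  be countable. The set is a G_delta.\<close>

lemma borel_frequently_diff_quot_less:
  fixes f :: "'a::real_normed_vector \<Rightarrow> real"
  assumes cont: "continuous_on UNIV f"
  shows "{x. \<exists>\<^sub>F h in at 0. diff_quot f v x h < p} \<in> sets borel"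
proof -
  have eq: "{x. \<exists>\<^sub>F h in at 0. diff_quot f v x h < p}
    = (\<Inter>n::nat. \<Union>h\<in>{h. h \<noteq> 0 \<and> \<bar>h\<bar> < 1 / Suc n}. {x. diff_quot f v x h < p})"
  proof (intro set_eqI iffI)
    fix x assume "x \<in> {x. \<exists>\<^sub>F h in at 0. diff_quot f v x h < p}"
    then show "x \<in> (\<Inter>n::nat. \<Union>h\<in>{h. h \<noteq> 0 \<and> \<bar>h\<bar> < 1 / Suc n}. {x. diff_quot f v x h < p})"
      by (fastforce simp: frequently_at dist_real_def)
  next
    fix x assume A: "x \<in> (\<Inter>n::nat. \<Union>h\<in>{h. h \<noteq> 0 \<and> \<bar>h\<bar> < 1 / Suc n}. {x. diff_quot f v x h < p})"
    have "\<exists>h\<in>UNIV. h \<noteq> 0 \<and> dist h 0 < d \<and> diff_quot f v x h < p" if d: "d > 0" for d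
    proof -
      obtain n where n: "1 / Suc n < d" using d nat_approx_posE by blast
      from A have "x \<in> (\<Union>h\<in>{h. h \<noteq> 0 \<and> \<bar>h\<bar> < 1 / Suc n}. {x. diff_quot f v x h < p})" by blast
      then obtain h where "h \<noteq> 0" "\<bar>h\<bar> < 1 / Suc n" "diff_quot f v x h < p" by auto
      with n show ?thesis by (intro bexI[of _ h]) (auto simp: dist_real_def)
    qed
    then show "x \<in> {x. \<exists>\<^sub>F h in at 0. diff_quot f v x h < p}"
      by (simp add: frequently_at)
  qed
  have "open {x. diff_quot f v x h < p}" for h
    unfolding diff_quot_def divide_inverse
    by (intro open_Collect_less continuous_intros continuous_on_compose2[OF cont]) auto
  then have "(\<Union>h\<in>{h. h \<noteq> 0 \<and> \<bar>h\<bar> < 1 / Suc n}. {x. diff_quot f v x h < p}) \<in> sets borel" for n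
    by (intro borel_open open_UN) auto
  then show ?thesis unfolding eq
    by (intro sets.countable_INT') auto
qed

text \<open>Oscillation is witnessed by a rational gap. The upper half is phrased through
  \<open>- f\<close>, so that both halves have the one form whose measurability is known and to
  which the covering estimate applies.\<close>

lemma not_tendsto_diff_quot_eq:
  fixes f :: "'a::real_normed_vector \<Rightarrow> real"
  assumes "L-lipschitz_on UNIV f"
  shows "{x. \<not> (\<exists>D. (diff_quot f v x \<longlongrightarrow> D) (at 0))} =
    (\<Union>p\<in>\<rat>. \<Union>r\<in>{r\<in>\<rat>. p < r}. {x. \<exists>\<^sub>F h in at 0. diff_quot f v x h < p} \<inter>
       {x. \<exists>\<^sub>F h in at 0. diff_quot (\<lambda>x. - f x) v x h < - r})" (is "?A = ?B")
proof (intro equalityI subsetI)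
  fix x assume "x \<in> ?A"
  then have "\<exists>p\<in>\<rat>. \<exists>r\<in>\<rat>. p < r \<and> (\<exists>\<^sub>F h in at 0. diff_quot f v x h < p) \<and> (\<exists>\<^sub>F h in at 0. r < diff_quot f v x h)"
    using diff_quot_bound[OF assms] by (intro not_convergent_imp_frequently[where K = "L * norm v"]) auto
  then show "x \<in> ?B" by (auto simp: diff_quot_uminus)
next
  fix x assume "x \<in> ?B"
  then obtain p r where pr: "p < r" "\<exists>\<^sub>F h in at 0. diff_quot f v x h < p"
     "\<exists>\<^sub>F h in at 0. r < diff_quot f v x h"
    by (auto simp: diff_quot_uminus)
  have False if D: "(diff_quot f v x \<longlongrightarrow> D) (at 0)" for D
  proof (cases "D < r")
    case True
    then have "\<forall>\<^sub>F h in at 0. diff_quot f v x h < r" by (rule order_tendstoD(2)[OF D])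
    then have "\<not> (\<exists>\<^sub>F h in at 0. r < diff_quot f v x h)" by (auto simp: not_frequently elim!: eventually_mono)
    with pr show False by blast
  next
    case False
    then have "p < D" using pr by simp
    then have "\<forall>\<^sub>F h in at 0. diff_quot f v x h > p" by (rule order_tendstoD(1)[OF D])
    then have "\<not> (\<exists>\<^sub>F h in at 0. p > diff_quot f v x h)" by (auto simp: not_frequently elim!: eventually_mono)
    with pr show False by blast
  qed
  then show "x \<in> ?A" by auto
qed

lemma borel_not_tendsto_diff_quot:
  fixes f :: "'a::real_normed_vector \<Rightarrow> real"
  assumes "L-lipschitz_on UNIV f"
  shows "{x. \<not> (\<exists>D. (diff_quot f v x \<longlongrightarrow> D) (at 0))} \<in> sets borel"
proof -
  have c: "continuous_on UNIV f" by (rule lipschitz_on_continuous_on[OF assms])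
  have "{x. \<exists>\<^sub>F h in at 0. diff_quot f v x h < p} \<inter>
       {x. \<exists>\<^sub>F h in at 0. diff_quot (\<lambda>x. - f x) v x h < - r} \<in> sets borel" for p r
    using c by (intro sets.Int borel_frequently_diff_quot_less continuous_on_minus)
  moreover have "countable {r \<in> \<rat>. p < r}" for p :: real
    by (rule countable_subset[OF _ countable_rat]) auto
  ultimately show ?thesis unfolding not_tendsto_diff_quot_eq[OF assms]
    by (intro sets.countable_UN'[OF countable_rat] sets.countable_UN' image_subsetI) blast+
qed

section \<open>Stieltjes measures of \<open>F\<close> and \<open>id - F\<close>\<close>

lemma continuous_on_of_mono_diff:
  fixes F :: "real \<Rightarrow> real"
  assumes mono: "mono F" and mono': "mono (\<lambda>x. x - F x)"
  shows "continuous_on UNIV F"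
proof -
  have "1-lipschitz_on UNIV F"
  proof (rule lipschitz_onI)
    fix x y :: real
    show "dist (F x) (F y) \<le> 1 * dist x y"
      using monoD[OF mono, of x y] monoD[OF mono, of y x] monoD[OF mono', of x y] monoD[OF mono', of y x]
      by (cases "x \<le> y") (auto simp: dist_real_def)
  qed auto
  then show ?thesis by (rule lipschitz_on_continuous_on)
qed

text \<open>On a box the two masses telescope to its length, and Lebesgue measure is determined by
  its values on boxes. In particular the measure of \<open>F\<close> is dominated by Lebesgue
  measure, so Lebesgue null sets carry no Stieltjes mass.\<close>

lemma emeasure_interval_measure_sum:
  fixes F :: "real \<Rightarrow> real"
  assumes mono: "mono F" and mono': "mono (\<lambda>x. x - F x)" and A: "A \<in> sets borel"
  shows "emeasure (interval_measure F) A + emeasure (interval_measure (\<lambda>x. x - F x)) A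
     = emeasure lborel A"
proof -
  let ?G = "\<lambda>x. x - F x"
  let ?m = "\<lambda>A. emeasure (interval_measure F) A + emeasure (interval_measure ?G) A"
  define M where "M = measure_of UNIV (sets borel) ?m"
  have cF: "continuous_on UNIV F" by (rule continuous_on_of_mono_diff[OF mono mono'])
  have cG: "continuous_on UNIV ?G" by (intro continuous_intros cF)
  have sa: "sigma_algebra UNIV (sets (borel::real measure))" 
    using sets.sigma_algebra_axioms[of "borel::real measure"] by simp
  have setsM: "sets M = sets borel" unfolding M_def using sa
    by (metis sigma_algebra.sigma_sets_eq sets_measure_of subset_UNIV Pow_UNIV)
  have pos: "positive (sets M) ?m" by (simp add: positive_def)
  have ca: "countably_additive (sets M) ?m"
  proof (rule countably_additiveI)
    fix A :: "nat \<Rightarrow> real set" assume A: "range A \<subseteq> sets M" "disjoint_family A"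
    have "(\<Sum>i. ?m (A i)) = (\<Sum>i. emeasure (interval_measure F) (A i)) + (\<Sum>i. emeasure (interval_measure ?G) (A i))"
      by (rule suminf_add[symmetric]) auto
    then show "(\<Sum>i. ?m (A i)) = ?m (\<Union> (range A))"
      using A by (simp add: suminf_emeasure setsM)
  qed
  have emM: "emeasure M B = ?m B" if "B \<in> sets borel" for B
    by (rule emeasure_measure_of[OF M_def _ pos ca]) (use that setsM in auto)
  \<comment> \<open>\<open>lborel_eqI\<close> tests open boxes, while the Stieltjes mass is
    available on closed intervals; continuity of \<open>H\<close> makes the end points null.\<close>
  have Ioo: "emeasure (interval_measure H) {l<..<u} = H u - H l" 
    if "mono H" "continuous_on UNIV H" "l \<le> u" for H l and u :: real
  proof (cases "l = u")
    case False
    then have "l < u" using that by simp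
    have H: "\<And>x y. x \<le> y \<Longrightarrow> H x \<le> H y" using that(1) by (simp add: monoD)
    have z: "emeasure (interval_measure H) {x} = 0" for x
      using emeasure_interval_measure_Icc[of x x H] H that(2) by simp
    have "emeasure (interval_measure H) {l..u} = emeasure (interval_measure H) ({l<..<u} \<union> {l,u})"
      using \<open>l < u\<close> by (intro arg_cong[where f="emeasure _"]) auto
    also have "\<dots> = emeasure (interval_measure H) {l<..<u}"
    proof (rule emeasure_Un_null_set)
      have "{l, u} = {l} \<union> {u}" by auto
      also have "\<dots> \<in> null_sets (interval_measure H)" by (intro null_sets.Un) (auto simp: null_sets_def z)
      finally show "{l,u} \<in> null_sets (interval_measure H)" .
    qed auto
    finally show ?thesis using emeasure_interval_measure_Icc[of l u H] H that by simp
  qed simp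
  have "lborel = M"
  proof (rule lborel_eqI)
    fix l u :: real assume "\<And>b. b \<in> Basis \<Longrightarrow> l \<bullet> b \<le> u \<bullet> b"
    then have "l \<le> u" by simp
    then show "emeasure M (box l u) = (\<Prod>b\<in>Basis. (u - l) \<bullet> b)"
      using monoD[OF mono, of l u] monoD[OF mono', of l u]
      by (simp add: emM box_real Ioo[OF mono cF] Ioo[OF mono' cG] flip: ennreal_plus)
  qed (rule setsM)
  then show ?thesis using emM[OF A] by simp
qed

text \<open>Cover \<open>E\<close>, up to a null set, by disjoint Vitali intervals on each of which \<open>F\<close> grows by
  at most \<open>p\<close> times the length.\<close>

lemma emeasure_interval_measure_le_of_dini:
  fixes F :: "real \<Rightarrow> real"
  assumes mono: "mono F" and mono': "mono (\<lambda>x. x - F x)" and E: "E \<in> sets borel" and p: "p \<ge> 0"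
    and dini: "\<And>x. x \<in> E \<Longrightarrow> \<exists>\<^sub>F h in at 0. diff_quot F 1 x h < p"
  shows "emeasure (interval_measure F) E \<le> ennreal p * emeasure lborel E"
proof -
  let ?\<mu> = "emeasure (interval_measure F)"
  have mF: "\<And>x y. x \<le> y \<Longrightarrow> F x \<le> F y" using mono by (simp add: monoD)
  have mle: "?\<mu> A \<le> emeasure lborel A" if "A \<in> sets borel" for A
    using emeasure_interval_measure_sum[OF mono mono' that] by (metis le_iff_add)
  have cF: "continuous_on UNIV F" by (rule continuous_on_of_mono_diff[OF mono mono'])
  have key: "?\<mu> E \<le> ennreal p * (emeasure lborel E + ennreal e)" if e: "e > 0" for e
  proof -
    obtain U where U: "open U" "E \<subseteq> U" "emeasure lborel (U - E) < e"
      using outer_regular_lborel[OF E e] .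
    \<comment> \<open>An index \<open>(x, h)\<close> stands for the interval between
      \<open>x\<close> and \<open>x + h\<close>, with \<open>h\<close> of either sign, written as a
      ball to suit the covering theorem. Containment in \<open>U\<close> keeps the total length
      within \<open>e\<close> of the measure of \<open>E\<close>.\<close>
    define K where "K = {(x,h). x \<in> E \<and> h \<noteq> 0 \<and> cball (x + h/2) (\<bar>h\<bar>/2) \<subseteq> U \<and> diff_quot F 1 x h < p}"
    define a where "a = (\<lambda>(x::real,h). x + h/2)"
    define r where "r = (\<lambda>(x::real,h::real). \<bar>h\<bar>/2)"
    have small: "?\<mu> (cball (a i) (r i)) \<le> ennreal p * emeasure lborel (cball (a i) (r i))" if "i \<in> K" for i
    proof -
      obtain x h where i: "i = (x,h)" by force
      have h: "h \<noteq> 0" "(F (x + h) - F x) / h < p" using that by (auto simp: i K_def diff_quot_def)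
      show ?thesis
      proof (cases "h > 0")
        case True
        then have "cball (a i) (r i) = {x..x+h}" by (auto simp: a_def r_def i cball_eq_atLeastAtMost field_simps)
        moreover have "F (x + h) - F x \<le> p * h" using h True by (simp add: field_simps)
        ultimately show ?thesis using emeasure_interval_measure_Icc[of x "x+h" F] True mF cF p
          by (auto simp: ennreal_mult[symmetric] intro!: ennreal_leI)
      next
        case False
        then have "h < 0" using h by simp
        then have "cball (a i) (r i) = {x+h..x}" by (auto simp: a_def r_def i cball_eq_atLeastAtMost field_simps)
        moreover have "F x - F (x + h) \<le> p * (- h)" using h \<open>h < 0\<close> by (simp add: field_simps)
        ultimately show ?thesis using emeasure_interval_measure_Icc[of "x+h" x F] \<open>h < 0\<close> mF cF p
          by (auto simp: ennreal_mult[symmetric] intro!: ennreal_leI)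
      qed
    qed
    have rpos: "0 < r i" if "i \<in> K" for i using that by (auto simp: K_def r_def)
    have cover: "\<exists>i. i \<in> K \<and> x \<in> cball (a i) (r i) \<and> r i < d" if x: "x \<in> E" and d: "d > 0" for x d
    proof -
      obtain s where s: "s > 0" "cball x s \<subseteq> U" using U x open_contains_cball by (metis subsetD)
      have "min d s > 0" using d s by simp
      then obtain h where h: "h \<noteq> 0" "\<bar>h\<bar> < min d s" "diff_quot F 1 x h < p"
        using dini[OF x] unfolding frequently_at by (metis UNIV_I dist_real_def diff_zero)
      have "cball (x + h/2) (\<bar>h\<bar>/2) \<subseteq> cball x s"
        using h by (auto simp: cball_eq_atLeastAtMost abs_if split: if_splits)
      then have "(x,h) \<in> K" using h s x by (auto simp: K_def)
      moreover have "x \<in> cball (a (x,h)) (r (x,h))" by (auto simp: a_def r_def dist_real_def)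
      moreover have "r (x,h) < d" using h by (auto simp: r_def)
      ultimately show ?thesis by blast
    qed
    obtain C where C: "countable C" "C \<subseteq> K"
      "pairwise (\<lambda>i j. disjnt (cball (a i) (r i)) (cball (a j) (r j))) C"
      "negligible (E - (\<Union>i \<in> C. cball (a i) (r i)))"
      using Vitali_covering_theorem_cballs[of K r E a, OF rpos cover] by blast
    let ?V = "\<Union>i \<in> C. cball (a i) (r i)"
    have disj: "disjoint_family_on (\<lambda>i. cball (a i) (r i)) C"
      using C(3) by (auto simp: disjoint_family_on_def pairwise_def disjnt_def)
    have VB: "?V \<in> sets borel" using C(1) by (intro sets.countable_UN') auto
    have neg: "emeasure lborel (E - ?V) = 0"
      using C(4) E VB by (subst (asm) negligible_iff_emeasure0) auto
    have VU: "?V \<subseteq> U" using C(2) by (fastforce simp: K_def a_def r_def)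
    have "?\<mu> E \<le> ?\<mu> (?V \<union> (E - ?V))" using E VB by (intro emeasure_mono) auto
    also have "\<dots> \<le> ?\<mu> ?V + ?\<mu> (E - ?V)" using E VB by (intro emeasure_subadditive) auto
    \<comment> \<open>What the covering misses is Lebesgue null, hence null for the dominated
      Stieltjes measure.\<close>
    also have "?\<mu> (E - ?V) = 0" using mle[of "E - ?V"] neg E VB by simp
    also have "?\<mu> ?V + 0 = (\<integral>\<^sup>+i. ?\<mu> (cball (a i) (r i)) \<partial>count_space C)"
      using C(1) disj by (simp add: emeasure_UN_countable)
    also have "\<dots> \<le> (\<integral>\<^sup>+i. ennreal p * emeasure lborel (cball (a i) (r i)) \<partial>count_space C)"
      using C(2) small by (intro nn_integral_mono) auto
    also have "\<dots> = ennreal p * (\<integral>\<^sup>+i. emeasure lborel (cball (a i) (r i)) \<partial>count_space C)"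
      by (rule nn_integral_cmult) simp
    also have "(\<integral>\<^sup>+i. emeasure lborel (cball (a i) (r i)) \<partial>count_space C) = emeasure lborel ?V"
      using C(1) disj by (simp add: emeasure_UN_countable)
    also have "emeasure lborel ?V \<le> emeasure lborel (E \<union> (U - E))"
      using VU U E by (intro emeasure_mono) (auto intro: borel_open)
    also have "\<dots> \<le> emeasure lborel E + emeasure lborel (U - E)"
      using U E by (intro emeasure_subadditive) (auto intro: borel_open)
    also have "\<dots> \<le> emeasure lborel E + ennreal e" using U(3) by (intro add_mono) auto
    finally show ?thesis by (simp add: mult_left_mono)
  qed
  show ?thesis
  proof (cases "emeasure lborel E = \<infinity>")
    case True
    show ?thesis
    \<comment> \<open>In \<open>ennreal\<close> zero times infinity is 0, so even for infinite
      measure the case \<open>p = 0\<close> is not vacuous.\<close>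
    proof (cases "p = 0")
      case True
      then show ?thesis using key[of 1] by simp
    next
      case False
      then show ?thesis using \<open>emeasure lborel E = \<infinity>\<close> p by (simp add: ennreal_mult_top)
    qed
  next
    case False
    show ?thesis
    proof (rule ennreal_le_epsilon)
      fix e :: real assume e: "e > 0"
      \<comment> \<open>The denominator \<open>p + 1\<close> instead of \<open>p\<close> also covers
        \<open>p = 0\<close>.\<close>
      have "?\<mu> E \<le> ennreal p * (emeasure lborel E + ennreal (e / (p+1)))"
        using e p by (intro key) auto
      also have "\<dots> = ennreal p * emeasure lborel E + ennreal (p * (e / (p+1)))"
        using p e by (subst ennreal_mult) (auto simp: distrib_left)
      also have "\<dots> \<le> ennreal p * emeasure lborel E + ennreal e"
        using p e by (intro add_mono ennreal_leI) (auto simp: field_simps)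
      finally show "?\<mu> E \<le> ennreal p * emeasure lborel E + ennreal e" .
    qed
  qed
qed

lemma AE_lborel_null_set:
  assumes "AE x in lborel. P x"
  shows "\<exists>N\<in>null_sets lborel. \<forall>x. x \<notin> N \<longrightarrow> P x"
  by (rule AE_E3[OF assms]) auto

text \<open>Slopes of \<open>f / L\<close> lie between -1 and 1; averaging with the identity moves
  them into the interval from 0 to 1.\<close>

lemma mono_lipschitz_normalize:
  fixes f :: "real \<Rightarrow> real"
  assumes f: "L-lipschitz_on UNIV f" and L: "L > 0"
  shows "mono (\<lambda>x. (f x / L + x) / 2)" "mono (\<lambda>x. x - (f x / L + x) / 2)"
proof -
  have *: "\<bar>f y - f x\<bar> \<le> L * (y - x)" if "x \<le> y" for x y
    using lipschitz_onD[OF f, of x y] that by (simp add: dist_real_def abs_minus_commute)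
  have **: "f y / L - f x / L \<le> y - x" "f x / L - f y / L \<le> y - x" if "x \<le> y" for x y
  proof -
    from *[OF that] have "f y - f x \<le> L * (y - x)" "f x - f y \<le> L * (y - x)" by (simp_all only: abs_le_iff minus_diff_eq)
    with L show "f y / L - f x / L \<le> y - x" "f x / L - f y / L \<le> y - x"
      by (simp_all only: pos_divide_le_eq mult.commute flip: diff_divide_distrib)
  qed
  have half: "(X + p) / 2 \<le> (Y + q) / 2" if "X - Y \<le> q - p" for X Y p q :: real
    using that by simp
  show "mono (\<lambda>x. (f x / L + x) / 2)"
    by (intro monoI half) (rule **)
  have half': "p - (X + p) / 2 \<le> q - (Y + q) / 2" if "Y - X \<le> q - p" for X Y p q :: real
    using that by (simp add: field_simps)
  show "mono (\<lambda>x. x - (f x / L + x) / 2)"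
    by (intro monoI half') (rule **)
qed

text \<open>\<open>id - F\<close> is the normalization of \<open>- f\<close>, which is why the
  quotients of \<open>f\<close> and \<open>- f\<close> undergo the same affine change.\<close>

lemma diff_quot_normalize:
  fixes f :: "real \<Rightarrow> real"
  assumes "h \<noteq> 0" 
  shows "diff_quot (\<lambda>x. (f x / L + x) / 2) 1 x h = (diff_quot f 1 x h / L + 1) / 2"
    "diff_quot (\<lambda>x. x - (f x / L + x) / 2) 1 x h = (diff_quot (\<lambda>x. - f x) 1 x h / L + 1) / 2"
  using assms by (simp_all add: diff_quot_def diff_divide_distrib add_divide_distrib mult_ac)

text \<open>Quotients of a nondecreasing function are nonnegative. This supplies the sign condition
  under which the constant may be read as an \<open>ennreal\<close>.\<close>

lemma frequently_diff_quot_pos: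
  assumes F: "mono (F :: real \<Rightarrow> real)" and fr: "\<exists>\<^sub>F h in at 0. diff_quot F 1 x h < p"
  shows "p > 0"
proof -
  have nn: "diff_quot F 1 x h \<ge> 0" for h
    using monoD[OF F, of x "x + h"] monoD[OF F, of "x + h" x]
    by (cases "h \<ge> 0") (auto simp: diff_quot_def divide_le_0_iff zero_le_divide_iff)
  from frequently_ex[OF fr] nn show ?thesis by (metis le_less_trans)
qed

lemma frequently_diff_quot_normalize:
  fixes f :: "real \<Rightarrow> real"
  assumes L: "L > 0"
  shows "\<exists>\<^sub>F h in at 0. diff_quot f 1 x h < p \<Longrightarrow>
     \<exists>\<^sub>F h in at 0. diff_quot (\<lambda>x. (f x / L + x) / 2) 1 x h < (p / L + 1) / 2"
   "\<exists>\<^sub>F h in at 0. diff_quot (\<lambda>x. - f x) 1 x h < p \<Longrightarrow>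
     \<exists>\<^sub>F h in at 0. diff_quot (\<lambda>x. x - (f x / L + x) / 2) 1 x h < (p / L + 1) / 2"
proof -
  have *: "(q / L + 1) / 2 < (p / L + 1) / 2" if "q < p" for q
    using that L by (simp add: divide_strict_right_mono)
  show "\<exists>\<^sub>F h in at 0. diff_quot (\<lambda>x. (f x / L + x) / 2) 1 x h < (p / L + 1) / 2"
    if "\<exists>\<^sub>F h in at 0. diff_quot f 1 x h < p"
    using that by (rule frequently_mp[rotated])
      (auto simp only: eventually_at_filter diff_quot_normalize * simp_thms intro!: always_eventually)
  show "\<exists>\<^sub>F h in at 0. diff_quot (\<lambda>x. x - (f x / L + x) / 2) 1 x h < (p / L + 1) / 2"
    if "\<exists>\<^sub>F h in at 0. diff_quot (\<lambda>x. - f x) 1 x h < p"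
    using that by (rule frequently_mp[rotated])
      (auto simp only: eventually_at_filter diff_quot_normalize * simp_thms intro!: always_eventually)
qed

text \<open>Hides the formula for \<open>F\<close>. The last clause turns an estimate for
  \<open>F\<close> back into one for increments of \<open>f\<close>.\<close>

lemma lipschitz_normalize:
  fixes f :: "real \<Rightarrow> real"
  assumes f: "L-lipschitz_on UNIV f" and L: "L > 0"
  obtains F where "mono F" "mono (\<lambda>x. x - F x)" "continuous_on UNIV F"
    "\<And>p x. \<exists>\<^sub>F h in at 0. diff_quot f 1 x h < p \<Longrightarrow>
       \<exists>\<^sub>F h in at 0. diff_quot F 1 x h < (p / L + 1) / 2"
    "\<And>p x. \<exists>\<^sub>F h in at 0. diff_quot (\<lambda>x. - f x) 1 x h < p \<Longrightarrow>
       \<exists>\<^sub>F h in at 0. diff_quot (\<lambda>x. x - F x) 1 x h < (p / L + 1) / 2"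
    "\<And>a b. F b - F a = ((f b - f a) / L + (b - a)) / 2"
proof
  show "continuous_on UNIV (\<lambda>x. (f x / L + x) / 2)"
    using L by (intro continuous_intros lipschitz_on_continuous_on[OF f]) auto
  show "(f b / L + b) / 2 - (f a / L + a) / 2 = ((f b - f a) / L + (b - a)) / 2" for a b
    by (simp only: diff_divide_distrib add_divide_distrib)
qed (rule mono_lipschitz_normalize[OF f L] frequently_diff_quot_normalize[OF L], assumption?)+

text \<open>Let \<open>p < r\<close> and let \<open>B\<close> be a bounded part of the set where
  quotients are frequently below \<open>p\<close> and frequently above \<open>r\<close>. The
  measures of \<open>F\<close> and \<open>id - F\<close> give \<open>B\<close> at most
  \<open>?p\<close> and \<open>?r\<close> times its Lebesgue measure, where
  \<open>?p + ?r < 1\<close>, yet together they give all of it. So \<open>B\<close> is null, and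
  countably many rational pairs exhaust the exceptional set.\<close>

lemma lipschitz_AE_derivative_real:
  fixes f :: "real \<Rightarrow> real"
  assumes "L-lipschitz_on UNIV f"
  shows "AE x in lborel. \<exists>D. (diff_quot f 1 x \<longlongrightarrow> D) (at 0)"
proof -
  \<comment> \<open>The normalization divides by the constant, and \<open>L\<close> may be
    0.\<close>
  define M where "M = L + 1"
  have M: "M > 0" "M-lipschitz_on UNIV f"
    using assms lipschitz_on_nonneg[OF assms] by (auto simp: M_def intro: lipschitz_on_mono)
  obtain F where F: "mono F" "mono (\<lambda>x. x - F x)" "continuous_on UNIV F"
    "\<And>p x. \<exists>\<^sub>F h in at 0. diff_quot f 1 x h < p \<Longrightarrow>
       \<exists>\<^sub>F h in at 0. diff_quot F 1 x h < (p / M + 1) / 2"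
    "\<And>p x. \<exists>\<^sub>F h in at 0. diff_quot (\<lambda>x. - f x) 1 x h < p \<Longrightarrow>
       \<exists>\<^sub>F h in at 0. diff_quot (\<lambda>x. x - F x) 1 x h < (p / M + 1) / 2"
    "\<And>a b. F b - F a = ((f b - f a) / M + (b - a)) / 2"
    using lipschitz_normalize[OF M(2,1)] by blast
  note mono = F(1,2)
  have cont: "continuous_on UNIV f" by (rule lipschitz_on_continuous_on[OF assms])
  have null: "{x. \<exists>\<^sub>F h in at 0. diff_quot f 1 x h < p} \<inter>
       {x. \<exists>\<^sub>F h in at 0. diff_quot (\<lambda>x. - f x) 1 x h < - r} \<in> null_sets lborel" (is "?E \<in> _")
    if "p < r" for p r
  proof -
    have EB: "?E \<in> sets borel"
      by (intro sets.Int borel_frequently_diff_quot_less continuous_on_minus cont)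
    \<comment> \<open>Being at most a factor below 1 times itself forces the measure to vanish only
      if it is finite, hence the balls.\<close>
    have "?E \<inter> cball 0 (real n) \<in> null_sets lborel" for n :: nat
    proof (cases "?E = {}")
      case False
      let ?B = "?E \<inter> cball 0 (real n)"
      let ?p = "(p / M + 1) / 2" and ?r = "(- r / M + 1) / 2"
      have EB': "?B \<in> sets borel" using EB by auto
      have fr: "\<exists>\<^sub>F h in at 0. diff_quot F 1 x h < ?p"
          "\<exists>\<^sub>F h in at 0. diff_quot (\<lambda>x. x - F x) 1 x h < ?r" if "x \<in> ?E" for x
        using that F(4)[of x p] F(5)[of x "- r"] by blast+
      have pr: "?p > 0" "?r > 0"
        using False fr frequently_diff_quot_pos[OF mono(1)] frequently_diff_quot_pos[OF mono(2)] by blast+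
      have "?p + ?r = 1 + (p - r) / M / 2" by (simp add: diff_divide_distrib add_divide_distrib)
      also have "\<dots> < 1" using \<open>p < r\<close> M(1) by (simp add: divide_less_0_iff)
      finally have s: "?p + ?r < 1" .
      have fin: "emeasure lborel ?B < \<infinity>"
        using emeasure_mono[of ?B "cball 0 (real n)" lborel] EB emeasure_lborel_cball_finite[of 0 "real n"]
        by (intro le_less_trans[OF _ emeasure_lborel_cball_finite[of 0 "real n"]]) auto
      have "emeasure lborel ?B = emeasure (interval_measure F) ?B + emeasure (interval_measure (\<lambda>x. x - F x)) ?B"
        by (rule emeasure_interval_measure_sum[symmetric, OF mono EB'])
      also have "\<dots> \<le> ennreal ?p * emeasure lborel ?B + ennreal ?r * emeasure lborel ?B"
        using pr fr EB' mono by (intro add_mono emeasure_interval_measure_le_of_dini) auto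
      also have "\<dots> = ennreal (?p + ?r) * emeasure lborel ?B"
        using pr by (subst ennreal_plus) (auto simp: distrib_right)
      finally have le: "emeasure lborel ?B \<le> ennreal (?p + ?r) * emeasure lborel ?B" .
      obtain m where m: "emeasure lborel ?B = ennreal m" "m \<ge> 0"
        using fin by (cases "emeasure lborel ?B") auto
      have "m \<le> (?p + ?r) * m" using le pr m by (simp add: m ennreal_mult[symmetric] del: ennreal_plus)
      then have "(1 - (?p + ?r)) * m \<le> 0" by (simp add: algebra_simps)
      then have "m = 0" using s m by (metis diff_gt_0_iff_gt mult_le_0_iff order_antisym_conv linorder_not_le)
      then show ?thesis using m EB' by (simp add: null_sets_def)
    qed simp
    then have "(\<Union>n::nat. ?E \<inter> cball 0 (real n)) \<in> null_sets lborel" by (intro null_sets_UN) auto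
    moreover have "(\<Union>n::nat. ?E \<inter> cball 0 (real n)) = ?E"
      by (auto intro: real_arch_simple)
    ultimately show ?thesis by simp
  qed
  have "countable {r \<in> \<rat>. p < r}" for p :: real
    by (rule countable_subset[OF _ countable_rat]) auto
  then have "{x. \<not> (\<exists>D. (diff_quot f 1 x \<longlongrightarrow> D) (at 0))} \<in> null_sets lborel"
    unfolding not_tendsto_diff_quot_eq[OF assms]
    by (intro null_sets_UN' countable_rat null) auto
  then show ?thesis by (rule AE_I') auto
qed

text \<open>For each \<open>p > c\<close> the quotients off a null set are eventually below
  \<open>p\<close>, so the covering estimate bounds the Stieltjes mass of the interval, which is
  \<open>F b - F a\<close>; the null set adds nothing to it. Then \<open>p\<close> decreases to
  \<open>c\<close>.\<close>

lemma lipschitz_increment_le_of_AE_derivative: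
  fixes f :: "real \<Rightarrow> real"
  assumes f: "L-lipschitz_on UNIV f" and "a \<le> b"
    and AE: "AE x in lborel. \<exists>D\<le>c. (diff_quot f 1 x \<longlongrightarrow> D) (at 0)"
  shows "f b - f a \<le> c * (b - a)"
proof (cases "a = b")
  case False
  then have ab: "a < b" using assms by simp
  define M where "M = L + 1"
  have M: "M > 0" "M-lipschitz_on UNIV f"
    using f lipschitz_on_nonneg[OF f] by (auto simp: M_def intro: lipschitz_on_mono)
  obtain F where F: "mono F" "mono (\<lambda>x. x - F x)" "continuous_on UNIV F"
    "\<And>p x. \<exists>\<^sub>F h in at 0. diff_quot f 1 x h < p \<Longrightarrow>
       \<exists>\<^sub>F h in at 0. diff_quot F 1 x h < (p / M + 1) / 2"
    "\<And>p x. \<exists>\<^sub>F h in at 0. diff_quot (\<lambda>x. - f x) 1 x h < p \<Longrightarrow>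
       \<exists>\<^sub>F h in at 0. diff_quot (\<lambda>x. x - F x) 1 x h < (p / M + 1) / 2"
    "\<And>a b. F b - F a = ((f b - f a) / M + (b - a)) / 2"
    using lipschitz_normalize[OF M(2,1)] by blast
  note mono = F(1,2)
  have mle: "emeasure (interval_measure F) A \<le> emeasure lborel A" if "A \<in> sets borel" for A
    using emeasure_interval_measure_sum[OF mono that] by (metis le_iff_add)
  obtain N where N: "N \<in> null_sets lborel" "\<And>x. x \<notin> N \<Longrightarrow> \<exists>D\<le>c. (diff_quot f 1 x \<longlongrightarrow> D) (at 0)"
    using AE_lborel_null_set[OF AE] by (elim bexE) (rule that, auto)
  let ?E = "{a..b} - N"
  have NB: "N \<in> sets borel" using N by (simp add: null_sets_def)
  have EB: "?E \<in> sets borel" using NB by auto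
  \<comment> \<open>A point of \<open>?E\<close> is what makes the normalized constant positive in
    \<open>pp\<close>.\<close>
  have "?E \<noteq> {}"
  proof
    assume "?E = {}"
    then have "emeasure lborel {a..b} \<le> emeasure lborel N" using NB by (intro emeasure_mono) auto
    then show False using N(1) ab by (simp add: null_sets_def)
  qed
  have key: "F b - F a \<le> (p / M + 1) / 2 * (b - a)" if p: "p > c" for p
  proof -
    have "\<exists>\<^sub>F h in at 0. diff_quot f 1 x h < p" if "x \<in> ?E" for x
    proof -
      have "x \<notin> N" using that by simp
      from N(2)[OF this] obtain D where D: "D \<le> c" "(diff_quot f 1 x \<longlongrightarrow> D) (at 0)" by auto
      then have "\<forall>\<^sub>F h in at 0. diff_quot f 1 x h < p" using p by (intro order_tendstoD(2)[OF D(2)]) auto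
      then show ?thesis by (rule eventually_frequently[rotated]) simp
    qed
    then have fr: "\<exists>\<^sub>F h in at 0. diff_quot F 1 x h < (p / M + 1) / 2" if "x \<in> ?E" for x
      using that F(4) by blast
    have pp: "(p / M + 1) / 2 > 0"
      using \<open>?E \<noteq> {}\<close> fr frequently_diff_quot_pos[OF mono(1)] by blast
    have mF: "\<And>x y. x \<le> y \<Longrightarrow> F x \<le> F y" using mono(1) by (rule monoD)
    have "ennreal (F b - F a) = emeasure (interval_measure F) {a..b}"
      using emeasure_interval_measure_Icc[of a b F] mF F(3) ab by simp
    also have "\<dots> \<le> emeasure (interval_measure F) (?E \<union> N)"
      using NB by (intro emeasure_mono) auto
    also have "\<dots> \<le> emeasure (interval_measure F) ?E + emeasure (interval_measure F) N"
      using NB EB by (intro emeasure_subadditive) auto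
    also have "emeasure (interval_measure F) N = 0"
      using mle[OF NB] N(1) by (simp add: null_sets_def)
    also have "emeasure (interval_measure F) ?E \<le> ennreal ((p / M + 1) / 2) * emeasure lborel {a..b}"
    proof (rule order_trans)
      show "emeasure (interval_measure F) ?E \<le> ennreal ((p / M + 1) / 2) * emeasure lborel ?E"
        using pp fr EB mono by (intro emeasure_interval_measure_le_of_dini) auto
      show "ennreal ((p / M + 1) / 2) * emeasure lborel ?E \<le> ennreal ((p / M + 1) / 2) * emeasure lborel {a..b}"
        by (intro mult_left_mono emeasure_mono) auto
    qed
    also have "emeasure lborel {a..b} = ennreal (b - a)" using ab by simp
    also have "ennreal ((p / M + 1) / 2) * ennreal (b - a) = ennreal ((p / M + 1) / 2 * (b - a))"
      using pp ab by (intro ennreal_mult[symmetric]) auto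
    finally have "ennreal (F b - F a) \<le> ennreal ((p / M + 1) / 2 * (b - a))" by simp
    moreover have "0 \<le> (p / M + 1) / 2 * (b - a)" using pp ab by (intro mult_nonneg_nonneg) auto
    ultimately show ?thesis by (simp only: ennreal_le_iff)
  qed
  have le: "f b - f a \<le> p * (b - a)" if "p > c" for p
  proof -
    have "(p / M + 1) / 2 * (b - a) = (p / M * (b - a) + (b - a)) / 2" by (simp add: distrib_right)
    then have "((f b - f a) / M + (b - a)) / 2 \<le> (p / M * (b - a) + (b - a)) / 2"
      using key[OF that] unfolding F(6)[of b a] by (simp only:)
    moreover have "X \<le> Y" if "(X + d) / 2 \<le> (Y + d) / 2" for X Y d :: real using that by simp
    ultimately have "(f b - f a) / M \<le> p / M * (b - a)" by blast
    then have "(f b - f a) / M \<le> p * (b - a) / M" by (simp only: times_divide_eq_left)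
    then show ?thesis using M(1) by (simp only: divide_le_cancel)
  qed
  have "(f b - f a) / (b - a) \<le> c"
  proof (rule dense_ge)
    fix p assume "p > c"
    from le[OF this] show "(f b - f a) / (b - a) \<le> p" using ab by (simp only: pos_divide_le_eq diff_gt_0_iff_gt)
  qed
  then show ?thesis using ab by (simp add: pos_divide_le_eq)
qed simp

section \<open>From lines to Euclidean space by Fubini\<close>

lemma AE_lborel_translate:
  fixes N :: "'a::euclidean_space set"
  assumes "N \<in> sets borel" and "AE x in lborel. x + c \<notin> N"
  shows "AE x in lborel. x \<notin> N"
proof -
  have "AE x in distr lborel borel ((+) c). x \<notin> N"
    using assms by (subst AE_distr_iff) (auto simp: add.commute)
  then show ?thesis unfolding lborel_distr_plus .
qed

text \<open>After the two quantifiers are exchanged, the bad set of \<open>x\<close> for fixed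
  \<open>t\<close> is a translate of \<open>N\<close>, and Lebesgue measure is translation
  invariant.\<close>

lemma AE_lborel_lines_iff:
  fixes N :: "'a::euclidean_space set"
  assumes N[measurable]: "N \<in> sets borel"
  shows "(AE x in lborel. AE t::real in lborel. x + t *\<^sub>R v \<notin> N) \<longleftrightarrow> (AE x in lborel. x \<notin> N)"
proof -
  have "(AE x in lborel. AE t::real in lborel. x + t *\<^sub>R v \<notin> N) \<longleftrightarrow>
        (AE t::real in lborel. AE x in lborel. x + t *\<^sub>R v \<notin> N)"
  proof (rule lborel_pair.AE_commute)
    show "{p \<in> space (lborel \<Otimes>\<^sub>M lborel). fst p + snd p *\<^sub>R v \<notin> N} \<in> sets (lborel \<Otimes>\<^sub>M lborel)"
      by measurable
  qed
  also have "\<dots> \<longleftrightarrow> (AE x in lborel. x \<notin> N)"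
  proof
    assume "AE t::real in lborel. AE x in lborel. x + t *\<^sub>R v \<notin> N"
    then obtain Z :: "real set" where Z: "Z \<in> null_sets lborel"
        "\<And>t. t \<notin> Z \<Longrightarrow> AE x in lborel. x + t *\<^sub>R v \<notin> N"
      by (drule_tac AE_lborel_null_set) auto
    \<comment> \<open>A single good \<open>t\<close> is enough, and a null set leaves one.\<close>
    have "Z \<noteq> UNIV" using Z(1) by (auto simp: null_sets_def)
    then obtain t where "AE x in lborel. x + t *\<^sub>R v \<notin> N" using Z(2) by auto
    then show "AE x in lborel. x \<notin> N" by (rule AE_lborel_translate[OF N])
  next
    assume A: "AE x in lborel. x \<notin> N"
    have "AE x in lborel. x + c \<notin> N" for c
    proof -
      have "AE x in distr lborel borel ((+) c). x \<notin> N" using A unfolding lborel_distr_plus .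
      then show ?thesis by (subst (asm) AE_distr_iff) (auto simp: add.commute)
    qed
    then show "AE t::real in lborel. AE x in lborel. x + t *\<^sub>R v \<notin> N" by simp
  qed
  finally show ?thesis .
qed

lemma diff_quot_line: "diff_quot (\<lambda>t. f (x + t *\<^sub>R v)) 1 t = diff_quot f v (x + t *\<^sub>R v)"
  by (simp add: fun_eq_iff diff_quot_def scaleR_left_distrib add.assoc)

lemma lipschitz_on_line:
  fixes f :: "'a::real_normed_vector \<Rightarrow> real"
  assumes "L-lipschitz_on UNIV f"
  shows "(L * norm v)-lipschitz_on UNIV (\<lambda>t. f (x + t *\<^sub>R v))"
proof (rule lipschitz_onI)
  fix s t :: real
  have "dist (x + s *\<^sub>R v) (x + t *\<^sub>R v) = norm v * dist s t"
    by (simp add: dist_norm) (metis mult.commute norm_scaleR real_norm_def scaleR_left_diff_distrib)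
  then show "dist (f (x + s *\<^sub>R v)) (f (x + t *\<^sub>R v)) \<le> L * norm v * dist s t"
    using lipschitz_onD[OF assms, of "x + s *\<^sub>R v" "x + t *\<^sub>R v"] by (simp only: mult.assoc UNIV_I simp_thms)
qed (use lipschitz_on_nonneg[OF assms] in auto)

lemma lipschitz_AE_directional_derivative:
  fixes f :: "'a::euclidean_space \<Rightarrow> real"
  assumes "L-lipschitz_on UNIV f"
  shows "AE x in lborel. \<exists>D. (diff_quot f v x \<longlongrightarrow> D) (at 0)"
proof -
  let ?N = "{x. \<not> (\<exists>D. (diff_quot f v x \<longlongrightarrow> D) (at 0))}"
  have "AE t::real in lborel. x + t *\<^sub>R v \<notin> ?N" for x
    using lipschitz_AE_derivative_real[OF lipschitz_on_line[OF assms, of v x]]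
    by (simp add: diff_quot_line)
  then have "AE x in lborel. AE t::real in lborel. x + t *\<^sub>R v \<notin> ?N" by simp
  then have "AE x in lborel. x \<notin> ?N" using AE_lborel_lines_iff[OF borel_not_tendsto_diff_quot[OF assms]] by blast
  then show ?thesis by simp
qed

text \<open>Almost every line meets the exceptional set in a null set, so the estimate on the line
  from \<open>t = 0\<close> to \<open>t = 1\<close> gives the inequality for almost every
  \<open>x\<close>. By continuity its solution set is closed, hence everything.\<close>

lemma lipschitz_increment_le_of_AE_directional_derivative:
  fixes f :: "'a::euclidean_space \<Rightarrow> real"
  assumes f: "L-lipschitz_on UNIV f"
    and AE: "AE x in lborel. \<exists>D\<le>c. (diff_quot f v x \<longlongrightarrow> D) (at 0)"
  shows "f (x + v) - f x \<le> c"
proof -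
  obtain N where N: "N \<in> null_sets lborel" "\<And>x. x \<notin> N \<Longrightarrow> \<exists>D\<le>c. (diff_quot f v x \<longlongrightarrow> D) (at 0)"
    using AE_lborel_null_set[OF AE] by (elim bexE) (rule that, auto)
  then have "AE x in lborel. AE t::real in lborel. x + t *\<^sub>R v \<notin> N"
    by (subst AE_lborel_lines_iff) (auto simp: null_sets_def intro!: AE_not_in)
  then have "AE x in lborel. f (x + v) - f x \<le> c"
  proof eventually_elim
    case (elim x)
    then have "AE t in lborel. \<exists>D\<le>c. (diff_quot (\<lambda>t. f (x + t *\<^sub>R v)) 1 t \<longlongrightarrow> D) (at 0)"
      by eventually_elim (use N(2) in \<open>auto simp: diff_quot_line\<close>)
    from lipschitz_increment_le_of_AE_derivative[OF lipschitz_on_line[OF f], of 0 1, OF _ this]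
    show ?case by simp
  qed
  have "continuous_on UNIV f" by (rule lipschitz_on_continuous_on[OF f])
  have "continuous_on UNIV (\<lambda>x. f (x + v))"
    by (rule continuous_on_compose2[OF \<open>continuous_on UNIV f\<close>]) (auto intro!: continuous_intros)
  with \<open>continuous_on UNIV f\<close> have "closed {x. f (x + v) - f x \<le> c}"
    by (intro closed_Collect_le continuous_on_diff continuous_on_const)
  with \<open>AE x in lborel. f (x + v) - f x \<le> c\<close> show ?thesis
    using mem_closed_if_AE_lebesgue[of "{x. f (x + v) - f x \<le> c}" x] by (simp add: AE_completion)
qed

subsection \<open>Rademacher's theorem\<close>

lemma integrable_indicator_box: "integrable lborel (indicator (box l u) :: 'a::euclidean_space \<Rightarrow> real)"
  by (rule integrable_real_indicator[OF _ emeasure_lborel_box_finite]) simp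

lemma integrable_indicator_cball: "integrable lborel (indicator (cball c r) :: 'a::euclidean_space \<Rightarrow> real)"
  by (rule integrable_real_indicator[OF _ emeasure_lborel_cball_finite]) simp

text \<open>The function \<open>1 + g / (K + 1)\<close> is almost everywhere nonnegative and, as a
  density, gives every box its volume. It therefore defines Lebesgue measure itself, and densities
  are unique almost everywhere.\<close>

lemma AE_eq_0_of_box_integrals:
  fixes g :: "'a::euclidean_space \<Rightarrow> real"
  assumes g[measurable]: "g \<in> borel_measurable borel" and K: "K \<ge> 0" and bd: "AE x in lborel. \<bar>g x\<bar> \<le> K"
    and int: "\<And>l u. (\<integral>x. indicator (box l u) x * g x \<partial>lborel) = 0"
  shows "AE x in lborel. g x = 0"
proof -
  define h where "h = (\<lambda>x. 1 + g x / (K + 1))"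
  have hm[measurable]: "h \<in> borel_measurable borel" unfolding h_def by measurable
  have pos: "AE x in lborel. 0 \<le> h x" using bd
  proof eventually_elim
    case (elim x)
    then have "- (K + 1) \<le> g x" by linarith
    then have "- 1 \<le> g x / (K + 1)" using K by (simp add: field_simps)
    then show ?case by (simp add: h_def)
  qed
  have "lborel = density lborel (\<lambda>x. ennreal (h x))"
  proof (rule lborel_eqI)
    fix l u :: 'a assume lu: "\<And>b. b \<in> Basis \<Longrightarrow> l \<bullet> b \<le> u \<bullet> b"
    have i1: "integrable lborel (indicator (box l u) :: 'a \<Rightarrow> real)"
      by (rule integrable_indicator_box)
    have i2: "integrable lborel (\<lambda>x. indicator (box l u) x * g x)"
    proof (rule Bochner_Integration.integrable_bound)
      show "integrable lborel (\<lambda>x. indicator (box l u) x * K)" using i1 by (rule integrable_mult_left)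
      show "AE x in lborel. norm (indicator (box l u) x * g x) \<le> norm (indicator (box l u) x * K)"
        using bd by eventually_elim (auto simp: indicator_def)
    qed measurable
    have eq: "(\<lambda>x. indicator (box l u) x * h x) = (\<lambda>x. indicator (box l u) x + indicator (box l u) x * g x / (K + 1))"
      by (auto simp: h_def algebra_simps)
    have "emeasure (density lborel (\<lambda>x. ennreal (h x))) (box l u)
        = (\<integral>\<^sup>+x. ennreal (h x) * indicator (box l u) x \<partial>lborel)"
      by (rule emeasure_density) auto
    also have "\<dots> = (\<integral>\<^sup>+x. ennreal (indicator (box l u) x * h x) \<partial>lborel)"
      by (intro nn_integral_cong) (auto simp: indicator_def)
    also have "\<dots> = ennreal (\<integral>x. indicator (box l u) x * h x \<partial>lborel)"
    proof (rule nn_integral_eq_integral)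
      show "integrable lborel (\<lambda>x. indicator (box l u) x * h x)"
        unfolding eq using i1 i2 by (intro Bochner_Integration.integrable_add integrable_divide)
      show "AE x in lborel. 0 \<le> indicator (box l u) x * h x"
        using pos by eventually_elim (auto simp: indicator_def)
    qed
    also have "(\<integral>x. indicator (box l u) x * h x \<partial>lborel) = measure lborel (box l u)"
      unfolding eq using i1 i2 by (simp add: int)
    also have "ennreal \<dots> = emeasure lborel (box l u)"
      by (rule emeasure_eq_ennreal_measure[symmetric]) (use emeasure_lborel_box_finite[of l u] in auto)
    also have "\<dots> = ennreal (\<Prod>b\<in>Basis. (u - l) \<bullet> b)" using lu by simp
    finally show "emeasure (density lborel (\<lambda>x. ennreal (h x))) (box l u) = (\<Prod>b\<in>Basis. (u - l) \<bullet> b)" .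
  qed simp
  then have "density lborel (\<lambda>x. 1) = density lborel (\<lambda>x. ennreal (h x))" by (simp add: density_1)
  then have "AE x in lborel. 1 = ennreal (h x)" by (subst (asm) sigma_finite_measure.density_unique_iff[OF sigma_finite_lborel]) auto
  with pos show ?thesis
  proof eventually_elim
    case (elim x)
    then have "h x = 1" by (metis ennreal_1 ennreal_inj zero_le_one)
    then show ?case using K by (simp add: h_def)
  qed
qed

lemma integral_lborel_translate:
  fixes g :: "'a::euclidean_space \<Rightarrow> real"
  assumes [measurable]: "g \<in> borel_measurable borel"
  shows "(\<integral>x. g (x + c) \<partial>lborel) = (\<integral>x. g x \<partial>lborel)"
proof -
  have "(\<integral>x. g x \<partial>lborel) = (\<integral>x. g x \<partial>distr lborel borel ((+) c))"
    by (simp only: lborel_distr_plus)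
  also have "\<dots> = (\<integral>x. g (c + x) \<partial>lborel)" by (rule integral_distr) auto
  finally show ?thesis by (simp add: add.commute)
qed

text \<open>Convergence can fail only on the boundary of the box, which is null.\<close>

lemma AE_indicator_box_translate_tendsto:
  fixes c :: "nat \<Rightarrow> 'a::euclidean_space"
  assumes c: "c \<longlonglongrightarrow> 0"
  shows "AE x in lborel. (\<lambda>n. indicator (box l u) (x - c n) :: real) \<longlonglongrightarrow> indicator (box l u) x"
proof -
  have "cbox l u - box l u \<in> null_sets lborel"
    using negligible_frontier_interval[of l u]
    by (subst (asm) negligible_iff_emeasure0) (auto simp: null_sets_def)
  then have "AE x in lborel. x \<notin> cbox l u - box l u" by (rule AE_not_in)
  then show ?thesis
  proof eventually_elim
    case (elim x)
    have lim: "(\<lambda>n. x - c n) \<longlonglongrightarrow> x" using tendsto_diff[OF tendsto_const c, of x] by simp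
    have "\<forall>\<^sub>F n in sequentially. indicator (box l u) (x - c n) = (indicator (box l u) x :: real)"
    proof (cases "x \<in> box l u")
      case True
      from topological_tendstoD[OF lim open_box True] show ?thesis
        by eventually_elim (use True in simp)
    next
      case False
      then have "x \<in> - cbox l u" using elim by auto
      moreover have "open (- cbox l u)" by (simp add: open_Compl closed_cbox)
      ultimately have "\<forall>\<^sub>F n in sequentially. x - c n \<in> - cbox l u"
        using topological_tendstoD[OF lim] by blast
      then show ?thesis
        using False box_subset_cbox[of l u] by (auto simp: indicator_def elim!: eventually_mono)
    qed
    then show ?case by (rule tendsto_eventually)
  qed
qed

lemma diff_quot_add:
  "h \<noteq> 0 \<Longrightarrow> diff_quot f (u + v) x h = diff_quot f u x h + diff_quot f v (x + h *\<^sub>R u) h"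
  by (simp add: diff_quot_def add_divide_distrib diff_divide_distrib scaleR_right_distrib add.assoc)

lemma diff_quot_at_sequence:
  assumes "(diff_quot f v x \<longlongrightarrow> D) (at 0)"
  shows "(\<lambda>n. diff_quot f v x (inverse (real (Suc n)))) \<longlonglongrightarrow> D"
proof (rule filterlim_compose[OF assms])
  show "filterlim (\<lambda>n. inverse (real (Suc n))) (at 0) sequentially"
    unfolding filterlim_at using LIMSEQ_inverse_real_of_nat by (simp del: of_nat_Suc)
qed

text \<open>Integrate \<open>diff_quot_add\<close> over boxes and let \<open>h \<rightarrow> 0\<close>: the shift by \<open>h u\<close> is moved to the indicator of
  the box and disappears in the limit by dominated convergence.\<close>

lemma AE_diff_quot_limit_add:
  fixes f :: "'a::euclidean_space \<Rightarrow> real"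
  assumes f: "L-lipschitz_on UNIV f"
  shows "AE x in lborel. \<forall>A B. (diff_quot f u x \<longlongrightarrow> A) (at 0) \<longrightarrow> (diff_quot f v x \<longlongrightarrow> B) (at 0)
     \<longrightarrow> (diff_quot f (u + v) x \<longlongrightarrow> A + B) (at 0)"
proof -
  define q where "q = (\<lambda>n w x. diff_quot f w x (inverse (real (Suc n))))"
  \<comment> \<open>Defined by \<open>lim\<close> along a sequence, \<open>D w\<close> is a total
    Borel function; it agrees with the directional derivative wherever that exists.\<close>
  define D where "D = (\<lambda>w x. lim (\<lambda>n. q n w x))"
  have cf: "continuous_on UNIV f" by (rule lipschitz_on_continuous_on[OF f])
  have fm[measurable]: "f \<in> borel_measurable borel" by (rule borel_measurable_continuous_onI[OF cf])
  have qm[measurable]: "q n w \<in> borel_measurable borel" for n w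
    unfolding q_def diff_quot_def by measurable
  have Dm[measurable]: "D w \<in> borel_measurable borel" for w
    unfolding D_def by measurable
  have qb: "\<bar>q n w x\<bar> \<le> L * norm w" for n w x
    unfolding q_def by (rule diff_quot_bound[OF f])
  have Dlim: "D w x = A" if "(diff_quot f w x \<longlongrightarrow> A) (at 0)" for w x A
    using diff_quot_at_sequence[OF that] by (simp add: D_def q_def limI)
  have qD: "AE x in lborel. (\<lambda>n. q n w x) \<longlonglongrightarrow> D w x" for w
    using lipschitz_AE_directional_derivative[OF f, of w]
  proof eventually_elim
    case (elim x)
    then obtain A where A: "(diff_quot f w x \<longlongrightarrow> A) (at 0)" ..
    show ?case using diff_quot_at_sequence[OF A] by (simp add: Dlim[OF A] q_def)
  qed
  have Db: "AE x in lborel. \<bar>D w x\<bar> \<le> L * norm w" for w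
    using qD[of w]
  proof eventually_elim
    case (elim x)
    have "(\<lambda>n. \<bar>q n w x\<bar>) \<longlonglongrightarrow> \<bar>D w x\<bar>" using elim by (rule tendsto_rabs)
    then show ?case by (rule LIMSEQ_le_const2) (use qb in auto)
  qed
  have key: "(\<lambda>n. \<integral>x. indicator (box l r) (x - c n) * q n w x \<partial>lborel) \<longlonglongrightarrow> (\<integral>x. indicator (box l r) x * D w x \<partial>lborel)"
    if c: "c \<longlonglongrightarrow> 0" for l r :: 'a and c w
  proof -
    obtain R where R: "\<And>x. x \<in> box l r \<Longrightarrow> norm x \<le> R" using bounded_box[of l r] unfolding bounded_iff by blast
    obtain C where C: "\<And>n. norm (c n) \<le> C"
      using convergent_imp_Bseq[OF convergentI[OF c]] by (auto simp: Bseq_def)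
    show ?thesis
    proof (rule integral_dominated_convergence)
      \<comment> \<open>The boxes shifted by the bounded sequence \<open>c\<close> all stay in one
        ball, whose indicator dominates.\<close>
      show "integrable lborel (\<lambda>x. indicator (cball (0::'a) (R + C)) x * (L * norm w))"
        by (intro integrable_mult_left) (rule integrable_indicator_cball)
      show "AE x in lborel. (\<lambda>n. indicator (box l r) (x - c n) * q n w x) \<longlonglongrightarrow> indicator (box l r) x * D w x"
        using qD[of w] AE_indicator_box_translate_tendsto[OF c, of l r]
        by eventually_elim (rule tendsto_mult)
      fix n
      show "AE x in lborel. norm (indicator (box l r) (x - c n) * q n w x) \<le> indicator (cball 0 (R + C)) x * (L * norm w)"
      proof (rule AE_I2)
        fix x
        have "x \<in> cball 0 (R + C)" if "x - c n \<in> box l r"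
          using R[OF that] C[of n] norm_triangle_ineq[of "x - c n" "c n"] by auto
        then show "norm (indicator (box l r) (x - c n) * q n w x) \<le> indicator (cball 0 (R + C)) x * (L * norm w)"
          using qb[of n w x] lipschitz_on_nonneg[OF f] by (auto simp: indicator_def)
      qed
    qed measurable
  qed
  have int: "integrable lborel (\<lambda>x. indicator (box l r) x * D w x)" for l r :: 'a and w
  proof (rule Bochner_Integration.integrable_bound)
    show "integrable lborel (\<lambda>x. indicator (box l r) x * (L * norm w))"
      by (intro integrable_mult_left) (rule integrable_indicator_box)
    show "AE x in lborel. norm (indicator (box l r) x * D w x) \<le> norm (indicator (box l r) x * (L * norm w))"
      using Db[of w] by eventually_elim (auto simp: indicator_def)
  qed measurable
  have intq: "integrable lborel (\<lambda>x. indicator (box l r) x * q n w (x + z))" for l r z :: 'a and n w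
  proof (rule Bochner_Integration.integrable_bound)
    show "integrable lborel (\<lambda>x. indicator (box l r) x * (L * norm w))"
      by (intro integrable_mult_left) (rule integrable_indicator_box)
    show "AE x in lborel. norm (indicator (box l r) x * q n w (x + z)) \<le> norm (indicator (box l r) x * (L * norm w))"
      using lipschitz_on_nonneg[OF f] by (intro AE_I2) (auto simp: indicator_def intro: order_trans[OF qb])
  qed measurable
  have box0: "(\<integral>x. indicator (box l r) x * (D (u + v) x - D u x - D v x) \<partial>lborel) = 0" for l r :: 'a
  proof -
    define c where "c = (\<lambda>n. inverse (real (Suc n)) *\<^sub>R u)"
    have c0: "c \<longlonglongrightarrow> 0"
      using tendsto_scaleR[OF LIMSEQ_inverse_real_of_nat tendsto_const, of u] by (simp add: c_def)
    have "(\<integral>x. indicator (box l r) x * q n (u + v) x \<partial>lborel) =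
       (\<integral>x. indicator (box l r) x * q n u x \<partial>lborel) + (\<integral>x. indicator (box l r) (x - c n) * q n v x \<partial>lborel)" for n
    proof -
      have "(\<integral>x. indicator (box l r) x * q n (u + v) x \<partial>lborel) =
         (\<integral>x. indicator (box l r) x * q n u x + indicator (box l r) x * q n v (x + c n) \<partial>lborel)"
        unfolding q_def c_def by (subst diff_quot_add) (auto simp: distrib_left)
      also have "\<dots> = (\<integral>x. indicator (box l r) x * q n u x \<partial>lborel) + (\<integral>x. indicator (box l r) x * q n v (x + c n) \<partial>lborel)"
        using intq[of l r n u 0] intq[of l r n v "c n"] by (intro Bochner_Integration.integral_add) simp_all
      also have "(\<integral>x. indicator (box l r) x * q n v (x + c n) \<partial>lborel) =
          (\<integral>x. indicator (box l r) (x - c n) * q n v x \<partial>lborel)"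
        using integral_lborel_translate[of "\<lambda>x. indicator (box l r) (x - c n) * q n v x" "c n"] by simp
      finally show ?thesis .
    qed
    then have "(\<lambda>n. \<integral>x. indicator (box l r) x * q n (u + v) x \<partial>lborel) \<longlonglongrightarrow>
       (\<integral>x. indicator (box l r) x * D u x \<partial>lborel) + (\<integral>x. indicator (box l r) x * D v x \<partial>lborel)"
      using tendsto_add[OF key[of "\<lambda>_. 0" l r u] key[OF c0, of l r v]] by simp
    moreover have "(\<lambda>n. \<integral>x. indicator (box l r) x * q n (u + v) x \<partial>lborel) \<longlonglongrightarrow>
       (\<integral>x. indicator (box l r) x * D (u + v) x \<partial>lborel)"
      using key[of "\<lambda>_. 0" l r "u + v"] by simp
    ultimately have "(\<integral>x. indicator (box l r) x * D (u + v) x \<partial>lborel) =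
      (\<integral>x. indicator (box l r) x * D u x \<partial>lborel) + (\<integral>x. indicator (box l r) x * D v x \<partial>lborel)"
      using LIMSEQ_unique by blast
    then show ?thesis using int[of l r] by (simp add: right_diff_distrib)
  qed
  have "AE x in lborel. D (u + v) x - D u x - D v x = 0"
  proof (rule AE_eq_0_of_box_integrals[where K = "L * norm (u + v) + L * norm u + L * norm v"])
    show "0 \<le> L * norm (u + v) + L * norm u + L * norm v"
      using lipschitz_on_nonneg[OF f] by simp
    show "AE x in lborel. \<bar>D (u + v) x - D u x - D v x\<bar> \<le> L * norm (u + v) + L * norm u + L * norm v"
      using Db[of "u + v"] Db[of u] Db[of v] by eventually_elim linarith
  qed (use box0 in auto)
  with lipschitz_AE_directional_derivative[OF f, of "u + v"] show ?thesis
  proof eventually_elim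
    case (elim x)
    then obtain E where E: "(diff_quot f (u + v) x \<longlongrightarrow> E) (at 0)" by auto
    show ?case
    proof (intro allI impI)
      fix A B assume "(diff_quot f u x \<longlongrightarrow> A) (at 0)" "(diff_quot f v x \<longlongrightarrow> B) (at 0)"
      then have "E = A + B" using elim Dlim E by fastforce
      with E show "(diff_quot f (u + v) x \<longlongrightarrow> A + B) (at 0)" by simp
    qed
  qed
qed

lemma diff_quot_limit_scaleR:
  assumes "(diff_quot f v x \<longlongrightarrow> D) (at 0)"
  shows "(diff_quot f (c *\<^sub>R v) x \<longlongrightarrow> c * D) (at 0)"
proof (cases "c = 0")
  case True
  then show ?thesis by (simp add: diff_quot_def[abs_def])
next
  case False
  have eq: "diff_quot f (c *\<^sub>R v) x h = c * diff_quot f v x (c * h)" for h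
    using False by (simp add: diff_quot_def mult.commute)
  have "filterlim (\<lambda>h. c * h) (at 0) (at 0)"
    using False by (auto simp: filterlim_at eventually_at_filter intro!: tendsto_eq_intros)
  from filterlim_compose[OF assms this] show ?thesis
    unfolding eq[abs_def] by (rule tendsto_mult_left)
qed

text \<open>Additivity and homogeneity, by induction on \<open>S\<close>. The null set depends on
  the coefficients \<open>c\<close>, so only countably many directions can be treated at
  once.\<close>

lemma AE_diff_quot_limit_linear:
  fixes f :: "'a::euclidean_space \<Rightarrow> real"
  assumes f: "L-lipschitz_on UNIV f" and "finite S"
  shows "AE x in lborel. \<forall>D. (\<forall>b\<in>S. (diff_quot f b x \<longlongrightarrow> D b) (at 0)) \<longrightarrow>
     (diff_quot f (\<Sum>b\<in>S. c b *\<^sub>R b) x \<longlongrightarrow> (\<Sum>b\<in>S. c b * D b)) (at 0)"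
  using \<open>finite S\<close>
proof induction
  case empty
  then show ?case by (simp add: diff_quot_def[abs_def])
next
  case (insert b S)
  from AE_diff_quot_limit_add[OF f, of "c b *\<^sub>R b" "\<Sum>b\<in>S. c b *\<^sub>R b"] insert.IH show ?case
  proof eventually_elim
    case (elim x)
    show ?case
    proof (intro allI impI)
      fix D assume D: "\<forall>b\<in>insert b S. (diff_quot f b x \<longlongrightarrow> D b) (at 0)"
      have "(diff_quot f (c b *\<^sub>R b) x \<longlongrightarrow> c b * D b) (at 0)"
        using D by (intro diff_quot_limit_scaleR) auto
      moreover have "(diff_quot f (\<Sum>b\<in>S. c b *\<^sub>R b) x \<longlongrightarrow> (\<Sum>b\<in>S. c b * D b)) (at 0)"
        using D elim by auto
      ultimately show "(diff_quot f (\<Sum>b\<in>insert b S. c b *\<^sub>R b) x \<longlongrightarrow> (\<Sum>b\<in>insert b S. c b * D b)) (at 0)"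
        using elim(1) insert.hyps by simp
    qed
  qed
qed

text \<open>By compactness finitely many directions of \<open>Q\<close> form a \<open>d\<close>-net
  of the unit ball, and along these the quotients converge uniformly. The Lipschitz bound makes
  replacing a unit vector by a nearby net point cheap at every scale \<open>h\<close>.\<close>

lemma lipschitz_has_derivative_of_dense_directions:
  fixes f :: "'a::euclidean_space \<Rightarrow> real"
  assumes f: "L-lipschitz_on UNIV f" and Q: "closure Q = UNIV"
    and lim: "\<And>v. v \<in> Q \<Longrightarrow> (diff_quot f v x \<longlongrightarrow> v \<bullet> g) (at 0)"
  shows "(f has_derivative (\<lambda>v. v \<bullet> g)) (at x)"
  unfolding has_derivative_at_alt
proof (intro conjI allI impI)
  show "bounded_linear (\<lambda>v. v \<bullet> g)" by (rule bounded_linear_inner_left)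
  fix e :: real assume e: "e > 0"
  \<comment> \<open>Three errors are added below: \<open>h * d\<close> from the quotient along
    \<open>q\<close>, \<open>L * (h * d)\<close> from exchanging \<open>w\<close> and
    \<open>q\<close> inside \<open>f\<close>, and \<open>h * d * norm g\<close> from the linear
    part. This \<open>d\<close> makes the sum \<open>h * e\<close>.\<close>
  define d where "d = e / (L + 1 + norm g)"
  have Lg: "L + 1 + norm g > 0" using lipschitz_on_nonneg[OF f] by (simp add: add_nonneg_pos add_pos_nonneg)
  have d: "d > 0" using e Lg by (simp add: d_def)
  have cov: "cball (0::'a) 1 \<subseteq> (\<Union>q\<in>Q. ball q d)"
  proof
    fix w :: 'a
    have "w \<in> closure Q" using Q by simp
    then obtain q where "q \<in> Q" "dist q w < d" using closure_approachable d by blast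
    then show "w \<in> (\<Union>q\<in>Q. ball q d)" by auto
  qed
  obtain T where T: "T \<subseteq> Q" "finite T" "cball (0::'a) 1 \<subseteq> (\<Union>q\<in>T. ball q d)"
    by (rule compactE_image[OF compact_cball _ cov]) auto
  have "\<forall>\<^sub>F h in at 0. \<forall>q\<in>T. \<bar>diff_quot f q x h - q \<bullet> g\<bar> < d"
  proof (intro eventually_ball_finite[OF T(2)] ballI)
    fix q assume "q \<in> T"
    then have "(diff_quot f q x \<longlongrightarrow> q \<bullet> g) (at 0)" using T(1) by (intro lim) auto
    from tendstoD[OF this d] show "\<forall>\<^sub>F h in at 0. \<bar>diff_quot f q x h - q \<bullet> g\<bar> < d"
      by (simp only: dist_real_def)
  qed
  then obtain s where s: "s > 0" "\<And>h. h \<noteq> 0 \<Longrightarrow> \<bar>h\<bar> < s \<Longrightarrow> \<forall>q\<in>T. \<bar>diff_quot f q x h - q \<bullet> g\<bar> < d"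
    unfolding eventually_at by (auto simp: dist_real_def)
  show "\<exists>s>0. \<forall>y. norm (y - x) < s \<longrightarrow> norm (f y - f x - (y - x) \<bullet> g) \<le> e * norm (y - x)"
  proof (intro exI[of _ s] conjI allI impI s(1))
    fix y assume y: "norm (y - x) < s"
    show "norm (f y - f x - (y - x) \<bullet> g) \<le> e * norm (y - x)"
    proof (cases "y = x")
      case False
      define h where "h = norm (y - x)"
      define w where "w = (1 / h) *\<^sub>R (y - x)"
      have h: "h > 0" using False by (simp add: h_def)
      have yw: "y = x + h *\<^sub>R w" using h by (simp add: w_def)
      have "norm w = 1" using h by (simp add: w_def h_def)
      then obtain q where q: "q \<in> T" "norm (q - w) < d" using T(3) by (force simp: dist_norm)
      have "\<bar>diff_quot f q x h - q \<bullet> g\<bar> < d" using s(2)[of h] h y q(1) by (auto simp: h_def)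
      then have "\<bar>(f (x + h *\<^sub>R q) - f x) - h * (q \<bullet> g)\<bar> \<le> h * d"
        using h by (auto simp: diff_quot_def abs_less_iff field_simps)
      moreover have "\<bar>f (x + h *\<^sub>R w) - f (x + h *\<^sub>R q)\<bar> \<le> L * (h * d)"
      proof -
        have "\<bar>f (x + h *\<^sub>R w) - f (x + h *\<^sub>R q)\<bar> \<le> L * norm (h *\<^sub>R (w - q))"
          using lipschitz_onD[OF f, of "x + h *\<^sub>R w" "x + h *\<^sub>R q"] by (simp add: dist_norm scaleR_right_diff_distrib)
        also have "\<dots> \<le> L * (h * d)"
          using q(2) h lipschitz_on_nonneg[OF f] by (auto simp: norm_minus_commute intro!: mult_left_mono)
        finally show ?thesis .
      qed
      moreover have "\<bar>h * (q \<bullet> g) - h * (w \<bullet> g)\<bar> \<le> h * d * norm g"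
      proof -
        have "h * (q \<bullet> g) - h * (w \<bullet> g) = h * ((q - w) \<bullet> g)" by (simp add: algebra_simps)
        then have "\<bar>h * (q \<bullet> g) - h * (w \<bullet> g)\<bar> = h * \<bar>(q - w) \<bullet> g\<bar>" using h by (simp add: abs_mult)
        also have "\<dots> \<le> h * (norm (q - w) * norm g)" using h Cauchy_Schwarz_ineq2 by (intro mult_left_mono) auto
        also have "\<dots> \<le> h * (d * norm g)" using q(2) h by (intro mult_left_mono mult_right_mono) auto
        finally show ?thesis by simp
      qed
      ultimately have "\<bar>f (x + h *\<^sub>R w) - f x - h * (w \<bullet> g)\<bar> \<le> h * d + L * (h * d) + h * d * norm g" by linarith
      also have "\<dots> = h * (d * (L + 1 + norm g))" by (simp add: algebra_simps)
      also have "d * (L + 1 + norm g) = e" using Lg by (simp add: d_def)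
      finally have "\<bar>f (x + h *\<^sub>R w) - f x - h * (w \<bullet> g)\<bar> \<le> h * e" .
      moreover have "(y - x) \<bullet> g = h * (w \<bullet> g)" by (simp add: yw)
      ultimately show ?thesis by (simp add: h_def[symmetric] yw[symmetric] mult.commute)
    qed simp
  qed
qed

text \<open>The partial derivatives supply the candidate gradient \<open>g\<close>. Null sets can be
  united only countably often, so the formula for directional derivatives is secured on a countable
  dense set of directions.\<close>

theorem rademacher_real:
  fixes f :: "'a::euclidean_space \<Rightarrow> real"
  assumes f: "L-lipschitz_on UNIV f"
  shows "AE x in lborel. f differentiable (at x)"
proof -
  obtain Q :: "'a set" where Q: "countable Q" "closure Q = UNIV"
    using separable[of UNIV] by (metis top.extremum_uniqueI)
  have "AE x in lborel. \<forall>b\<in>Basis. \<exists>D. (diff_quot f b x \<longlongrightarrow> D) (at 0)"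
    by (intro AE_finite_allI lipschitz_AE_directional_derivative[OF f]) simp
  moreover have "AE x in lborel. \<forall>q\<in>Q. \<forall>D. (\<forall>b\<in>Basis. (diff_quot f b x \<longlongrightarrow> D b) (at 0)) \<longrightarrow>
     (diff_quot f (\<Sum>b\<in>Basis. (q \<bullet> b) *\<^sub>R b) x \<longlongrightarrow> (\<Sum>b\<in>Basis. (q \<bullet> b) * D b)) (at 0)"
    by (simp only: AE_ball_countable[OF Q(1)] ball_simps) (intro ballI AE_diff_quot_limit_linear[OF f] finite_Basis)
  ultimately show ?thesis
  proof eventually_elim
    case (elim x)
    from bchoice[OF elim(1)] obtain D where D: "\<forall>b\<in>Basis. (diff_quot f b x \<longlongrightarrow> D b) (at 0)" ..
    define g where "g = (\<Sum>b\<in>Basis. D b *\<^sub>R b)"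
    have "(diff_quot f q x \<longlongrightarrow> q \<bullet> g) (at 0)" if "q \<in> Q" for q
    proof -
      have "(diff_quot f (\<Sum>b\<in>Basis. (q \<bullet> b) *\<^sub>R b) x \<longlongrightarrow> (\<Sum>b\<in>Basis. (q \<bullet> b) * D b)) (at 0)"
        using elim(2) that D by blast
      then show ?thesis by (simp add: euclidean_representation g_def inner_sum_right mult.commute)
    qed
    from lipschitz_has_derivative_of_dense_directions[OF f Q(2) this] show ?case
      by (auto simp: differentiable_def)
  qed
qed

theorem rademacher:
  fixes f :: "'a::euclidean_space \<Rightarrow> 'b::euclidean_space"
  assumes f: "L-lipschitz_on UNIV f"
  shows "AE x in lborel. f differentiable (at x)"
proof -
  have "AE x in lborel. \<forall>b\<in>Basis. (\<lambda>x. f x \<bullet> b) differentiable (at x)"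
  proof (intro AE_finite_allI finite_Basis)
    fix b :: 'b assume b: "b \<in> Basis"
    have "L-lipschitz_on UNIV (\<lambda>x. f x \<bullet> b)"
    proof (rule lipschitz_onI)
      fix x y
      have "dist (f x \<bullet> b) (f y \<bullet> b) \<le> dist (f x) (f y)"
        using Basis_le_norm[OF b, of "f x - f y"] by (simp add: dist_norm inner_diff_left)
      also have "\<dots> \<le> L * dist x y" using lipschitz_onD[OF f] by simp
      finally show "dist (f x \<bullet> b) (f y \<bullet> b) \<le> L * dist x y" .
    qed (rule lipschitz_on_nonneg[OF f])
    then show "AE x in lborel. (\<lambda>x. f x \<bullet> b) differentiable (at x)" by (rule rademacher_real)
  qed
  then show ?thesis
    by eventually_elim (subst differentiable_componentwise_within, simp)
qed

subsection \<open>Proximal map and Moreau envelope\<close>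

text \<open>The second difference \<open>S t u v\<close> is symmetric in \<open>u\<close> and
  \<open>v\<close>, and by the mean value theorem it equals
  \<open>t\<^sup>2 * (H u \<bullet> v)\<close> up to \<open>o(t\<^sup>2)\<close>. Differentiability
  of \<open>G\<close> at the single point \<open>y\<close> suffices for this expansion.\<close>

lemma hessian_symmetric:
  fixes e :: "'a::real_inner \<Rightarrow> real" and G :: "'a \<Rightarrow> 'a"
  assumes e: "\<And>x. (e has_derivative (\<lambda>d. G x \<bullet> d)) (at x)" and G: "(G has_derivative H) (at y)"
  shows "H u \<bullet> v = H v \<bullet> u"
proof -
  have lin: "linear H" using has_derivative_linear[OF G] .
  define S where "S = (\<lambda>t u v. e (y + t *\<^sub>R u + t *\<^sub>R v) - e (y + t *\<^sub>R u) - e (y + t *\<^sub>R v) + e y)"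
  have key: "\<exists>s>0. \<forall>t. 0 < t \<and> t < s \<longrightarrow> \<bar>S t u v - t\<^sup>2 * (H u \<bullet> v)\<bar> \<le> t\<^sup>2 * (2 * \<epsilon> * (norm u + norm v) * norm v)"
    if \<epsilon>: "\<epsilon> > 0" for u v \<epsilon>
  proof -
    obtain d where d: "d > 0" "\<And>w. norm (w - y) < d \<Longrightarrow> norm (G w - G y - H (w - y)) \<le> \<epsilon> * norm (w - y)"
      using G \<epsilon> unfolding has_derivative_at_alt by blast
    show ?thesis
    proof (intro exI[of _ "d / (norm u + norm v + 1)"] conjI allI impI)
      show "d / (norm u + norm v + 1) > 0" using d by (simp add: add_nonneg_pos)
      fix t assume t: "0 < t \<and> t < d / (norm u + norm v + 1)"
      then have td: "t * (norm u + norm v + 1) < d" by (simp add: pos_less_divide_eq add_nonneg_pos)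
      \<comment> \<open>\<open>\<psi>\<close> runs in direction \<open>t v\<close> with and without
        the offset \<open>t u\<close>, so \<open>\<psi> 1 - \<psi> 0\<close> is the second
        difference, and its derivative compares \<open>G\<close> at two points near
        \<open>y\<close>.\<close>
      define \<psi> where "\<psi> = (\<lambda>s. e (y + t *\<^sub>R u + s *\<^sub>R (t *\<^sub>R v)) - e (y + s *\<^sub>R (t *\<^sub>R v)))"
      define \<psi>' where "\<psi>' = (\<lambda>s. (G (y + t *\<^sub>R u + s *\<^sub>R (t *\<^sub>R v)) - G (y + s *\<^sub>R (t *\<^sub>R v))) \<bullet> (t *\<^sub>R v))"
      have der: "(\<psi> has_real_derivative \<psi>' s) (at s)" for s
      proof -
        have "((\<lambda>s. e (z + s *\<^sub>R w)) has_derivative (\<lambda>h. G (z + s *\<^sub>R w) \<bullet> (h *\<^sub>R w))) (at s)" for z w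
          by (rule has_derivative_compose[OF _ e]) (auto intro!: derivative_eq_intros)
        from has_derivative_diff[OF this this] show ?thesis
          unfolding \<psi>_def \<psi>'_def has_field_derivative_def
          by (rule has_derivative_eq_rhs) (auto simp: inner_diff_left algebra_simps)
      qed
      obtain \<xi> where \<xi>: "0 < \<xi>" "\<xi> < 1" "\<psi> 1 - \<psi> 0 = \<psi>' \<xi>"
        using MVT2[of 0 1 \<psi> \<psi>'] der by auto
      have S: "S t u v = \<psi> 1 - \<psi> 0" by (simp add: S_def \<psi>_def)
      define r where "r = (\<lambda>w. G (y + w) - G y - H w)"
      have r: "norm (r w) \<le> \<epsilon> * (t * (norm u + norm v))" if "norm w \<le> t * (norm u + norm v)" for w
      proof -
        have "norm w < d" using that td t by (simp add: distrib_left)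
        then have "norm (r w) \<le> \<epsilon> * norm w" using d(2)[of "y + w"] by (simp add: r_def)
        also have "\<dots> \<le> \<epsilon> * (t * (norm u + norm v))" using that \<epsilon> by (intro mult_left_mono) auto
        finally show ?thesis .
      qed
      have \<xi>v: "norm (\<xi> *\<^sub>R t *\<^sub>R v) \<le> t * norm v" using \<xi> t by (simp add: mult_left_le_one_le)
      have "t * norm v \<le> t * (norm u + norm v)" using t by (intro mult_left_mono) auto
      with \<xi>v have b1: "norm (\<xi> *\<^sub>R t *\<^sub>R v) \<le> t * (norm u + norm v)" by (rule order_trans)
      have b2: "norm (t *\<^sub>R u + \<xi> *\<^sub>R t *\<^sub>R v) \<le> t * (norm u + norm v)"
      proof -
        have "norm (t *\<^sub>R u) = t * norm u" using t by simp
        then show ?thesis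
          using norm_triangle_ineq[of "t *\<^sub>R u" "\<xi> *\<^sub>R t *\<^sub>R v"] \<xi>v
          unfolding distrib_left by linarith
      qed
      have "\<psi>' \<xi> = (t *\<^sub>R H u + r (t *\<^sub>R u + \<xi> *\<^sub>R t *\<^sub>R v) - r (\<xi> *\<^sub>R t *\<^sub>R v)) \<bullet> (t *\<^sub>R v)"
        by (simp add: \<psi>'_def r_def linear_add[OF lin] linear_scale[OF lin] add.assoc)
      then have "S t u v - t\<^sup>2 * (H u \<bullet> v) = t * ((r (t *\<^sub>R u + \<xi> *\<^sub>R t *\<^sub>R v) - r (\<xi> *\<^sub>R t *\<^sub>R v)) \<bullet> v)"
        by (simp add: S \<xi>(3) inner_add_left inner_diff_left power2_eq_square algebra_simps)
      also have "\<bar>\<dots>\<bar> \<le> t * ((2 * (\<epsilon> * (t * (norm u + norm v)))) * norm v)"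
      proof -
        have "\<bar>(r (t *\<^sub>R u + \<xi> *\<^sub>R t *\<^sub>R v) - r (\<xi> *\<^sub>R t *\<^sub>R v)) \<bullet> v\<bar>
           \<le> norm (r (t *\<^sub>R u + \<xi> *\<^sub>R t *\<^sub>R v) - r (\<xi> *\<^sub>R t *\<^sub>R v)) * norm v"
          by (rule Cauchy_Schwarz_ineq2)
        also have "\<dots> \<le> (2 * (\<epsilon> * (t * (norm u + norm v)))) * norm v"
          using r[OF b1] r[OF b2] norm_triangle_ineq4[of "r (t *\<^sub>R u + \<xi> *\<^sub>R t *\<^sub>R v)" "r (\<xi> *\<^sub>R t *\<^sub>R v)"]
          by (intro mult_right_mono) auto
        finally show ?thesis using t by (simp add: abs_mult mult_left_mono)
      qed
      finally show "\<bar>S t u v - t\<^sup>2 * (H u \<bullet> v)\<bar> \<le> t\<^sup>2 * (2 * \<epsilon> * (norm u + norm v) * norm v)"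
        by (simp add: power2_eq_square mult_ac)
    qed
  qed
  have bound: "\<bar>H u \<bullet> v - H v \<bullet> u\<bar> \<le> \<epsilon> * (2 * (norm u + norm v)\<^sup>2)" if \<epsilon>: "\<epsilon> > 0" for \<epsilon>
  proof -
    obtain s1 where s1: "s1 > 0" "\<And>t. 0 < t \<and> t < s1 \<Longrightarrow> \<bar>S t u v - t\<^sup>2 * (H u \<bullet> v)\<bar> \<le> t\<^sup>2 * (2 * \<epsilon> * (norm u + norm v) * norm v)"
      using key[OF \<epsilon>, of u v] by blast
    obtain s2 where s2: "s2 > 0" "\<And>t. 0 < t \<and> t < s2 \<Longrightarrow> \<bar>S t v u - t\<^sup>2 * (H v \<bullet> u)\<bar> \<le> t\<^sup>2 * (2 * \<epsilon> * (norm v + norm u) * norm u)"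
      using key[OF \<epsilon>, of v u] by blast
    define t where "t = min s1 s2 / 2"
    have t: "0 < t" "t < s1" "t < s2" using s1 s2 by (auto simp: t_def)
    have "S t v u = S t u v" by (simp add: S_def add_ac)
    then have "\<bar>t\<^sup>2 * (H u \<bullet> v) - t\<^sup>2 * (H v \<bullet> u)\<bar>
        \<le> t\<^sup>2 * (2 * \<epsilon> * (norm u + norm v) * norm v) + t\<^sup>2 * (2 * \<epsilon> * (norm v + norm u) * norm u)"
      using s1(2)[of t] s2(2)[of t] t by auto
    also have "\<dots> = t\<^sup>2 * (\<epsilon> * (2 * (norm u + norm v)\<^sup>2))" by (simp add: power2_eq_square algebra_simps)
    also have "\<bar>t\<^sup>2 * (H u \<bullet> v) - t\<^sup>2 * (H v \<bullet> u)\<bar> = t\<^sup>2 * \<bar>H u \<bullet> v - H v \<bullet> u\<bar>"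
      by (simp add: abs_mult flip: right_diff_distrib)
    finally show ?thesis using t by simp
  qed
  have "\<bar>H u \<bullet> v - H v \<bullet> u\<bar> \<le> 0"
  proof (rule field_le_epsilon)
    fix \<epsilon> :: real assume "\<epsilon> > 0"
    define c where "c = 2 * (norm u + norm v)\<^sup>2 + 1"
    have c: "c > 0" by (simp add: c_def add_nonneg_pos)
    have "\<bar>H u \<bullet> v - H v \<bullet> u\<bar> \<le> \<epsilon> / c * (2 * (norm u + norm v)\<^sup>2)" using bound[of "\<epsilon> / c"] \<open>\<epsilon> > 0\<close> c by simp
    also have "\<dots> \<le> \<epsilon> / c * c" using \<open>\<epsilon> > 0\<close> c by (intro mult_left_mono) (auto simp: c_def)
    finally show "\<bar>H u \<bullet> v - H v \<bullet> u\<bar> \<le> 0 + \<epsilon>" using c by simp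
  qed
  then show ?thesis by simp
qed

text \<open>The mean value theorem is applied to the remainder itself: its derivative along the
  segment is the first-order error of \<open>G\<close> at \<open>y\<close>, paired with
  \<open>w\<close>.\<close>

lemma second_order_expansion:
  fixes e :: "'a::real_inner \<Rightarrow> real" and G :: "'a \<Rightarrow> 'a"
  assumes e: "\<And>x. (e has_derivative (\<lambda>d. G x \<bullet> d)) (at x)" and G: "(G has_derivative H) (at y)"
    and \<epsilon>: "\<epsilon> > 0"
  shows "\<exists>s>0. \<forall>w. norm w < s \<longrightarrow> \<bar>e (y + w) - e y - G y \<bullet> w - (H w \<bullet> w) / 2\<bar> \<le> \<epsilon> * (norm w)\<^sup>2"
proof -
  have lin: "linear H" using has_derivative_linear[OF G] .
  obtain d where d: "d > 0" "\<And>w. norm (w - y) < d \<Longrightarrow> norm (G w - G y - H (w - y)) \<le> \<epsilon> * norm (w - y)"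
    using G \<epsilon> unfolding has_derivative_at_alt by blast
  show ?thesis
  proof (intro exI[of _ d] conjI allI impI d(1))
    fix w :: 'a assume w: "norm w < d"
    define \<psi> where "\<psi> = (\<lambda>s. e (y + s *\<^sub>R w) - s * (G y \<bullet> w) - s\<^sup>2 * ((H w \<bullet> w) / 2))"
    define \<psi>' where "\<psi>' = (\<lambda>s. (G (y + s *\<^sub>R w) - G y - s *\<^sub>R H w) \<bullet> w)"
    have der: "(\<psi> has_real_derivative \<psi>' s) (at s)" for s
    proof -
      have "((\<lambda>s. e (y + s *\<^sub>R w)) has_derivative (\<lambda>h. G (y + s *\<^sub>R w) \<bullet> (h *\<^sub>R w))) (at s)"
        by (rule has_derivative_compose[OF _ e]) (auto intro!: derivative_eq_intros)
      then have "((\<lambda>s. e (y + s *\<^sub>R w)) has_real_derivative (G (y + s *\<^sub>R w) \<bullet> w)) (at s)"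
        unfolding has_field_derivative_def by (rule has_derivative_eq_rhs) (simp add: fun_eq_iff mult.commute)
      then show ?thesis unfolding \<psi>_def \<psi>'_def
        by (auto intro!: derivative_eq_intros simp: inner_diff_left)
    qed
    obtain \<xi> where \<xi>: "0 < \<xi>" "\<xi> < 1" "\<psi> 1 - \<psi> 0 = \<psi>' \<xi>"
      using MVT2[of 0 1 \<psi> \<psi>'] der by auto
    have \<xi>w: "norm (\<xi> *\<^sub>R w) \<le> norm w" using \<xi> by (simp add: mult_left_le_one_le)
    have "norm (G (y + \<xi> *\<^sub>R w) - G y - H (\<xi> *\<^sub>R w)) \<le> \<epsilon> * norm (\<xi> *\<^sub>R w)"
      using d(2)[of "y + \<xi> *\<^sub>R w"] \<xi>w w by simp
    also have "\<dots> \<le> \<epsilon> * norm w" using \<xi>w \<epsilon> by (intro mult_left_mono) auto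
    finally have *: "norm (G (y + \<xi> *\<^sub>R w) - G y - \<xi> *\<^sub>R H w) \<le> \<epsilon> * norm w"
      by (simp add: linear_scale[OF lin])
    have "\<bar>\<psi>' \<xi>\<bar> \<le> norm (G (y + \<xi> *\<^sub>R w) - G y - \<xi> *\<^sub>R H w) * norm w"
      unfolding \<psi>'_def by (rule Cauchy_Schwarz_ineq2)
    also have "\<dots> \<le> (\<epsilon> * norm w) * norm w" using * by (rule mult_right_mono) simp
    finally have "\<bar>\<psi> 1 - \<psi> 0\<bar> \<le> \<epsilon> * (norm w)\<^sup>2" using \<xi>(3) by (simp add: power2_eq_square mult.assoc)
    moreover have "\<psi> 1 - \<psi> 0 = e (y + w) - e y - G y \<bullet> w - (H w \<bullet> w) / 2" by (simp add: \<psi>_def)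
    ultimately show "\<bar>e (y + w) - e y - G y \<bullet> w - (H w \<bullet> w) / 2\<bar> \<le> \<epsilon> * (norm w)\<^sup>2" by simp
  qed
qed

section \<open>Weakly convex functions on their domain\<close>

text \<open>A domain \<open>D\<close> and a real-valued \<open>f\<close> replace the extended-valued
  function, so that all arithmetic is real. Lower semicontinuity is encoded as closedness of the
  epigraph.\<close>

locale weakly_convex_on =
  fixes D :: "'a::euclidean_space set" and f :: "'a \<Rightarrow> real" and \<rho> :: real
  assumes nonempty: "D \<noteq> {}"
    and closed_epi: "closed {(x, a). x \<in> D \<and> f x \<le> a}"
    and rho: "\<rho> \<ge> 0"
    and conv: "\<And>x y l. x \<in> D \<Longrightarrow> y \<in> D \<Longrightarrow> 0 < l \<Longrightarrow> l < 1 \<Longrightarrow> (1 - l) *\<^sub>R x + l *\<^sub>R y \<in> D"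
    and wconv: "\<And>x y l. x \<in> D \<Longrightarrow> y \<in> D \<Longrightarrow> 0 < l \<Longrightarrow> l < 1 \<Longrightarrow>
      f ((1 - l) *\<^sub>R x + l *\<^sub>R y) \<le> (1 - l) * f x + l * f y + \<rho> / 2 * l * (1 - l) * (norm (x - y))\<^sup>2"
begin

text \<open>The global proximal subgradient inequality with modulus \<open>\<rho>\<close>. For
  weakly convex functions its solutions are exactly the limiting subgradients, as
  \<open>gph_subdifferential_eq\<close> shows.\<close>

definition gph :: "('a \<times> 'a) set" where
  "gph = {(x, v). x \<in> D \<and> (\<forall>p\<in>D. f x + v \<bullet> (p - x) - \<rho> / 2 * (norm (p - x))\<^sup>2 \<le> f p)}"

lemma lsc_seq:
  assumes "\<And>n. X n \<in> D" "X \<longlonglongrightarrow> x" "\<And>n. f (X n) \<le> c n" "c \<longlonglongrightarrow> c0"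
  shows "x \<in> D \<and> f x \<le> c0"
proof -
  have "(x, c0) \<in> {(x, a). x \<in> D \<and> f x \<le> a}"
  proof (rule closed_sequentially[OF closed_epi])
    show "(\<lambda>n. (X n, c n)) \<longlonglongrightarrow> (x, c0)" by (rule tendsto_Pair[OF assms(2,4)])
  qed (use assms in auto)
  then show ?thesis by simp
qed

lemma gph_hypomonotone:
  assumes "(x, v) \<in> gph" "(x', v') \<in> gph"
  shows "(v - v') \<bullet> (x - x') \<ge> - \<rho> * (norm (x - x'))\<^sup>2"
proof -
  have "f x + v \<bullet> (x' - x) - \<rho> / 2 * (norm (x' - x))\<^sup>2 \<le> f x'"
    "f x' + v' \<bullet> (x - x') - \<rho> / 2 * (norm (x - x'))\<^sup>2 \<le> f x"
    using assms by (auto simp: gph_def)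
  moreover have "norm (x' - x) = norm (x - x')" by (rule norm_minus_commute)
  moreover have "v \<bullet> (x' - x) = - (v \<bullet> (x - x'))" by (simp add: inner_diff_right)
  ultimately show ?thesis by (simp add: inner_diff_left)
qed

end

lemma norm_convex_combination_sq:
  fixes p q y :: "'a::real_inner"
  shows "(norm ((1 - l) *\<^sub>R p + l *\<^sub>R q - y))\<^sup>2
    = (1 - l) * (norm (p - y))\<^sup>2 + l * (norm (q - y))\<^sup>2 - l * (1 - l) * (norm (p - q))\<^sup>2"
  unfolding power2_norm_eq_inner
  by (simp add: inner_add_left inner_add_right inner_diff_left inner_diff_right inner_commute power2_eq_square algebra_simps)

section \<open>Proximal map and Moreau envelope for a fixed parameter\<close>

locale prox_on = weakly_convex_on +
  fixes \<mu> :: real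
  assumes lam: "\<mu> > 0" and lam_rho: "\<mu> * \<rho> < 1"
begin

definition F :: "'a \<Rightarrow> 'a \<Rightarrow> real" where
  "F y p = f p + (norm (p - y))\<^sup>2 / (2 * \<mu>)"

text \<open>The modulus of strong convexity of \<open>F y\<close>: the quadratic term contributes
  \<open>1 / \<mu>\<close> and weak convexity costs \<open>\<rho>\<close>.\<close>

definition kap :: real where "kap = 1 / \<mu> - \<rho>"

lemma kap: "kap > 0"
  using lam lam_rho pos_less_divide_eq[of \<mu> \<rho> 1] by (simp add: kap_def mult.commute)

lemma F_strongly_convex:
  assumes "p \<in> D" "q \<in> D" "0 < l" "l < 1"
  shows "F y ((1 - l) *\<^sub>R p + l *\<^sub>R q)
    \<le> (1 - l) * F y p + l * F y q - kap / 2 * l * (1 - l) * (norm (p - q))\<^sup>2"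
proof -
  have "(norm ((1 - l) *\<^sub>R p + l *\<^sub>R q - y))\<^sup>2 / (2 * \<mu>) = (1 - l) * ((norm (p - y))\<^sup>2 / (2 * \<mu>))
     + l * ((norm (q - y))\<^sup>2 / (2 * \<mu>)) - 1 / \<mu> / 2 * l * (1 - l) * (norm (p - q))\<^sup>2"
    unfolding norm_convex_combination_sq by (simp add: add_divide_distrib diff_divide_distrib)
  moreover have "(1 - l) * (fp + a) + l * (fq + b) - (k - \<rho>) / 2 * l * (1 - l) * n =
      ((1 - l) * fp + l * fq + \<rho> / 2 * l * (1 - l) * n) + ((1 - l) * a + l * b - k / 2 * l * (1 - l) * n)"
    for fp fq a b k n :: real by (simp add: field_simps)
  ultimately show ?thesis using wconv[OF assms]
    unfolding F_def kap_def by (metis add_mono order_refl)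
qed

lemma F_lsc_seq:
  assumes X: "\<And>n. X n \<in> D" "X \<longlonglongrightarrow> x" and c: "\<And>n. F y (X n) \<le> c n" "c \<longlonglongrightarrow> c0"
  shows "x \<in> D \<and> F y x \<le> c0"
proof -
  have "x \<in> D \<and> f x \<le> c0 - (norm (x - y))\<^sup>2 / (2 * \<mu>)"
  proof (rule lsc_seq[OF X])
    show "(\<lambda>n. c n - (norm (X n - y))\<^sup>2 / (2 * \<mu>)) \<longlonglongrightarrow> c0 - (norm (x - y))\<^sup>2 / (2 * \<mu>)"
      using lam by (intro tendsto_intros c X) auto
    show "f (X n) \<le> c n - (norm (X n - y))\<^sup>2 / (2 * \<mu>)" for n
      using c(1)[of n] by (simp add: F_def)
  qed
  then show ?thesis by (simp add: F_def)
qed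

lemma F_bounded_below_cball: "\<exists>m. \<forall>p\<in>D \<inter> cball x0 R. m \<le> F y p"
proof (rule ccontr)
  assume no: "\<not> ?thesis"
  have "\<forall>n::nat. \<exists>p. p \<in> D \<inter> cball x0 R \<and> F y p < - real n"
    using no by (metis not_le)
  then obtain X where X: "\<And>n. X n \<in> D \<inter> cball x0 R" "\<And>n. F y (X n) < - real n" by metis
  obtain x r where r: "strict_mono r" "(X \<circ> r) \<longlonglongrightarrow> x"
    using X(1) compact_cball[of x0 R] unfolding compact_def by (metis Int_iff)
  have "F y x \<le> - real k" for k
  proof -
    have "x \<in> D \<and> F y x \<le> - real k"
    proof (rule F_lsc_seq)
      \<comment> \<open>The tail from index \<open>k\<close> on has values below \<open>- k\<close>,
        and semicontinuity hands this bound to the limit \<open>x\<close> for every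
        \<open>k\<close>.\<close>
      show "(\<lambda>n. X (r (n + k))) \<longlonglongrightarrow> x" using LIMSEQ_ignore_initial_segment[OF r(2), of k] by (simp add: o_def)
      show "F y (X (r (n + k))) \<le> - real k" for n
        using X(2)[of "r (n + k)"] seq_suble[OF r(1), of "n + k"] by linarith
    qed (use X in auto)
    then show ?thesis ..
  qed
  moreover obtain k :: nat where "- F y x < real k" using reals_Archimedean2 by blast
  ultimately show False by (smt (verit))
qed

lemma F_attains_cball:
  assumes "x0 \<in> D" "R \<ge> 0"
  shows "\<exists>p\<in>D \<inter> cball x0 R. \<forall>q\<in>D \<inter> cball x0 R. F y p \<le> F y q"
proof -
  let ?A = "F y ` (D \<inter> cball x0 R)"
  have ne: "?A \<noteq> {}" using assms by auto
  have bdd: "bdd_below ?A" using F_bounded_below_cball[of x0 R y] by (auto simp: bdd_below_def)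
  have "\<exists>p. p \<in> D \<inter> cball x0 R \<and> F y p < Inf ?A + inverse (real (Suc n))" for n
    using cInf_lessD[OF ne, of "Inf ?A + inverse (real (Suc n))"] by auto
  then obtain X where X: "\<And>n. X n \<in> D \<inter> cball x0 R" "\<And>n. F y (X n) < Inf ?A + inverse (real (Suc n))" by metis
  obtain x r where r: "x \<in> cball x0 R" "strict_mono r" "(X \<circ> r) \<longlonglongrightarrow> x"
    using X(1) compact_cball[of x0 R] unfolding compact_def by (metis Int_iff)
  have "(\<lambda>n. Inf ?A + inverse (real (Suc n))) \<longlonglongrightarrow> Inf ?A"
    using LIMSEQ_inverse_real_of_nat_add by auto
  from LIMSEQ_subseq_LIMSEQ[OF this r(2)]
  have "x \<in> D \<and> F y x \<le> Inf ?A"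
    by (rule F_lsc_seq[rotated 3]) (use X r(3) in \<open>auto simp: o_def intro: less_imp_le\<close>)
  then show ?thesis using r(1) bdd by (meson IntI cInf_lower image_eqI order_trans)
qed

text \<open>Strong convexity makes \<open>F y\<close> coercive: for a far point \<open>p\<close>,
  the point at distance 1 from \<open>x0\<close> towards \<open>p\<close> has value at least
  \<open>m\<close>, which forces \<open>F y p\<close> above \<open>F y x0\<close>. A minimizer on a
  large ball is then global.\<close>

lemma F_attains: "\<exists>p\<in>D. \<forall>q\<in>D. F y p \<le> F y q"
proof -
  obtain x0 where x0: "x0 \<in> D" using nonempty by blast
  obtain m where m: "\<And>p. p \<in> D \<inter> cball x0 1 \<Longrightarrow> m \<le> F y p" using F_bounded_below_cball by blast
  \<comment> \<open>\<open>R\<close> solves \<open>kap / 2 * (R - 1) = F y x0 - m\<close>, the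
    break-even distance in \<open>far\<close>.\<close>
  define R where "R = 1 + 2 * (F y x0 - m) / kap"
  have mx: "m \<le> F y x0" using m[of x0] x0 by simp
  have R: "R \<ge> 1" using mx kap by (simp add: R_def)
  have far: "F y x0 < F y p" if p: "p \<in> D" "p \<notin> cball x0 R" for p
  proof -
    define r where "r = norm (p - x0)"
    have r: "r > R" using p by (simp add: r_def dist_norm norm_minus_commute)
    have r1: "r > 1" using r R by simp
    define l where "l = 1 / r"
    have l: "0 < l" "l < 1" "l * r = 1" using r1 by (auto simp: l_def)
    let ?q = "(1 - l) *\<^sub>R x0 + l *\<^sub>R p"
    have "?q - x0 = l *\<^sub>R (p - x0)" by (simp add: algebra_simps)
    then have "norm (?q - x0) = 1" using l by (simp flip: r_def)
    then have "?q \<in> D \<inter> cball x0 1" using conv[OF x0 p(1) l(1,2)] by (simp add: dist_norm norm_minus_commute)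
    then have "m \<le> (1 - l) * F y x0 + l * F y p - kap / 2 * l * (1 - l) * r\<^sup>2"
      using m[of ?q] F_strongly_convex[OF x0 p(1) l(1,2), of y] by (simp add: r_def norm_minus_commute)
    then have "r * m \<le> r * ((1 - l) * F y x0 + l * F y p - kap / 2 * l * (1 - l) * r\<^sup>2)"
      using r1 by (intro mult_left_mono) auto
    also have "\<dots> = (r - l * r) * F y x0 + (l * r) * F y p - kap / 2 * (l * r) * (r - l * r) * r"
      by (simp add: algebra_simps power2_eq_square)
    also have "\<dots> = (r - 1) * F y x0 + F y p - kap / 2 * (r - 1) * r" by (simp add: l(3))
    finally have "F y p - F y x0 \<ge> r * (kap / 2 * (r - 1) - (F y x0 - m))" by (simp add: algebra_simps)
    moreover have "kap / 2 * (r - 1) > F y x0 - m"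
      using r kap by (simp add: R_def field_simps)
    ultimately show ?thesis using r1 by (smt (verit) mult_pos_pos)
  qed
  obtain p where p: "p \<in> D \<inter> cball x0 R" "\<forall>q\<in>D \<inter> cball x0 R. F y p \<le> F y q"
    using F_attains_cball[OF x0, of R y] R by auto
  have "F y p \<le> F y q" if "q \<in> D" for q
  proof (cases "q \<in> cball x0 R")
    case False
    have "F y p \<le> F y x0" using p(2) x0 R by auto
    then show ?thesis using far[OF that False] by simp
  qed (use p that in auto)
  then show ?thesis using p by auto
qed

definition P :: "'a \<Rightarrow> 'a" where
  "P y = (SOME p. p \<in> D \<and> (\<forall>q\<in>D. F y p \<le> F y q))"

definition G :: "'a \<Rightarrow> 'a" where
  "G y = (1 / \<mu>) *\<^sub>R (y - P y)"

definition env :: "'a \<Rightarrow> real" where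
  "env y = F y (P y)"

lemma P_in: "P y \<in> D" and P_le: "q \<in> D \<Longrightarrow> F y (P y) \<le> F y q"
proof -
  have "P y \<in> D \<and> (\<forall>q\<in>D. F y (P y) \<le> F y q)"
    unfolding P_def by (rule someI_ex) (use F_attains[of y] in auto)
  then show "P y \<in> D" "q \<in> D \<Longrightarrow> F y (P y) \<le> F y q" by auto
qed

text \<open>Quadratic growth at the minimizer: compare with the point at parameter \<open>l\<close>
  on the way to \<open>q\<close>, divide by \<open>l\<close>, and let \<open>l\<close> tend to
  0.\<close>

lemma P_strong:
  assumes q: "q \<in> D"
  shows "F y (P y) + kap / 2 * (norm (q - P y))\<^sup>2 \<le> F y q"
proof -
  let ?N = "(norm (P y - q))\<^sup>2"
  have *: "F y (P y) \<le> F y q - kap / 2 * (1 - l) * ?N" if l: "0 < l" "l < 1" for l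
  proof -
    have "F y (P y) \<le> F y ((1 - l) *\<^sub>R P y + l *\<^sub>R q)"
      by (rule P_le[OF conv[OF P_in q l]])
    also have "\<dots> \<le> (1 - l) * F y (P y) + l * F y q - kap / 2 * l * (1 - l) * ?N"
      by (rule F_strongly_convex[OF P_in q l])
    finally have "l * F y (P y) \<le> l * (F y q - kap / 2 * (1 - l) * ?N)" by (simp add: algebra_simps)
    then show ?thesis using l by simp
  qed
  have "((\<lambda>l. F y q - kap / 2 * (1 - l) * ?N) \<longlongrightarrow> F y q - kap / 2 * (1 - 0) * ?N) (at_right 0)"
    by (intro tendsto_intros)
  moreover have "\<forall>\<^sub>F l in at_right 0. F y (P y) \<le> F y q - kap / 2 * (1 - l) * ?N"
    using eventually_at_right_real[OF zero_less_one] by (rule eventually_mono) (use * in auto)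
  ultimately have "F y (P y) \<le> F y q - kap / 2 * (1 - 0) * ?N"
    by (intro tendsto_lowerbound) auto
  then show ?thesis by (simp add: norm_minus_commute)
qed

lemma F_diff: "F y q - F y p = f q - f p - (1 / \<mu>) * ((y - p) \<bullet> (q - p)) + (norm (q - p))\<^sup>2 / (2 * \<mu>)"
proof -
  have "(norm (q - y))\<^sup>2 = (norm (q - p))\<^sup>2 - 2 * ((y - p) \<bullet> (q - p)) + (norm (p - y))\<^sup>2"
    unfolding power2_norm_eq_inner by (simp add: inner_diff_left inner_diff_right inner_commute)
  then have "(norm (q - y))\<^sup>2 / (2 * \<mu>) = ((norm (q - p))\<^sup>2 - 2 * ((y - p) \<bullet> (q - p)) + (norm (p - y))\<^sup>2) / (2 * \<mu>)" by simp
  then show ?thesis by (simp add: F_def add_divide_distrib diff_divide_distrib)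
qed

text \<open>When \<open>F y\<close> is expanded around \<open>P y\<close>, the terms with
  \<open>1 / (2 * \<mu>)\<close> cancel against those of the quadratic growth and only the modulus
  \<open>\<rho>\<close> is left.\<close>

lemma P_gph: "(P y, G y) \<in> gph"
proof -
  have "f (P y) + G y \<bullet> (q - P y) - \<rho> / 2 * (norm (q - P y))\<^sup>2 \<le> f q" if q: "q \<in> D" for q
  proof -
    have "kap / 2 * (norm (q - P y))\<^sup>2 = (norm (q - P y))\<^sup>2 / (2 * \<mu>) - \<rho> / 2 * (norm (q - P y))\<^sup>2"
      by (simp add: kap_def left_diff_distrib)
    moreover have "G y \<bullet> (q - P y) = (1 / \<mu>) * ((y - P y) \<bullet> (q - P y))" by (simp add: G_def)
    ultimately show ?thesis using P_strong[OF q, of y] F_diff[of y q "P y"] by linarith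
  qed
  then show ?thesis by (simp add: gph_def P_in)
qed

text \<open>The inequality defining \<open>gph\<close> makes \<open>x\<close> a minimizer of
  \<open>F (x + \<mu> *\<^sub>R v)\<close> with margin \<open>kap / 2\<close> times the squared
  distance, so the minimizer selected by \<open>P\<close> cannot differ from
  \<open>x\<close>.\<close>

lemma gph_P:
  assumes "(x, v) \<in> gph"
  shows "P (x + \<mu> *\<^sub>R v) = x" "G (x + \<mu> *\<^sub>R v) = v"
proof -
  let ?y = "x + \<mu> *\<^sub>R v"
  have x: "x \<in> D" using assms by (simp add: gph_def)
  have "f x + v \<bullet> (P ?y - x) - \<rho> / 2 * (norm (P ?y - x))\<^sup>2 \<le> f (P ?y)"
    using assms P_in by (auto simp: gph_def)
  moreover have "kap / 2 * (norm (P ?y - x))\<^sup>2 = (norm (P ?y - x))\<^sup>2 / (2 * \<mu>) - \<rho> / 2 * (norm (P ?y - x))\<^sup>2"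
    by (simp add: kap_def left_diff_distrib)
  ultimately have "kap / 2 * (norm (P ?y - x))\<^sup>2 \<le> F ?y (P ?y) - F ?y x"
    using lam by (simp add: F_diff)
  also have "\<dots> \<le> 0" using P_le[OF x, of ?y] by simp
  finally have "(norm (P ?y - x))\<^sup>2 \<le> 0" using kap by (simp add: mult_le_0_iff)
  then show P: "P ?y = x" by simp
  show "G ?y = v" using lam by (simp add: G_def P)
qed

lemma gph_eq: "gph = range (\<lambda>y. (P y, G y))"
proof (intro equalityI subsetI)
  fix p assume p: "p \<in> gph"
  obtain x v where xv: "p = (x, v)" by (cases p)
  have "p = (P (x + \<mu> *\<^sub>R v), G (x + \<mu> *\<^sub>R v))" using gph_P[of x v] p by (simp add: xv)
  then show "p \<in> range (\<lambda>y. (P y, G y))" by (rule range_eqI)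
qed (use P_gph in auto)

text \<open>Hypomonotonicity of the graph multiplied by \<open>\<mu>\<close>. For
  \<open>\<rho> = 0\<close> and \<open>\<mu> = 1\<close> this is firm nonexpansiveness.\<close>

lemma P_inner: "(1 - \<mu> * \<rho>) * (norm (P y - P z))\<^sup>2 \<le> (y - z) \<bullet> (P y - P z)"
proof -
  have "- \<rho> * (norm (P y - P z))\<^sup>2 \<le> (G y - G z) \<bullet> (P y - P z)"
    by (rule gph_hypomonotone[OF P_gph P_gph])
  then have "\<mu> * (- \<rho> * (norm (P y - P z))\<^sup>2) \<le> \<mu> * ((G y - G z) \<bullet> (P y - P z))"
    using lam by (intro mult_left_mono) auto
  also have "\<dots> = ((y - z) - (P y - P z)) \<bullet> (P y - P z)"
  proof -
    have "\<mu> *\<^sub>R (G y - G z) = (y - z) - (P y - P z)"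
      using lam by (simp add: G_def scaleR_right_diff_distrib)
    then show ?thesis by (metis inner_scaleR_left)
  qed
  finally show ?thesis by (simp add: inner_diff_left power2_norm_eq_inner algebra_simps)
qed

lemma P_lipschitz: "(1 / (1 - \<mu> * \<rho>))-lipschitz_on UNIV P"
proof (rule lipschitz_onI)
  fix y z
  have "(1 - \<mu> * \<rho>) * (norm (P y - P z))\<^sup>2 \<le> norm (y - z) * norm (P y - P z)"
    using P_inner[of y z] norm_cauchy_schwarz[of "y - z" "P y - P z"] by linarith
  then have "(1 - \<mu> * \<rho>) * norm (P y - P z) \<le> norm (y - z)"
    by (cases "P y = P z") (auto simp: power2_eq_square)
  then show "dist (P y) (P z) \<le> 1 / (1 - \<mu> * \<rho>) * dist y z"
    using lam_rho by (simp add: dist_norm field_simps)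
next
  show "0 \<le> 1 / (1 - \<mu> * \<rho>)"
    by (rule divide_nonneg_nonneg) (use lam_rho in linarith)+
qed

lemma G_lipschitz: "\<exists>C\<ge>0. \<forall>y z. norm (G y - G z) \<le> C * norm (y - z)"
proof -
  define C where "C = (1 / \<mu>) * (1 + 1 / (1 - \<mu> * \<rho>))"
  have "norm (G y - G z) \<le> C * norm (y - z)" for y z
  proof -
    have "G y - G z = (1 / \<mu>) *\<^sub>R ((y - z) - (P y - P z))"
      by (simp add: G_def algebra_simps)
    then have "norm (G y - G z) = (1 / \<mu>) * norm ((y - z) - (P y - P z))" using lam by simp
    also have "\<dots> \<le> (1 / \<mu>) * (norm (y - z) + 1 / (1 - \<mu> * \<rho>) * norm (y - z))"
      using lam norm_triangle_ineq4[of "y - z" "P y - P z"] lipschitz_onD[OF P_lipschitz, of y z]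
      by (intro mult_left_mono) (auto simp: dist_norm)
    finally show ?thesis by (simp add: C_def algebra_simps)
  qed
  moreover have "C \<ge> 0" using lam lam_rho by (simp add: C_def)
  ultimately show ?thesis by blast
qed

lemma env_le: "p \<in> D \<Longrightarrow> env y \<le> f p + (norm (p - y))\<^sup>2 / (2 * \<mu>)"
  using P_le[of p y] by (simp add: env_def F_def)

text \<open>The point \<open>P y\<close>, optimal at \<open>y\<close>, serves as a competitor at
  \<open>z\<close>.\<close>

lemma env_upper: "env z \<le> env y + G y \<bullet> (z - y) + (norm (z - y))\<^sup>2 / (2 * \<mu>)"
proof -
  have "(norm (P y - z))\<^sup>2 = (norm (P y - y))\<^sup>2 + 2 * ((y - P y) \<bullet> (z - y)) + (norm (z - y))\<^sup>2"
    unfolding power2_norm_eq_inner by (simp add: inner_diff_left inner_diff_right inner_commute)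
  then have "(norm (P y - z))\<^sup>2 / (2 * \<mu>) = ((norm (P y - y))\<^sup>2 + 2 * ((y - P y) \<bullet> (z - y)) + (norm (z - y))\<^sup>2) / (2 * \<mu>)" by simp
  also have "\<dots> = (norm (P y - y))\<^sup>2 / (2 * \<mu>) + G y \<bullet> (z - y) + (norm (z - y))\<^sup>2 / (2 * \<mu>)"
    by (simp add: G_def add_divide_distrib)
  finally show ?thesis using env_le[OF P_in, of z y] by (simp add: env_def F_def)
qed

text \<open>\<open>env_upper\<close> bounds the remainder from above. With \<open>y\<close> and
  \<open>z\<close> exchanged it bounds it from below, and replacing \<open>G z\<close> by
  \<open>G y\<close> costs the Lipschitz constant \<open>C\<close>.\<close>

lemma env_has_derivative: "(env has_derivative (\<lambda>d. G y \<bullet> d)) (at y)"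
  unfolding has_derivative_at_alt
proof (intro conjI allI impI)
  show "bounded_linear (\<lambda>d. G y \<bullet> d)" by (rule bounded_linear_inner_right)
  fix e :: real assume e: "e > 0"
  obtain C where C: "C \<ge> 0" "\<And>y z. norm (G y - G z) \<le> C * norm (y - z)" using G_lipschitz by blast
  define K where "K = C + 1 / (2 * \<mu>)"
  have K: "K > 0" using C lam by (simp add: K_def add_nonneg_pos)
  have b: "\<bar>env z - env y - G y \<bullet> (z - y)\<bar> \<le> K * (norm (z - y))\<^sup>2" for z
  proof -
    have u: "env z - env y - G y \<bullet> (z - y) \<le> (norm (z - y))\<^sup>2 / (2 * \<mu>)" using env_upper[of z y] by simp
    have "env y \<le> env z + G z \<bullet> (y - z) + (norm (y - z))\<^sup>2 / (2 * \<mu>)" by (rule env_upper)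
    moreover have "G z \<bullet> (y - z) = - (G y \<bullet> (z - y)) - (G z - G y) \<bullet> (z - y)"
      by (simp add: inner_diff_left inner_diff_right)
    moreover have "\<bar>(G z - G y) \<bullet> (z - y)\<bar> \<le> C * (norm (z - y))\<^sup>2"
    proof -
      have "\<bar>(G z - G y) \<bullet> (z - y)\<bar> \<le> norm (G z - G y) * norm (z - y)" by (rule Cauchy_Schwarz_ineq2)
      also have "\<dots> \<le> (C * norm (z - y)) * norm (z - y)" using C(2) by (intro mult_right_mono) auto
      finally show ?thesis by (simp add: power2_eq_square mult.assoc)
    qed
    moreover have "K * (norm (z - y))\<^sup>2 = C * (norm (z - y))\<^sup>2 + (norm (z - y))\<^sup>2 / (2 * \<mu>)"
      by (simp add: K_def distrib_right)
    moreover have "C * (norm (z - y))\<^sup>2 \<ge> 0" using C by simp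
    ultimately show ?thesis using u by (simp add: norm_minus_commute abs_le_iff)
  qed
  show "\<exists>d>0. \<forall>z. norm (z - y) < d \<longrightarrow> norm (env z - env y - G y \<bullet> (z - y)) \<le> e * norm (z - y)"
  proof (intro exI[of _ "e / K"] conjI allI impI)
    show "e / K > 0" using e K by simp
    fix z assume "norm (z - y) < e / K"
    then have "K * norm (z - y) \<le> e" using K by (simp add: field_simps)
    then have "K * (norm (z - y))\<^sup>2 \<le> e * norm (z - y)"
      using mult_right_mono[of "K * norm (z - y)" e "norm (z - y)"] by (simp add: power2_eq_square mult.assoc)
    then show "norm (env z - env y - G y \<bullet> (z - y)) \<le> e * norm (z - y)" using b[of z] by simp
  qed
qed

lemma env_convex_of_monotone:
  assumes mono: "\<And>y z. (G y - G z) \<bullet> (y - z) \<ge> 0"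
  shows "env z \<ge> env y + G y \<bullet> (z - y)"
proof -
  have der: "((\<lambda>s. env (y + s *\<^sub>R (z - y))) has_real_derivative (G (y + s *\<^sub>R (z - y)) \<bullet> (z - y))) (at s)" for s
  proof -
    have "((\<lambda>s. env (y + s *\<^sub>R (z - y))) has_derivative (\<lambda>h. G (y + s *\<^sub>R (z - y)) \<bullet> (h *\<^sub>R (z - y)))) (at s)"
      by (rule has_derivative_compose[OF _ env_has_derivative]) (auto intro!: derivative_eq_intros)
    then show ?thesis
      unfolding has_field_derivative_def by (rule has_derivative_eq_rhs) (simp add: fun_eq_iff mult.commute)
  qed
  obtain \<xi> where \<xi>: "0 < \<xi>" "\<xi> < 1" "env z - env y = G (y + \<xi> *\<^sub>R (z - y)) \<bullet> (z - y)"
    using MVT2[of 0 1 "\<lambda>s. env (y + s *\<^sub>R (z - y))" "\<lambda>s. G (y + s *\<^sub>R (z - y)) \<bullet> (z - y)"] der by auto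
  have "(G (y + \<xi> *\<^sub>R (z - y)) - G y) \<bullet> (\<xi> *\<^sub>R (z - y)) \<ge> 0" using mono[of "y + \<xi> *\<^sub>R (z - y)" y] by simp
  then have "(G (y + \<xi> *\<^sub>R (z - y)) - G y) \<bullet> (z - y) \<ge> 0" using \<xi> by (simp add: zero_le_mult_iff)
  then show ?thesis using \<xi>(3) by (simp add: inner_diff_left)
qed

end

context prox_on
begin

lemma env_eq: "env y = f (P y) + \<mu> / 2 * (norm (G y))\<^sup>2"
proof -
  have "P y - y = - (\<mu> *\<^sub>R G y)" using lam by (simp add: G_def)
  then have "norm (P y - y) = \<mu> * norm (G y)" using lam by simp
  then have "(norm (P y - y))\<^sup>2 / (2 * \<mu>) = \<mu> / 2 * (norm (G y))\<^sup>2"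
    using lam by (simp add: power2_eq_square)
  then show ?thesis by (simp add: env_def F_def)
qed

text \<open>The envelope lies below \<open>f\<close> at the end points. Its gradient inequalities at
  \<open>x\<close>, averaged with weights \<open>1 - t\<close> and \<open>t\<close>, have cancelling
  linear terms, and \<open>P x\<close> is the required \<open>p\<close>.\<close>

lemma env_convex_imp_approx:
  assumes mono: "\<And>y z. (G y - G z) \<bullet> (y - z) \<ge> 0" and D: "x0 \<in> D" "x1 \<in> D" and t: "0 < t" "t < 1"
  defines "x \<equiv> (1 - t) *\<^sub>R x0 + t *\<^sub>R x1"
  shows "\<exists>p\<in>D. f p + (norm (p - x))\<^sup>2 / (2 * \<mu>) \<le> (1 - t) * f x0 + t * f x1"
proof
  show "P x \<in> D" by (rule P_in)
  have "env x0 \<le> f x0" "env x1 \<le> f x1" using env_le[OF D(1), of x0] env_le[OF D(2), of x1] by simp_all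
  then have u: "(1 - t) * env x0 + t * env x1 \<le> (1 - t) * f x0 + t * f x1"
    using t by (intro add_mono mult_left_mono) auto
  have "(1 - t) * (env x + G x \<bullet> (x0 - x)) + t * (env x + G x \<bullet> (x1 - x)) \<le> (1 - t) * env x0 + t * env x1"
    using t env_convex_of_monotone[OF mono] by (intro add_mono mult_left_mono) auto
  also have "(1 - t) * (env x + G x \<bullet> (x0 - x)) + t * (env x + G x \<bullet> (x1 - x))
      = env x + G x \<bullet> ((1 - t) *\<^sub>R (x0 - x) + t *\<^sub>R (x1 - x))"
    by (simp add: inner_add_right algebra_simps)
  also have "(1 - t) *\<^sub>R (x0 - x) + t *\<^sub>R (x1 - x) = 0"
    by (simp add: x_def algebra_simps)
  finally have "env x \<le> (1 - t) * env x0 + t * env x1" by simp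
  with u show "f (P x) + (norm (P x - x))\<^sup>2 / (2 * \<mu>) \<le> (1 - t) * f x0 + t * f x1"
    by (simp add: env_def F_def)
qed

end

section \<open>Letting the proximal parameter tend to 0\<close>

context weakly_convex_on
begin

lemma prox_onI: "\<mu> > 0 \<Longrightarrow> \<mu> * \<rho> < 1 \<Longrightarrow> prox_on D f \<rho> \<mu>"
  by unfold_locales

text \<open>The envelope for the fixed parameter \<open>\<mu>0\<close> provides a quadratic lower
  bound for \<open>f\<close>; bounded penalized values then force \<open>p n\<close> towards
  \<open>x\<close>, and lower semicontinuity transfers the bound \<open>M\<close>.\<close>

lemma le_of_prox_approximation:
  assumes x: "x \<in> D"
    and ap: "\<And>\<mu>. \<mu> > 0 \<Longrightarrow> \<mu> * \<rho> < 1 \<Longrightarrow> \<exists>p\<in>D. f p + (norm (p - x))\<^sup>2 / (2 * \<mu>) \<le> M"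
  shows "f x \<le> M"
proof -
  define \<mu>0 where "\<mu>0 = 1 / (\<rho> + 1)"
  have \<mu>0: "\<mu>0 > 0" "\<mu>0 * \<rho> < 1" using rho by (auto simp: \<mu>0_def)
  interpret p0: prox_on D f \<rho> \<mu>0 by (rule prox_onI[OF \<mu>0])
  define m where "m = p0.env x"
  have m: "m \<le> f p + (norm (p - x))\<^sup>2 / (2 * \<mu>0)" if "p \<in> D" for p
    using p0.env_le[OF that] by (simp add: m_def)
  \<comment> \<open>Chosen so that \<open>1 / \<mu> n - 1 / \<mu>0\<close> is exactly
    \<open>Suc n\<close>; half of it times the squared distance is at most
    \<open>M - m\<close>.\<close>
  define \<mu> where "\<mu> = (\<lambda>n. 1 / (\<rho> + 1 + real (Suc n)))"
  have "\<exists>p\<in>D. f p + (norm (p - x))\<^sup>2 / (2 * \<mu> n) \<le> M" for n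
    by (rule ap) (use rho in \<open>auto simp: \<mu>_def\<close>)
  then obtain p where p: "\<And>n. p n \<in> D" "\<And>n. f (p n) + (norm (p n - x))\<^sup>2 / (2 * \<mu> n) \<le> M" by metis
  have b: "(norm (p n - x))\<^sup>2 \<le> 2 * (M - m) * inverse (real (Suc n))" for n
  proof -
    have "(norm (p n - x))\<^sup>2 / (2 * \<mu> n) - (norm (p n - x))\<^sup>2 / (2 * \<mu>0) \<le> M - m"
      using m[OF p(1), of n] p(2)[of n] by simp
    moreover have "(norm (p n - x))\<^sup>2 / (2 * \<mu> n) - (norm (p n - x))\<^sup>2 / (2 * \<mu>0) = (norm (p n - x))\<^sup>2 * real (Suc n) / 2"
      by (simp add: \<mu>_def \<mu>0_def algebra_simps)
    ultimately have "(norm (p n - x))\<^sup>2 * real (Suc n) / 2 \<le> M - m" by (simp only:)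
    moreover have "a \<le> 2 * b" if "a / 2 \<le> b" for a b :: real using that by simp
    ultimately have "(norm (p n - x))\<^sup>2 * real (Suc n) \<le> 2 * (M - m)" by blast
    then show ?thesis by (simp add: field_simps del: of_nat_Suc)
  qed
  have "(\<lambda>n. 2 * (M - m) * inverse (real (Suc n))) \<longlonglongrightarrow> 2 * (M - m) * 0"
    by (intro tendsto_mult_left LIMSEQ_inverse_real_of_nat)
  then have "(\<lambda>n. (norm (p n - x))\<^sup>2) \<longlonglongrightarrow> 0"
    by (intro tendsto_sandwich[of "\<lambda>_. 0" "\<lambda>n. (norm (p n - x))\<^sup>2" sequentially]) (use b in auto)
  then have "(\<lambda>n. sqrt ((norm (p n - x))\<^sup>2)) \<longlonglongrightarrow> sqrt 0" by (rule tendsto_real_sqrt)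
  then have "p \<longlonglongrightarrow> x" by (simp add: tendsto_norm_zero_iff LIM_zero_iff)
  moreover have "f (p n) \<le> M" for n
  proof -
    have "(norm (p n - x))\<^sup>2 / (2 * \<mu> n) \<ge> 0" using rho by (simp add: \<mu>_def)
    then show ?thesis using p(2)[of n] by linarith
  qed
  ultimately show ?thesis using lsc_seq[of p x "\<lambda>_. M" M] p(1) by auto
qed

end

section \<open>Second-order behaviour at a point where the proximal map is differentiable\<close>

locale prox_differentiable = prox_on +
  fixes y :: 'a and J :: "'a \<Rightarrow> 'a"
  assumes J: "(P has_derivative J) (at y)"
begin

definition H :: "'a \<Rightarrow> 'a" where
  "H d = (1 / \<mu>) *\<^sub>R (d - J d)"

lemma J_linear: "linear J"
  using has_derivative_linear[OF J] .

lemma G_has_derivative: "(G has_derivative H) (at y)"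
  unfolding G_def[abs_def] H_def[abs_def] by (intro derivative_intros J)

lemma H_linear: "linear H"
  using has_derivative_linear[OF G_has_derivative] .

lemma H_symmetric: "H u \<bullet> v = u \<bullet> H v"
  using hessian_symmetric[OF env_has_derivative G_has_derivative, of u v] by (simp add: inner_commute)

lemma J_eq: "J d = d - \<mu> *\<^sub>R H d"
  using lam by (simp add: H_def)

lemma J_symmetric: "J u \<bullet> v = u \<bullet> J v"
  by (simp add: J_eq inner_diff_left inner_diff_right H_symmetric)

lemma H_J_commute: "H (J d) = J (H d)"
  by (simp add: J_eq linear_diff[OF H_linear] linear_scale[OF H_linear])

lemma env_expansion:
  assumes "\<epsilon> > 0"
  shows "\<exists>s>0. \<forall>t. 0 < t \<and> t < s \<longrightarrow>
    \<bar>env (y + t *\<^sub>R d) - env y - t * (G y \<bullet> d) - t\<^sup>2 / 2 * (H d \<bullet> d)\<bar> \<le> \<epsilon> * t\<^sup>2"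
proof -
  define c where "c = (norm d)\<^sup>2 + 1"
  have c: "c > 0" by (simp add: c_def add_nonneg_pos)
  obtain s where s: "s > 0" "\<And>w. norm w < s \<Longrightarrow> \<bar>env (y + w) - env y - G y \<bullet> w - (H w \<bullet> w) / 2\<bar> \<le> \<epsilon> / c * (norm w)\<^sup>2"
    using second_order_expansion[OF env_has_derivative G_has_derivative, of "\<epsilon> / c"] assms c by auto
  show ?thesis
  proof (intro exI[of _ "s / (norm d + 1)"] conjI allI impI)
    show "s / (norm d + 1) > 0" using s by (simp add: add_nonneg_pos)
    fix t assume t: "0 < t \<and> t < s / (norm d + 1)"
    then have "t * (norm d + 1) < s" by (simp add: pos_less_divide_eq add_nonneg_pos)
    then have "norm (t *\<^sub>R d) < s" using t by (simp add: distrib_left)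
    then have "\<bar>env (y + t *\<^sub>R d) - env y - G y \<bullet> (t *\<^sub>R d) - (H (t *\<^sub>R d) \<bullet> (t *\<^sub>R d)) / 2\<bar> \<le> \<epsilon> / c * (norm (t *\<^sub>R d))\<^sup>2"
      by (rule s(2))
    also have "\<epsilon> / c * (norm (t *\<^sub>R d))\<^sup>2 = t\<^sup>2 * (\<epsilon> / c * (norm d)\<^sup>2)" by (simp add: power_mult_distrib)
    also have "\<dots> \<le> t\<^sup>2 * (\<epsilon> / c * c)" using assms c by (intro mult_left_mono) (auto simp: c_def)
    also have "\<dots> = \<epsilon> * t\<^sup>2" using c by simp
    also have "H (t *\<^sub>R d) \<bullet> (t *\<^sub>R d) / 2 = t\<^sup>2 / 2 * (H d \<bullet> d)"
      by (simp add: linear_scale[OF H_linear] power2_eq_square)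
    finally show "\<bar>env (y + t *\<^sub>R d) - env y - t * (G y \<bullet> d) - t\<^sup>2 / 2 * (H d \<bullet> d)\<bar> \<le> \<epsilon> * t\<^sup>2" by simp
  qed
qed

text \<open>\<open>P y + t u\<close> is a competitor for the envelope at \<open>y + t d\<close>;
  expanding the square produces the correction in \<open>norm (u - d)\<close>. The direction
  \<open>d\<close> is a free parameter: it is later chosen to make the bound sharp on the range of
  \<open>J\<close> and arbitrarily large off it.\<close>

lemma second_order_lower_bound:
  assumes "\<epsilon> > 0"
  shows "\<exists>s>0. \<forall>t u. 0 < t \<and> t < s \<longrightarrow> P y + t *\<^sub>R u \<in> D \<longrightarrow>
    (H d \<bullet> d - (norm (u - d))\<^sup>2 / \<mu> - \<epsilon>) * (t\<^sup>2 / 2) \<le> f (P y + t *\<^sub>R u) - f (P y) - t * (G y \<bullet> u)"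
proof -
  obtain s where s: "s > 0" "\<And>t. 0 < t \<and> t < s \<Longrightarrow>
    \<bar>env (y + t *\<^sub>R d) - env y - t * (G y \<bullet> d) - t\<^sup>2 / 2 * (H d \<bullet> d)\<bar> \<le> \<epsilon> / 2 * t\<^sup>2"
    using env_expansion[of "\<epsilon> / 2" d] assms by auto
  show ?thesis
  proof (intro exI[of _ s] conjI allI impI s(1))
    fix t u assume t: "0 < t \<and> t < s" and D: "P y + t *\<^sub>R u \<in> D"
    have "env (y + t *\<^sub>R d) \<le> f (P y + t *\<^sub>R u) + (norm (P y + t *\<^sub>R u - (y + t *\<^sub>R d)))\<^sup>2 / (2 * \<mu>)"
      by (rule env_le[OF D])
    moreover have "(norm (P y + t *\<^sub>R u - (y + t *\<^sub>R d)))\<^sup>2 / (2 * \<mu>)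
        = \<mu> / 2 * (norm (G y))\<^sup>2 - t * (G y \<bullet> (u - d)) + (norm (u - d))\<^sup>2 / \<mu> * (t\<^sup>2 / 2)"
    proof -
      have "P y + t *\<^sub>R u - (y + t *\<^sub>R d) = t *\<^sub>R (u - d) - \<mu> *\<^sub>R G y"
        using lam by (simp add: G_def algebra_simps)
      then have "(norm (P y + t *\<^sub>R u - (y + t *\<^sub>R d)))\<^sup>2
          = t\<^sup>2 * (norm (u - d))\<^sup>2 - 2 * t * \<mu> * (G y \<bullet> (u - d)) + \<mu>\<^sup>2 * (norm (G y))\<^sup>2"
        unfolding power2_norm_eq_inner
        by (simp only:) (simp add: inner_diff_left inner_diff_right inner_commute power2_eq_square algebra_simps)
      then show ?thesis using lam by (simp add: add_divide_distrib diff_divide_distrib power2_eq_square mult_ac)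
    qed
    moreover have "G y \<bullet> (u - d) = G y \<bullet> u - G y \<bullet> d" by (rule inner_diff_right)
    then have "t * (G y \<bullet> (u - d)) = t * (G y \<bullet> u) - t * (G y \<bullet> d)" by (simp add: right_diff_distrib)
    moreover have "(H d \<bullet> d - (norm (u - d))\<^sup>2 / \<mu> - \<epsilon>) * (t\<^sup>2 / 2)
       = t\<^sup>2 / 2 * (H d \<bullet> d) - (norm (u - d))\<^sup>2 / \<mu> * (t\<^sup>2 / 2) - \<epsilon> / 2 * t\<^sup>2"
      by (simp add: algebra_simps)
    \<comment> \<open>The preceding identities combine linearly once every product is abstracted
      into a variable.\<close>
    moreover have "L \<le> fu - f0 - Xu"
      if "e \<le> fu + N" "N = K - X + Z" "X = Xu - Xd" "L = Q - Z - W" "\<bar>e - e0 - Xd - Q\<bar> \<le> W" "e0 = f0 + K"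
      for e e0 fu f0 N K X Z Xu Xd L Q W :: real using that by linarith
    ultimately show "(H d \<bullet> d - (norm (u - d))\<^sup>2 / \<mu> - \<epsilon>) * (t\<^sup>2 / 2)
        \<le> f (P y + t *\<^sub>R u) - f (P y) - t * (G y \<bullet> u)"
      using s(2)[OF t] env_eq[of y] by blast
  qed
qed

lemma has_derivative_along_sequence:
  fixes g :: "'a \<Rightarrow> 'a"
  assumes g: "(g has_derivative g') (at y)" and \<tau>: "\<And>k. \<tau> k > 0" "\<tau> \<longlonglongrightarrow> 0"
  shows "(\<lambda>k. (1 / \<tau> k) *\<^sub>R (g (y + \<tau> k *\<^sub>R d) - g y)) \<longlonglongrightarrow> g' d"
proof (rule LIMSEQ_I)
  fix \<epsilon> :: real assume \<epsilon>: "\<epsilon> > 0"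
  define c where "c = norm d + 1"
  have c: "c > 0" "norm d \<le> c" by (auto simp: c_def add_nonneg_pos)
  have "\<epsilon> / (2 * c) > 0" using \<epsilon> c by simp
  then obtain s where s: "s > 0" "\<And>z. norm (z - y) < s \<Longrightarrow> norm (g z - g y - g' (z - y)) \<le> \<epsilon> / (2 * c) * norm (z - y)"
    using g unfolding has_derivative_at_alt by blast
  obtain N where N: "\<And>k. k \<ge> N \<Longrightarrow> \<bar>\<tau> k\<bar> < s / c"
    using LIMSEQ_D[OF \<tau>(2), of "s / c"] s(1) c by auto
  have "norm ((1 / \<tau> k) *\<^sub>R (g (y + \<tau> k *\<^sub>R d) - g y) - g' d) < \<epsilon>" if k: "k \<ge> N" for k
  proof -
    have t: "\<tau> k > 0" by (rule \<tau>)
    have "\<tau> k * norm d \<le> \<tau> k * c" using t c by (intro mult_left_mono) auto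
    also have "\<dots> < s" using N[OF k] t c by (simp add: pos_less_divide_eq)
    finally have "norm (g (y + \<tau> k *\<^sub>R d) - g y - g' (\<tau> k *\<^sub>R d)) \<le> \<epsilon> / (2 * c) * (\<tau> k * norm d)"
      using s(2)[of "y + \<tau> k *\<^sub>R d"] t by simp
    also have "\<dots> \<le> \<epsilon> / (2 * c) * (\<tau> k * c)" using \<epsilon> t c by (intro mult_left_mono) auto
    also have "\<dots> = \<tau> k * (\<epsilon> / 2)" using c by simp
    finally have "norm (g (y + \<tau> k *\<^sub>R d) - g y - g' (\<tau> k *\<^sub>R d)) \<le> \<tau> k * (\<epsilon> / 2)" .
    moreover have "(1 / \<tau> k) *\<^sub>R (g (y + \<tau> k *\<^sub>R d) - g y) - g' d = (1 / \<tau> k) *\<^sub>R (g (y + \<tau> k *\<^sub>R d) - g y - g' (\<tau> k *\<^sub>R d))"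
      using t by (simp add: linear_scale[OF has_derivative_linear[OF g]] scaleR_right_diff_distrib)
    ultimately have "norm ((1 / \<tau> k) *\<^sub>R (g (y + \<tau> k *\<^sub>R d) - g y) - g' d) \<le> \<epsilon> / 2"
      using t by (simp add: pos_divide_le_eq mult.commute)
    then show ?thesis using \<epsilon> by linarith
  qed
  then show "\<exists>N. \<forall>k\<ge>N. norm ((1 / \<tau> k) *\<^sub>R (g (y + \<tau> k *\<^sub>R d) - g y) - g' d) < \<epsilon>" by blast
qed

text \<open>The difference quotients of \<open>P\<close> keep
  \<open>P y + \<tau> k *\<^sub>R ws k\<close> on the image of \<open>P\<close>, where
  \<open>env_eq\<close> expresses \<open>f\<close> through the envelope and \<open>G\<close>. The
  limit is \<open>H d \<bullet> d - \<mu> * (norm (H d))\<^sup>2\<close>, which is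
  \<open>H d \<bullet> J d\<close>.\<close>

lemma recovery_sequence:
  fixes d :: 'a
  assumes \<tau>: "\<And>k. \<tau> k > 0" "\<tau> \<longlonglongrightarrow> 0"
  defines "ws \<equiv> (\<lambda>k. (1 / \<tau> k) *\<^sub>R (P (y + \<tau> k *\<^sub>R d) - P y))"
  shows "ws \<longlonglongrightarrow> J d" and "\<And>k. P y + \<tau> k *\<^sub>R ws k \<in> D"
    and "(\<lambda>k. (f (P y + \<tau> k *\<^sub>R ws k) - f (P y) - \<tau> k * (G y \<bullet> ws k)) / (1 / 2 * (\<tau> k)\<^sup>2)) \<longlonglongrightarrow> H d \<bullet> J d"
proof -
  show "ws \<longlonglongrightarrow> J d" unfolding ws_def by (rule has_derivative_along_sequence[OF J \<tau>])
  have wsP: "P y + \<tau> k *\<^sub>R ws k = P (y + \<tau> k *\<^sub>R d)" for k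
    using \<tau>(1)[of k] by (simp add: ws_def)
  show "P y + \<tau> k *\<^sub>R ws k \<in> D" for k by (simp only: wsP P_in)
  define gs where "gs = (\<lambda>k. (1 / \<tau> k) *\<^sub>R (G (y + \<tau> k *\<^sub>R d) - G y))"
  have gs: "gs \<longlonglongrightarrow> H d" unfolding gs_def by (rule has_derivative_along_sequence[OF G_has_derivative \<tau>])
  define E where "E = (\<lambda>k. (env (y + \<tau> k *\<^sub>R d) - env y - \<tau> k * (G y \<bullet> d)) / (1 / 2 * (\<tau> k)\<^sup>2))"
  have E: "E \<longlonglongrightarrow> H d \<bullet> d"
  proof (rule LIMSEQ_I)
    fix \<epsilon> :: real assume \<epsilon>: "\<epsilon> > 0"
    obtain s where s: "s > 0" "\<And>t. 0 < t \<and> t < s \<Longrightarrow>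
      \<bar>env (y + t *\<^sub>R d) - env y - t * (G y \<bullet> d) - t\<^sup>2 / 2 * (H d \<bullet> d)\<bar> \<le> \<epsilon> / 4 * t\<^sup>2"
      using env_expansion[of "\<epsilon> / 4" d] \<epsilon> by auto
    obtain N where N: "\<And>k. k \<ge> N \<Longrightarrow> \<bar>\<tau> k\<bar> < s"
      using LIMSEQ_D[OF \<tau>(2) s(1)] by auto
    have "norm (E k - H d \<bullet> d) < \<epsilon>" if "k \<ge> N" for k
    proof -
      let ?t = "\<tau> k" and ?X = "env (y + \<tau> k *\<^sub>R d) - env y - \<tau> k * (G y \<bullet> d)"
      have t: "0 < ?t \<and> ?t < s" using N[OF that] \<tau>(1)[of k] by auto
      have t2: "1 / 2 * ?t\<^sup>2 > 0" using t by simp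
      have "E k - H d \<bullet> d = (?X - ?t\<^sup>2 / 2 * (H d \<bullet> d)) / (1 / 2 * ?t\<^sup>2)"
        unfolding E_def using t by (simp add: diff_divide_distrib)
      then have "\<bar>E k - H d \<bullet> d\<bar> = \<bar>?X - ?t\<^sup>2 / 2 * (H d \<bullet> d)\<bar> / (1 / 2 * ?t\<^sup>2)"
        using t2 by (simp only: abs_divide abs_of_pos)
      also have "\<dots> \<le> (\<epsilon> / 4 * ?t\<^sup>2) / (1 / 2 * ?t\<^sup>2)"
        using s(2)[OF t] t2 by (intro divide_right_mono) auto
      also have "\<dots> = \<epsilon> / 2" using t by simp
      finally show ?thesis using \<epsilon> by simp
    qed
    then show "\<exists>N. \<forall>k\<ge>N. norm (E k - H d \<bullet> d) < \<epsilon>" by blast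
  qed
  have eq: "(f (P y + \<tau> k *\<^sub>R ws k) - f (P y) - \<tau> k * (G y \<bullet> ws k)) / (1 / 2 * (\<tau> k)\<^sup>2) = E k - \<mu> * (norm (gs k))\<^sup>2" for k
  proof -
    let ?z = "y + \<tau> k *\<^sub>R d"
    have t: "\<tau> k > 0" by (rule \<tau>)
    have "\<tau> k *\<^sub>R ws k = P ?z - P y" using t by (simp add: ws_def)
    also have "\<dots> = \<tau> k *\<^sub>R d - \<mu> *\<^sub>R (G ?z - G y)" using lam by (simp add: G_def algebra_simps)
    finally have tw: "\<tau> k * (G y \<bullet> ws k) = \<tau> k * (G y \<bullet> d) - \<mu> * (G y \<bullet> G ?z - G y \<bullet> G y)"
      by (metis inner_diff_right inner_scaleR_right)
    have n: "(norm (G ?z - G y))\<^sup>2 = (norm (G ?z))\<^sup>2 - 2 * (G y \<bullet> G ?z) + G y \<bullet> G y"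
      unfolding power2_norm_eq_inner by (simp add: inner_diff_left inner_diff_right inner_commute)
    have "f (P ?z) - f (P y) - \<tau> k * (G y \<bullet> ws k)
        = (env ?z - env y - \<tau> k * (G y \<bullet> d)) - \<mu> / 2 * (norm (G ?z - G y))\<^sup>2"
      unfolding tw n env_eq by (simp add: power2_norm_eq_inner algebra_simps)
    also have "(norm (G ?z - G y))\<^sup>2 = (\<tau> k)\<^sup>2 * (norm (gs k))\<^sup>2"
      using t by (simp add: gs_def power_mult_distrib power_divide)
    finally have "(f (P ?z) - f (P y) - \<tau> k * (G y \<bullet> ws k)) / (1 / 2 * (\<tau> k)\<^sup>2) =
      E k - (\<mu> / 2 * ((\<tau> k)\<^sup>2 * (norm (gs k))\<^sup>2)) / (1 / 2 * (\<tau> k)\<^sup>2)"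
      by (simp only: E_def diff_divide_distrib)
    then show ?thesis using t by (simp add: wsP)
  qed
  have "(\<lambda>k. E k - \<mu> * (norm (gs k))\<^sup>2) \<longlonglongrightarrow> H d \<bullet> d - \<mu> * (norm (H d))\<^sup>2"
    by (intro tendsto_intros E gs)
  also have "H d \<bullet> d - \<mu> * (norm (H d))\<^sup>2 = H d \<bullet> J d"
    by (simp add: J_eq inner_diff_right power2_norm_eq_inner)
  finally show "(\<lambda>k. (f (P y + \<tau> k *\<^sub>R ws k) - f (P y) - \<tau> k * (G y \<bullet> ws k)) / (1 / 2 * (\<tau> k)\<^sup>2)) \<longlonglongrightarrow> H d \<bullet> J d"
    by (simp only: eq)
qed

text \<open>At the target \<open>J d\<close> the bound with parameter \<open>d\<close> loses
  nothing: it equals the limit along the recovery sequence.\<close>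

lemma lower_bound_at_range: "H d \<bullet> d - (norm (J d - d))\<^sup>2 / \<mu> = H d \<bullet> J d"
proof -
  have "J d - d = - (\<mu> *\<^sub>R H d)" by (simp add: J_eq)
  then have "(norm (J d - d))\<^sup>2 = \<mu>\<^sup>2 * (H d \<bullet> H d)"
    by (simp add: power_mult_distrib power2_norm_eq_inner)
  then have "(norm (J d - d))\<^sup>2 / \<mu> = \<mu> * (H d \<bullet> H d)"
    using lam by (simp add: power2_eq_square)
  then show ?thesis by (simp add: J_eq inner_diff_right)
qed

text \<open>The component \<open>n\<close> of \<open>w\<close> orthogonal to the range lies in the
  kernel of the symmetric map \<open>J\<close>, so \<open>H n = n / \<mu>\<close>. For
  \<open>d = s n\<close> the terms quadratic in \<open>s\<close> cancel and a linear term with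
  positive slope remains.\<close>

lemma lower_bound_off_range:
  assumes w: "w \<notin> range J"
  shows "\<exists>d. M \<le> H d \<bullet> d - (norm (w - d))\<^sup>2 / \<mu>"
proof -
  have sub: "subspace (range J)" using linear_subspace_image[OF J_linear subspace_UNIV] .
  obtain r n where rn: "r \<in> span (range J)" "\<And>b. b \<in> span (range J) \<Longrightarrow> orthogonal n b" "w = r + n"
    using orthogonal_subspace_decomp_exists[of "range J" w] by metis
  have r: "r \<in> range J" using rn(1) sub by (simp add: span_eq_iff[THEN iffD2])
  have "n \<noteq> 0" using w r rn(3) by auto
  have orth: "n \<bullet> J a = 0" for a
    using rn(2)[of "J a"] by (simp add: orthogonal_def span_base)
  have "J n \<bullet> J n = 0" using orth[of "J n"] by (simp add: J_symmetric)
  then have Jn: "J n = 0" by simp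
  have Hn: "H (s *\<^sub>R n) = (s / \<mu>) *\<^sub>R n" for s
    by (simp add: linear_scale[OF H_linear]) (simp add: H_def Jn)
  obtain a where "r = J a" using r by auto
  then have "r \<bullet> n = 0" using orth[of a] by (metis inner_commute)
  then have wn: "w \<bullet> n = n \<bullet> n" by (simp add: rn(3) inner_add_left)
  have npos: "n \<bullet> n > 0" using \<open>n \<noteq> 0\<close> by simp
  \<comment> \<open>Solves
    \<open>(2 * s * (n \<bullet> n) - w \<bullet> w) / \<mu> = M\<close>.\<close>
  define s where "s = (\<mu> * M + w \<bullet> w) / (2 * (n \<bullet> n))"
  have "H (s *\<^sub>R n) \<bullet> (s *\<^sub>R n) - (norm (w - s *\<^sub>R n))\<^sup>2 / \<mu> = (2 * s * (n \<bullet> n) - w \<bullet> w) / \<mu>"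
  proof -
    have "(norm (w - s *\<^sub>R n))\<^sup>2 = w \<bullet> w - 2 * s * (n \<bullet> n) + s * s * (n \<bullet> n)"
      unfolding power2_norm_eq_inner
      by (simp add: inner_diff_left inner_diff_right inner_commute[of n w] wn right_diff_distrib)
    then show ?thesis by (simp add: Hn add_divide_distrib diff_divide_distrib)
  qed
  also have "2 * s * (n \<bullet> n) = \<mu> * M + w \<bullet> w" using npos by (simp add: s_def)
  also have "(\<mu> * M + w \<bullet> w - w \<bullet> w) / \<mu> = M" using lam by simp
  finally show ?thesis by (intro exI[of _ "s *\<^sub>R n"]) simp
qed

text \<open>At a point of differentiability the tangent directions of the graph are the pairs
  \<open>(J h, H h)\<close>; since \<open>H\<close> and \<open>J\<close> are symmetric and commute, \<open>(H d, - J d)\<close> annihilates them.\<close>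

lemma graph_normal:
  assumes \<epsilon>: "\<epsilon> > 0"
  shows "\<exists>s>0. \<forall>(x, v)\<in>gph. norm ((x, v) - (P y, G y)) < s \<longrightarrow>
     (H d, - J d) \<bullet> ((x, v) - (P y, G y)) \<le> \<epsilon> * norm ((x, v) - (P y, G y))"
proof -
  \<comment> \<open>The first factor weighs the remainders of \<open>P\<close> and \<open>G\<close>,
    with 1 added for positivity; \<open>1 + \<mu>\<close> converts \<open>norm (z - y)\<close> into
    distance in the graph.\<close>
  define c where "c = (norm (H d) + norm (J d) + 1) * (1 + \<mu>)"
  have c: "c > 0" using lam by (simp add: c_def add_nonneg_pos)
  define \<delta> where "\<delta> = \<epsilon> / c"
  have \<delta>: "\<delta> > 0" using \<epsilon> c by (simp add: \<delta>_def)
  obtain s1 where s1: "s1 > 0" "\<And>z. norm (z - y) < s1 \<Longrightarrow> norm (P z - P y - J (z - y)) \<le> \<delta> * norm (z - y)"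
    using J \<delta> unfolding has_derivative_at_alt by blast
  obtain s2 where s2: "s2 > 0" "\<And>z. norm (z - y) < s2 \<Longrightarrow> norm (G z - G y - H (z - y)) \<le> \<delta> * norm (z - y)"
    using G_has_derivative \<delta> unfolding has_derivative_at_alt by blast
  define s where "s = min s1 s2 / (1 + \<mu>)"
  have mu1: "1 + \<mu> > 0" using lam by simp
  show ?thesis
  proof (intro exI[of _ s] conjI ballI)
    show "s > 0" using s1 s2 mu1 by (simp add: s_def)
    fix p assume "p \<in> gph"
    then obtain z where p: "p = (P z, G z)" by (auto simp: gph_eq)
    show "case p of (x, v) \<Rightarrow> norm ((x, v) - (P y, G y)) < s \<longrightarrow>
     (H d, - J d) \<bullet> ((x, v) - (P y, G y)) \<le> \<epsilon> * norm ((x, v) - (P y, G y))"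
      unfolding p prod.case
    proof
      let ?N = "norm ((P z, G z) - (P y, G y))"
      assume N: "?N < s"
      \<comment> \<open>Since \<open>z = P z + \<mu> *\<^sub>R G z\<close>, the parameter is a
        Lipschitz function of the graph point, so nearby graph points have nearby
        parameters.\<close>
      have zy: "norm (z - y) \<le> (1 + \<mu>) * ?N"
      proof -
        have "z - y = (P z - P y) + \<mu> *\<^sub>R (G z - G y)"
          using lam by (simp add: G_def algebra_simps)
        then have "norm (z - y) \<le> norm (P z - P y) + \<mu> * norm (G z - G y)"
          using norm_triangle_ineq[of "P z - P y" "\<mu> *\<^sub>R (G z - G y)"] lam by simp
        also have "\<dots> \<le> ?N + \<mu> * ?N"
          using lam by (intro add_mono mult_left_mono) (auto intro: norm_fst_le norm_snd_le)
        finally show ?thesis by (simp add: distrib_right)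
      qed
      also have "\<dots> < (1 + \<mu>) * s" using N mu1 by simp
      also have "\<dots> = min s1 s2" using mu1 by (simp add: s_def)
      finally have zs: "norm (z - y) < s1" "norm (z - y) < s2" by auto
      have zero: "H d \<bullet> J (z - y) - J d \<bullet> H (z - y) = 0"
        by (simp add: J_symmetric[symmetric] H_symmetric[symmetric] H_J_commute)
      have "(H d, - J d) \<bullet> ((P z, G z) - (P y, G y)) = H d \<bullet> (P z - P y) - J d \<bullet> (G z - G y)"
        by (simp add: inner_prod_def)
      also have "\<dots> = H d \<bullet> (P z - P y - J (z - y)) - J d \<bullet> (G z - G y - H (z - y))"
        using zero by (simp add: inner_diff_right)
      also have "\<dots> \<le> norm (H d) * norm (P z - P y - J (z - y)) + norm (J d) * norm (G z - G y - H (z - y))"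
        using norm_cauchy_schwarz[of "H d" "P z - P y - J (z - y)"]
          Cauchy_Schwarz_ineq2[of "J d" "G z - G y - H (z - y)"] by linarith
      also have "\<dots> \<le> norm (H d) * (\<delta> * norm (z - y)) + norm (J d) * (\<delta> * norm (z - y))"
        using s1(2)[OF zs(1)] s2(2)[OF zs(2)] by (intro add_mono mult_left_mono) auto
      also have "\<dots> = (norm (H d) + norm (J d)) * (\<delta> * norm (z - y))" by (simp add: distrib_right)
      also have "\<dots> \<le> (norm (H d) + norm (J d) + 1) * (\<delta> * ((1 + \<mu>) * ?N))"
        using \<delta> zy by (intro mult_mono mult_left_mono) auto
      also have "\<dots> = \<delta> * c * ?N" by (simp add: c_def mult_ac)
      also have "\<delta> * c = \<epsilon>" using c by (simp add: \<delta>_def)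
      finally show "(H d, - J d) \<bullet> ((P z, G z) - (P y, G y)) \<le> \<epsilon> * ?N" .
    qed
  qed
qed

end

section \<open>Monotonicity of \<open>G\<close> from derivatives almost everywhere\<close>

context prox_on
begin

text \<open>The hypothesis makes the derivative of the reflection \<open>R\<close> nonexpansive
  wherever it exists. Rademacher's theorem and the increment estimate pass this to \<open>R\<close>
  itself, and nonexpansiveness of \<open>R\<close> gives monotonicity by polarization.\<close>

lemma monotone_of_derivative:
  assumes H: "\<And>y J d. (P has_derivative J) (at y) \<Longrightarrow> J d \<bullet> (d - J d) \<ge> 0"
  shows "(G y - G z) \<bullet> (y - z) \<ge> 0"
proof -
  define R where "R = (\<lambda>y. 2 *\<^sub>R P y - y)"
  define L where "L = 1 / (1 - \<mu> * \<rho>)"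
  have L: "L-lipschitz_on UNIV P" unfolding L_def by (rule P_lipschitz)
  have RL: "norm (R y - R z) \<le> (2 * L + 1) * norm (y - z)" for y z
  proof -
    have "R y - R z = 2 *\<^sub>R (P y - P z) - (y - z)" by (simp add: R_def algebra_simps)
    then have "norm (R y - R z) \<le> 2 * norm (P y - P z) + norm (y - z)"
      using norm_triangle_ineq4[of "2 *\<^sub>R (P y - P z)" "y - z"] by simp
    then show ?thesis using lipschitz_onD[OF L, of y z] by (simp add: dist_norm algebra_simps)
  qed
  have L0: "L \<ge> 0" by (rule lipschitz_on_nonneg[OF L])
  have R_nonexp: "norm (R y - R z) \<le> norm (y - z)" for y z
  proof -
    \<comment> \<open>Pairing with this fixed vector reduces \<open>R\<close> to a scalar function
      whose increment from \<open>z\<close> to \<open>z + d = y\<close> is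
      \<open>u \<bullet> u\<close>.\<close>
    define u where "u = R y - R z"
    define d where "d = y - z"
    have lip: "((2 * L + 1) * norm u)-lipschitz_on UNIV (\<lambda>y. R y \<bullet> u)"
    proof (rule lipschitz_onI)
      fix a b
      have "\<bar>R a \<bullet> u - R b \<bullet> u\<bar> \<le> norm (R a - R b) * norm u"
        using Cauchy_Schwarz_ineq2[of "R a - R b" u] by (simp add: inner_diff_left)
      also have "\<dots> \<le> ((2 * L + 1) * norm (a - b)) * norm u" by (intro mult_right_mono RL) simp
      finally show "dist (R a \<bullet> u) (R b \<bullet> u) \<le> (2 * L + 1) * norm u * dist a b"
        by (simp add: dist_norm mult_ac)
    qed (use L0 in simp)
    have "AE x in lborel. \<exists>D\<le>norm d * norm u. (diff_quot (\<lambda>y. R y \<bullet> u) d x \<longlongrightarrow> D) (at 0)"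
      using rademacher[OF L]
    proof eventually_elim
      case (elim x)
      then obtain J where J: "(P has_derivative J) (at x)" by (auto simp: differentiable_def)
      let ?D = "(2 *\<^sub>R J d - d) \<bullet> u"
      have "((\<lambda>y. R y \<bullet> u) has_derivative (\<lambda>h. (2 *\<^sub>R J h - h) \<bullet> u)) (at x)"
        unfolding R_def by (auto intro!: derivative_eq_intros J)
      then have "((\<lambda>t. R (x + t *\<^sub>R d) \<bullet> u) has_derivative (\<lambda>t. (2 *\<^sub>R J (t *\<^sub>R d) - t *\<^sub>R d) \<bullet> u)) (at 0)"
        by (intro has_derivative_compose[of "\<lambda>t. x + t *\<^sub>R d" "\<lambda>t. t *\<^sub>R d" 0 UNIV "\<lambda>y. R y \<bullet> u"])
          (auto intro!: derivative_eq_intros)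
      then have "((\<lambda>t. R (x + t *\<^sub>R d) \<bullet> u) has_real_derivative ?D) (at 0)"
        unfolding has_field_derivative_def
        by (rule has_derivative_eq_rhs)
          (simp add: fun_eq_iff linear_scale[OF has_derivative_linear[OF J]] inner_diff_left algebra_simps)
      then have "(diff_quot (\<lambda>y. R y \<bullet> u) d x \<longlongrightarrow> ?D) (at 0)"
        by (simp add: has_field_derivative_iff diff_quot_def[abs_def])
      moreover have "?D \<le> norm d * norm u"
      proof -
        have "(norm (2 *\<^sub>R J d - d))\<^sup>2 = (norm d)\<^sup>2 - 4 * (J d \<bullet> (d - J d))"
          unfolding power2_norm_eq_inner
          by (simp add: inner_diff_left inner_diff_right inner_commute)
        then have "(norm (2 *\<^sub>R J d - d))\<^sup>2 \<le> (norm d)\<^sup>2" using H[OF J, of d] by simp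
        then have "norm (2 *\<^sub>R J d - d) \<le> norm d" by (rule power2_le_imp_le) simp
        then have "norm (2 *\<^sub>R J d - d) * norm u \<le> norm d * norm u" by (rule mult_right_mono) simp
        then show ?thesis using norm_cauchy_schwarz[of "2 *\<^sub>R J d - d" u] by linarith
      qed
      ultimately show ?case by blast
    qed
    from lipschitz_increment_le_of_AE_directional_derivative[OF lip this, of z]
    have "u \<bullet> u \<le> norm d * norm u" by (simp add: d_def u_def inner_diff_left)
    then have "norm u * norm u \<le> norm d * norm u" by (simp add: dot_square_norm power2_eq_square)
    then show ?thesis by (cases "u = 0") (auto simp: u_def d_def)
  qed
  define a where "a = P y - P z"
  define b where "b = G y - G z"
  have yz: "y - z = a + \<mu> *\<^sub>R b" using lam by (simp add: a_def b_def G_def algebra_simps)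
  \<comment> \<open>With sum \<open>y - z\<close> and difference \<open>R y - R z\<close> of
    \<open>a\<close> and \<open>\<mu> *\<^sub>R b\<close>, comparing squared norms isolates the sign
    of \<open>a \<bullet> b\<close>.\<close>
  have "R y - R z = a - \<mu> *\<^sub>R b" using yz by (simp add: R_def a_def algebra_simps scaleR_2)
  then have "(norm (a - \<mu> *\<^sub>R b))\<^sup>2 \<le> (norm (a + \<mu> *\<^sub>R b))\<^sup>2"
    using R_nonexp[of y z] yz by (intro power_mono) auto
  then have "\<mu> * (a \<bullet> b) \<ge> 0"
    unfolding power2_norm_eq_inner
    by (simp add: inner_diff_left inner_diff_right inner_add_left inner_add_right inner_commute)
  then have ab: "a \<bullet> b \<ge> 0" using lam by (simp add: zero_le_mult_iff)
  have "b \<bullet> (a + \<mu> *\<^sub>R b) \<ge> 0" using ab lam by (simp add: inner_add_right inner_commute)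
  then show ?thesis by (simp add: yz b_def)
qed

end

subsection \<open>Normal cones and second subderivatives\<close>

text \<open>At \<open>z = zb\<close> both sides of the inequality vanish, so the punctured
  neighbourhoods behind the upper limit may be replaced by full balls; isolated points are covered
  as well.\<close>

lemma regular_normal_cone_iff:
  "v \<in> regular_normal_cone \<Omega> zb \<longleftrightarrow>
    (\<forall>\<epsilon>>0. \<exists>s>0. \<forall>z\<in>\<Omega>. norm (z - zb) < s \<longrightarrow> v \<bullet> (z - zb) \<le> \<epsilon> * norm (z - zb))" (is "_ \<longleftrightarrow> ?R")
proof
  assume "v \<in> regular_normal_cone \<Omega> zb"
  then have L: "\<And>y. y > 0 \<Longrightarrow> \<forall>\<^sub>F z in at zb within \<Omega>. y > ereal (v \<bullet> (z - zb) / norm (z - zb))"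
    unfolding regular_normal_cone_def Limsup_le_iff by blast
  show ?R
  proof (intro allI impI)
    fix \<epsilon> :: real assume "\<epsilon> > 0"
    then have "\<forall>\<^sub>F z in at zb within \<Omega>. v \<bullet> (z - zb) / norm (z - zb) < \<epsilon>"
      using L[of "ereal \<epsilon>"] by simp
    then obtain s where s: "s > 0" "\<And>z. z \<in> \<Omega> \<Longrightarrow> z \<noteq> zb \<Longrightarrow> dist z zb < s \<Longrightarrow> v \<bullet> (z - zb) / norm (z - zb) < \<epsilon>"
      unfolding eventually_at by blast
    have "v \<bullet> (z - zb) \<le> \<epsilon> * norm (z - zb)" if "z \<in> \<Omega>" "norm (z - zb) < s" for z
    proof (cases "z = zb")
      case False
      then have "v \<bullet> (z - zb) / norm (z - zb) < \<epsilon>" using that by (intro s(2)) (auto simp: dist_norm)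
      then show ?thesis using False by (simp add: pos_divide_less_eq)
    qed simp
    then show "\<exists>s>0. \<forall>z\<in>\<Omega>. norm (z - zb) < s \<longrightarrow> v \<bullet> (z - zb) \<le> \<epsilon> * norm (z - zb)"
      using s(1) by blast
  qed
next
  assume R: ?R
  have "\<forall>\<^sub>F z in at zb within \<Omega>. ereal (v \<bullet> (z - zb) / norm (z - zb)) < c" if c: "c > 0" for c
  proof -
    obtain r where r: "0 < ereal r" "ereal r < c" using ereal_dense2[OF c] by (metis zero_ereal_def)
    then have "r > 0" by simp
    then obtain s where s: "s > 0" "\<And>z. z \<in> \<Omega> \<Longrightarrow> norm (z - zb) < s \<Longrightarrow> v \<bullet> (z - zb) \<le> r * norm (z - zb)"
      using R by blast
    have "ereal (v \<bullet> (z - zb) / norm (z - zb)) < c" if "z \<in> \<Omega>" "z \<noteq> zb" "dist z zb < s" for z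
    proof -
      have "v \<bullet> (z - zb) / norm (z - zb) \<le> r"
        using s(2)[of z] that by (simp add: dist_norm pos_divide_le_eq)
      then have "ereal (v \<bullet> (z - zb) / norm (z - zb)) \<le> ereal r" by simp
      then show ?thesis using r(2) by (rule le_less_trans)
    qed
    then show ?thesis unfolding eventually_at using s(1) by blast
  qed
  then show "v \<in> regular_normal_cone \<Omega> zb"
    unfolding regular_normal_cone_def Limsup_le_iff by blast
qed

lemma regular_subset_limiting_normal_cone:
  "zb \<in> \<Omega> \<Longrightarrow> regular_normal_cone \<Omega> zb \<subseteq> limiting_normal_cone \<Omega> zb"
  unfolding limiting_normal_cone_def by (blast intro: tendsto_const)

lemma closed_epi_of_lsc:
  assumes lsc: "lower_semicontinuous (\<phi> :: 'a::metric_space \<Rightarrow> ereal)"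
  shows "closed {(x, a :: real). \<phi> x \<le> ereal a}"
  unfolding closed_sequential_limits
proof (intro allI impI, elim conjE)
  fix Z :: "nat \<Rightarrow> 'a \<times> real" and l
  assume Z: "\<forall>n. Z n \<in> {(x, a). \<phi> x \<le> ereal a}" and lim: "Z \<longlonglongrightarrow> l"
  obtain x a where l: "l = (x, a)" by (cases l)
  have X: "(\<lambda>n. fst (Z n)) \<longlonglongrightarrow> x" and A: "(\<lambda>n. snd (Z n)) \<longlonglongrightarrow> a"
    using tendsto_fst[OF lim] tendsto_snd[OF lim] by (simp_all add: l)
  have le: "\<phi> (fst (Z n)) \<le> ereal (snd (Z n))" for n using Z[rule_format, of n] by (auto simp: case_prod_beta)
  have "\<phi> x \<le> ereal a"
  proof (rule ccontr)
    assume "\<not> ?thesis"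
    then have "ereal a < \<phi> x" by simp
    then obtain b where b: "ereal a < ereal b" "ereal b < \<phi> x" using ereal_dense2 by blast
    have "ereal b < Liminf (at x) \<phi>" using b(2) lsc by (auto simp: lower_semicontinuous_def intro: less_le_trans)
    then have "\<forall>\<^sub>F y in at x. ereal b < \<phi> y" by (rule less_LiminfD)
    \<comment> \<open>The lower limit ignores \<open>x\<close> itself; the strict inequality there
      is added because the sequence may hit \<open>x\<close>.\<close>
    then have "\<forall>\<^sub>F y in nhds x. ereal b < \<phi> y" using b(2) by (auto simp: eventually_at_filter elim!: eventually_mono)
    then have "\<forall>\<^sub>F n in sequentially. ereal b < \<phi> (fst (Z n))"
      by (rule eventually_compose_filterlim[OF _ X])
    moreover have "\<forall>\<^sub>F n in sequentially. snd (Z n) < b"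
      using order_tendstoD(2)[OF A] b(1) by simp
    ultimately have "\<forall>\<^sub>F n in sequentially. False"
    proof eventually_elim
      case (elim n)
      from less_le_trans[OF elim(1) le[of n]] have "b < snd (Z n)" by simp
      with elim(2) show False by simp
    qed
    then show False by simp
  qed
  then show "l \<in> {(x, a). \<phi> x \<le> ereal a}" by (simp add: l)
qed

section \<open>Limiting subgradients of extended-valued weakly convex functions\<close>

text \<open>The value \<open>\<rho> = 0\<close> is included, so that convex functions are an
  instance and share the whole development.\<close>

locale ereal_weakly_convex =
  fixes \<phi> :: "'a::euclidean_space \<Rightarrow> ereal" and \<rho> :: real
  assumes no_minf: "\<And>x. \<phi> x \<noteq> -\<infinity>" and proper: "proper_fun \<phi>"
    and lsc: "lower_semicontinuous \<phi>" and rho_nonneg: "0 \<le> \<rho>" and sconv: "s_convex (- \<rho>) \<phi>"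
begin

abbreviation \<phi>r :: "'a \<Rightarrow> real" where "\<phi>r x \<equiv> real_of_ereal (\<phi> x)"

lemma phi_eq: "x \<in> dom_fun \<phi> \<Longrightarrow> \<phi> x = ereal (\<phi>r x)"
  using no_minf[of x] by (cases "\<phi> x") (auto simp: dom_fun_def)

lemma phi_infinite: "x \<notin> dom_fun \<phi> \<Longrightarrow> \<phi> x = \<infinity>"
  by (simp add: dom_fun_def)

lemma phi_le_iff: "\<phi> x \<le> ereal a \<longleftrightarrow> x \<in> dom_fun \<phi> \<and> \<phi>r x \<le> a"
proof (cases "x \<in> dom_fun \<phi>")
  case True
  then show ?thesis using phi_eq[OF True] by (metis ereal_less_eq(3))
next
  case False
  then show ?thesis using phi_infinite[OF False] by simp
qed

lemma epi_eq: "epi \<phi> = {(x, a). x \<in> dom_fun \<phi> \<and> \<phi>r x \<le> a}"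
  by (auto simp: epi_def phi_le_iff)

lemma phi_convex_combination:
  assumes "x \<in> dom_fun \<phi>" "y \<in> dom_fun \<phi>" "0 < l" "l < 1"
  shows "\<phi> ((1 - l) *\<^sub>R x + l *\<^sub>R y)
    \<le> ereal ((1 - l) * \<phi>r x + l * \<phi>r y + \<rho> / 2 * l * (1 - l) * (norm (x - y))\<^sup>2)"
proof -
  have "\<phi> ((1 - l) *\<^sub>R x + l *\<^sub>R y) \<le> ereal (1 - l) * \<phi> x + ereal l * \<phi> y
      - ereal (- \<rho> / 2 * l * (1 - l) * (norm (x - y))\<^sup>2)"
    using sconv assms(3,4) by (auto simp: s_convex_def)
  also have "\<dots> = ereal ((1 - l) * \<phi>r x + l * \<phi>r y + \<rho> / 2 * l * (1 - l) * (norm (x - y))\<^sup>2)"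
    by (subst phi_eq[OF assms(1)], subst phi_eq[OF assms(2)]) simp
  finally show ?thesis .
qed

sublocale weakly_convex_on "dom_fun \<phi>" \<phi>r \<rho>
proof
  show "dom_fun \<phi> \<noteq> {}" using proper by (simp add: proper_fun_def)
  show "closed {(x, a). x \<in> dom_fun \<phi> \<and> \<phi>r x \<le> a}"
    using closed_epi_of_lsc[OF lsc] by (simp add: phi_le_iff)
  show "0 \<le> \<rho>" by (rule rho_nonneg)
next
  fix x y l assume "x \<in> dom_fun \<phi>" "y \<in> dom_fun \<phi>" "0 < (l::real)" "l < 1"
  from phi_convex_combination[OF this]
  show "(1 - l) *\<^sub>R x + l *\<^sub>R y \<in> dom_fun \<phi>"
    "\<phi>r ((1 - l) *\<^sub>R x + l *\<^sub>R y) \<le> (1 - l) * \<phi>r x + l * \<phi>r y + \<rho> / 2 * l * (1 - l) * (norm (x - y))\<^sup>2"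
    by (simp_all add: phi_le_iff)
qed

text \<open>Weak convexity supplies a curve in the epigraph from \<open>(x, a)\<close> towards
  \<open>p\<close>; testing the normal along it and dividing by \<open>t\<close> gives a global
  inequality. A general \<open>\<beta>\<close> and heights \<open>a\<close> above the graph are
  allowed because the normals approximating \<open>(v, -1)\<close> may have both.\<close>

lemma regular_normal_epi_imp:
  assumes xa: "(x, a) \<in> epi \<phi>" and N: "(v, - \<beta>) \<in> regular_normal_cone (epi \<phi>) (x, a)" and p: "p \<in> dom_fun \<phi>"
  shows "v \<bullet> (p - x) - \<beta> * (\<phi>r p - a + \<rho> / 2 * (norm (p - x))\<^sup>2) \<le> 0"
proof -
  let ?n = "(norm (x - p))\<^sup>2"
  have x: "x \<in> dom_fun \<phi>" "\<phi>r x \<le> a" using xa by (auto simp: epi_eq)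
  define c where "c = (\<lambda>t. \<phi>r p - a + \<rho> / 2 * (1 - t) * ?n)"
  define Z where "Z = (\<lambda>t. ((1 - t) *\<^sub>R x + t *\<^sub>R p, a + t * c t))"
  have Zin: "Z t \<in> epi \<phi>" if t: "0 < t" "t < 1" for t
  proof -
    have "\<phi>r ((1 - t) *\<^sub>R x + t *\<^sub>R p) \<le> (1 - t) * \<phi>r x + t * \<phi>r p + \<rho> / 2 * t * (1 - t) * ?n"
      by (rule wconv[OF x(1) p t])
    also have "\<dots> \<le> (1 - t) * a + t * \<phi>r p + \<rho> / 2 * t * (1 - t) * ?n"
      using x(2) t by simp
    also have "\<dots> = a + t * c t" by (simp add: c_def algebra_simps)
    finally show ?thesis using conv[OF x(1) p t] by (simp add: Z_def epi_eq)
  qed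
  have Zd: "Z t - (x, a) = t *\<^sub>R (p - x, c t)" for t
    by (simp add: Z_def algebra_simps)
  have ct: "(c \<longlongrightarrow> c 0) (at_right 0)" unfolding c_def by (intro tendsto_intros)
  have lim0: "((\<lambda>t. norm (Z t - (x, a))) \<longlongrightarrow> 0) (at_right 0)"
  proof -
    have "((\<lambda>t. norm (t *\<^sub>R (p - x, c t))) \<longlongrightarrow> norm (0 *\<^sub>R (p - x, c 0))) (at_right 0)"
      by (intro tendsto_intros ct)
    then show ?thesis by (simp add: Zd)
  qed
  have key: "v \<bullet> (p - x) - \<beta> * c 0 \<le> \<epsilon> * norm (p - x, c 0)" if \<epsilon>: "\<epsilon> > 0" for \<epsilon>
  proof -
    obtain s where s: "s > 0" "\<And>z. z \<in> epi \<phi> \<Longrightarrow> norm (z - (x, a)) < s \<Longrightarrow> (v, - \<beta>) \<bullet> (z - (x, a)) \<le> \<epsilon> * norm (z - (x, a))"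
      using N \<epsilon> unfolding regular_normal_cone_iff by blast
    have "\<forall>\<^sub>F t in at_right 0. v \<bullet> (p - x) - \<beta> * c t \<le> \<epsilon> * norm (p - x, c t)"
      using order_tendstoD(2)[OF lim0 s(1)] eventually_at_right_real[OF zero_less_one]
    proof eventually_elim
      case (elim t)
      then have t: "0 < t" "t < 1" by auto
      have "(v, - \<beta>) \<bullet> (Z t - (x, a)) \<le> \<epsilon> * norm (Z t - (x, a))" using elim Zin[OF t] by (intro s(2)) auto
      moreover have "(v, - \<beta>) \<bullet> (Z t - (x, a)) = t * (v \<bullet> (p - x) - \<beta> * c t)"
        unfolding Zd by (simp add: inner_prod_def algebra_simps)
      moreover have "\<epsilon> * norm (Z t - (x, a)) = t * (\<epsilon> * norm (p - x, c t))"
        unfolding Zd norm_scaleR using t by simp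
      ultimately show ?case using t by simp
    qed
    moreover have "((\<lambda>t. v \<bullet> (p - x) - \<beta> * c t) \<longlongrightarrow> v \<bullet> (p - x) - \<beta> * c 0) (at_right 0)"
      by (intro tendsto_intros ct)
    moreover have "((\<lambda>t. \<epsilon> * norm (p - x, c t)) \<longlongrightarrow> \<epsilon> * norm (p - x, c 0)) (at_right 0)"
      by (intro tendsto_intros ct)
    ultimately show ?thesis by (intro tendsto_le[of "at_right (0::real)"]) auto
  qed
  have "v \<bullet> (p - x) - \<beta> * c 0 \<le> 0"
  proof (rule field_le_epsilon)
    fix e :: real assume e: "e > 0"
    define K where "K = norm (p - x, c 0) + 1"
    have K: "K > 0" by (simp add: K_def add_nonneg_pos)
    have "v \<bullet> (p - x) - \<beta> * c 0 \<le> e / K * norm (p - x, c 0)" using key[of "e / K"] e K by simp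
    also have "\<dots> \<le> e / K * K" using e K by (intro mult_left_mono) (auto simp: K_def)
    finally show "v \<bullet> (p - x) - \<beta> * c 0 \<le> 0 + e" using K by simp
  qed
  then show ?thesis by (simp add: c_def norm_minus_commute)
qed

text \<open>Left to right, the global inequality for regular normals passes to limits. Right to
  left, the global inequality makes \<open>(v, -1)\<close> a regular normal, since its quadratic
  error is of smaller order than the distance.\<close>

lemma gph_subdifferential_eq: "gph_subdifferential \<phi> = gph"
proof (intro equalityI subsetI)
  fix q assume "q \<in> gph_subdifferential \<phi>"
  then obtain x v where q: "q = (x, v)" and x: "x \<in> dom_fun \<phi>"
    and N: "(v, -1) \<in> limiting_normal_cone (epi \<phi>) (x, \<phi>r x)"
    by (auto simp: gph_subdifferential_def limiting_subdifferential_def split: if_splits)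
  then obtain z u where z: "z \<longlonglongrightarrow> (x, \<phi>r x)" "\<And>k. z k \<in> epi \<phi>"
    and u: "u \<longlonglongrightarrow> (v, -1)" "\<And>k. u k \<in> regular_normal_cone (epi \<phi>) (z k)"
    unfolding limiting_normal_cone_def by blast
  have "\<phi>r x + v \<bullet> (p - x) - \<rho> / 2 * (norm (p - x))\<^sup>2 \<le> \<phi>r p" if p: "p \<in> dom_fun \<phi>" for p
  proof -
    have *: "fst (u k) \<bullet> (p - fst (z k)) - (- snd (u k)) * (\<phi>r p - snd (z k) + \<rho> / 2 * (norm (p - fst (z k)))\<^sup>2) \<le> 0" for k
      using z(2)[of k] u(2)[of k] by (intro regular_normal_epi_imp[OF _ _ p]) auto
    have l: "(\<lambda>k. fst (u k)) \<longlonglongrightarrow> v" "(\<lambda>k. snd (u k)) \<longlonglongrightarrow> -1"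
      "(\<lambda>k. fst (z k)) \<longlonglongrightarrow> x" "(\<lambda>k. snd (z k)) \<longlonglongrightarrow> \<phi>r x"
      using tendsto_fst[OF u(1)] tendsto_snd[OF u(1)] tendsto_fst[OF z(1)] tendsto_snd[OF z(1)] by simp_all
    have "(\<lambda>k. fst (u k) \<bullet> (p - fst (z k)) - (- snd (u k)) * (\<phi>r p - snd (z k) + \<rho> / 2 * (norm (p - fst (z k)))\<^sup>2))
      \<longlonglongrightarrow> v \<bullet> (p - x) - (- (-1)) * (\<phi>r p - \<phi>r x + \<rho> / 2 * (norm (p - x))\<^sup>2)"
      by (intro tendsto_intros l)
    then have "v \<bullet> (p - x) - (- (-1)) * (\<phi>r p - \<phi>r x + \<rho> / 2 * (norm (p - x))\<^sup>2) \<le> 0"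
      by (rule LIMSEQ_le_const2) (use * in auto)
    then show ?thesis by simp
  qed
  then show "q \<in> gph" using x by (simp add: q gph_def)
next
  fix q assume "q \<in> gph"
  then obtain x v where q: "q = (x, v)" and x: "x \<in> dom_fun \<phi>"
    and g: "\<And>p. p \<in> dom_fun \<phi> \<Longrightarrow> \<phi>r x + v \<bullet> (p - x) - \<rho> / 2 * (norm (p - x))\<^sup>2 \<le> \<phi>r p"
    by (auto simp: gph_def)
  have "(v, -1) \<in> regular_normal_cone (epi \<phi>) (x, \<phi>r x)"
    unfolding regular_normal_cone_iff
  proof (intro allI impI)
    fix \<epsilon> :: real assume \<epsilon>: "\<epsilon> > 0"
    have r1: "\<rho> + 1 > 0" using rho_nonneg by simp
    show "\<exists>s>0. \<forall>z\<in>epi \<phi>. norm (z - (x, \<phi>r x)) < s \<longrightarrow> (v, -1) \<bullet> (z - (x, \<phi>r x)) \<le> \<epsilon> * norm (z - (x, \<phi>r x))"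
    \<comment> \<open>The only error is \<open>\<rho> / 2\<close> times a squared distance, at most
      \<open>(\<rho> + 1) * ?N * ?N\<close>, hence at most \<open>\<epsilon> * ?N\<close> within
      this radius.\<close>
    proof (intro exI[of _ "\<epsilon> / (\<rho> + 1)"] conjI ballI impI)
      show "\<epsilon> / (\<rho> + 1) > 0" using \<epsilon> r1 by simp
      fix z assume z: "z \<in> epi \<phi>" "norm (z - (x, \<phi>r x)) < \<epsilon> / (\<rho> + 1)"
      obtain p a where pa: "z = (p, a)" by (cases z)
      let ?N = "norm (z - (x, \<phi>r x))"
      have p: "p \<in> dom_fun \<phi>" "\<phi>r p \<le> a" using z(1) by (auto simp: pa epi_eq)
      have "norm (p - x) \<le> ?N" by (simp add: pa norm_fst_le)
      then have n2: "(norm (p - x))\<^sup>2 \<le> ?N * ?N" by (simp add: power2_eq_square mult_mono)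
      have "(v, -1) \<bullet> (z - (x, \<phi>r x)) = v \<bullet> (p - x) - (a - \<phi>r x)"
        by (simp add: pa inner_prod_def)
      also have "\<dots> \<le> \<rho> / 2 * (norm (p - x))\<^sup>2" using g[OF p(1)] p(2) by linarith
      also have "\<dots> \<le> (\<rho> + 1) * (?N * ?N)" using n2 rho_nonneg by (intro mult_mono) auto
      also have "\<dots> = ((\<rho> + 1) * ?N) * ?N" by simp
      also have "\<dots> \<le> \<epsilon> * ?N"
        using z(2) r1 by (intro mult_right_mono) (auto simp: pos_less_divide_eq mult.commute)
      finally show "(v, -1) \<bullet> (z - (x, \<phi>r x)) \<le> \<epsilon> * norm (z - (x, \<phi>r x))" .
    qed
  qed
  moreover have "(x, \<phi>r x) \<in> epi \<phi>" using x by (simp add: epi_eq)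
  ultimately have "(v, -1) \<in> limiting_normal_cone (epi \<phi>) (x, \<phi>r x)"
    using regular_subset_limiting_normal_cone by blast
  then show "q \<in> gph_subdifferential \<phi>"
    using x by (simp add: q gph_subdifferential_def limiting_subdifferential_def)
qed

lemma second_diff_quotient_eq:
  assumes "x \<in> dom_fun \<phi>" "x + \<tau> *\<^sub>R u \<in> dom_fun \<phi>" 
  shows "second_diff_quotient \<phi> x v \<tau> u = ereal ((\<phi>r (x + \<tau> *\<^sub>R u) - \<phi>r x - \<tau> * (v \<bullet> u)) / (1 / 2 * \<tau>\<^sup>2))"
  unfolding second_diff_quotient_def
  by (subst phi_eq[OF assms(1)], subst phi_eq[OF assms(2)]) simp

lemma second_diff_quotient_infinite:
  assumes "x \<in> dom_fun \<phi>" "x + \<tau> *\<^sub>R u \<notin> dom_fun \<phi>" "\<tau> > 0"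
  shows "second_diff_quotient \<phi> x v \<tau> u = \<infinity>"
  unfolding second_diff_quotient_def
  by (subst phi_eq[OF assms(1)], subst phi_infinite[OF assms(2)]) (use assms(3) in simp)

end

section \<open>The second subderivative at proximal points\<close>

locale ereal_prox = ereal_weakly_convex + 
  fixes \<mu> :: real
  assumes mu_pos: "\<mu> > 0" and mu_rho: "\<mu> * \<rho> < 1"
begin

sublocale prox_on "dom_fun \<phi>" \<phi>r \<rho> \<mu>
  by unfold_locales (rule mu_pos mu_rho)+

end

locale ereal_prox_differentiable = ereal_prox +
  fixes y :: 'a and J :: "'a \<Rightarrow> 'a"
  assumes J_deriv: "(P has_derivative J) (at y)"
begin

sublocale prox_differentiable "dom_fun \<phi>" \<phi>r \<rho> \<mu> y J
  by unfold_locales (rule J_deriv)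

abbreviation D2 :: "'a \<Rightarrow> ereal" where "D2 \<equiv> second_subderivative \<phi> (P y) (G y)"

text \<open>The threshold in \<open>second_order_lower_bound\<close> does not depend on
  \<open>u\<close>, and \<open>norm (u - d)\<close> is continuous in \<open>u\<close>; so the bound
  survives the joint lower limit.\<close>

lemma D2_lower: "ereal (H d \<bullet> d - (norm (w - d))\<^sup>2 / \<mu>) \<le> D2 w"
  unfolding second_subderivative_def le_Liminf_iff
proof (intro allI impI)
  fix b assume b: "b < ereal (H d \<bullet> d - (norm (w - d))\<^sup>2 / \<mu>)"
  let ?C = "H d \<bullet> d - (norm (w - d))\<^sup>2 / \<mu>"
  obtain r where r: "b < ereal r" "ereal r < ereal ?C" using ereal_dense2[OF b] by blast
  \<comment> \<open>One third is spent on the expansion, one on moving \<open>u\<close> away from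
    \<open>w\<close>, and one keeps the inequality strict.\<close>
  define \<epsilon> where "\<epsilon> = (?C - r) / 3"
  have \<epsilon>: "\<epsilon> > 0" using r by (simp add: \<epsilon>_def)
  obtain s where s: "s > 0" "\<And>t u. 0 < t \<Longrightarrow> t < s \<Longrightarrow> P y + t *\<^sub>R u \<in> dom_fun \<phi> \<Longrightarrow>
    (H d \<bullet> d - (norm (u - d))\<^sup>2 / \<mu> - \<epsilon>) * (t\<^sup>2 / 2) \<le> \<phi>r (P y + t *\<^sub>R u) - \<phi>r (P y) - t * (G y \<bullet> u)"
    using second_order_lower_bound[OF \<epsilon>, of d] by blast
  have "((\<lambda>u. (norm (u - d))\<^sup>2 / \<mu>) \<longlongrightarrow> (norm (w - d))\<^sup>2 / \<mu>) (nhds w)"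
    using mu_pos by (intro tendsto_intros filterlim_ident) auto
  then have e1: "\<forall>\<^sub>F u in nhds w. (norm (u - d))\<^sup>2 / \<mu> < (norm (w - d))\<^sup>2 / \<mu> + \<epsilon>"
    by (rule order_tendstoD) (use \<epsilon> in simp)
  have e2: "\<forall>\<^sub>F t in at_right 0. t \<in> {0<..<s}" by (rule eventually_at_right_real[OF s(1)])
  have "b < second_diff_quotient \<phi> (P y) (G y) t u"
    if t: "t \<in> {0<..<s}" and u: "(norm (u - d))\<^sup>2 / \<mu> < (norm (w - d))\<^sup>2 / \<mu> + \<epsilon>" for t u
  proof (cases "P y + t *\<^sub>R u \<in> dom_fun \<phi>")
    case True
    have t2: "1 / 2 * t\<^sup>2 > 0" using t by simp
    have "(H d \<bullet> d - (norm (u - d))\<^sup>2 / \<mu> - \<epsilon>) * (1 / 2 * t\<^sup>2) \<le> \<phi>r (P y + t *\<^sub>R u) - \<phi>r (P y) - t * (G y \<bullet> u)"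
      using s(2)[of t u] t True by simp
    then have "H d \<bullet> d - (norm (u - d))\<^sup>2 / \<mu> - \<epsilon> \<le> (\<phi>r (P y + t *\<^sub>R u) - \<phi>r (P y) - t * (G y \<bullet> u)) / (1 / 2 * t\<^sup>2)"
      using t2 by (subst pos_le_divide_eq) auto
    moreover have "r < H d \<bullet> d - (norm (u - d))\<^sup>2 / \<mu> - \<epsilon>"
    proof -
      have "3 * ((c - r) / 3) = c - r" for c :: real by simp
      then have "3 * \<epsilon> = ?C - r" unfolding \<epsilon>_def .
      then show ?thesis using u \<epsilon> by linarith
    qed
    ultimately have "ereal r < second_diff_quotient \<phi> (P y) (G y) t u"
      by (simp only: second_diff_quotient_eq[OF P_in True] ereal_less_eq less_ereal.simps(1))
    with r(1) show ?thesis by (rule less_trans)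
  next
    case False
    then show ?thesis using second_diff_quotient_infinite[OF P_in False, of "G y"] t r(1) by auto
  qed
  then show "\<forall>\<^sub>F z in at_right 0 \<times>\<^sub>F nhds w. b < (case z of (\<tau>, u) \<Rightarrow> second_diff_quotient \<phi> (P y) (G y) \<tau> u)"
    unfolding eventually_prod_filter using e1 e2
    by (intro exI[of _ "\<lambda>t. t \<in> {0<..<s}"] exI[of _ "\<lambda>u. (norm (u - d))\<^sup>2 / \<mu> < (norm (w - d))\<^sup>2 / \<mu> + \<epsilon>"]) simp
qed

lemma filterlim_at_right_prod_nhds:
  assumes "\<And>k. \<tau> k > (0::real)" "\<tau> \<longlonglongrightarrow> 0" "ws \<longlonglongrightarrow> w"
  shows "filterlim (\<lambda>k. (\<tau> k, ws k)) (at_right 0 \<times>\<^sub>F nhds w) sequentially"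
  using assms by (intro filterlim_Pair tendsto_imp_filterlim_at_right) auto

lemma quotient_recovery:
  assumes \<tau>: "\<And>k. \<tau> k > 0" "\<tau> \<longlonglongrightarrow> 0"
  shows "\<exists>ws. ws \<longlonglongrightarrow> J d \<and>
    (\<lambda>k. second_diff_quotient \<phi> (P y) (G y) (\<tau> k) (ws k)) \<longlonglongrightarrow> ereal (H d \<bullet> J d)"
proof -
  define ws where "ws = (\<lambda>k. (1 / \<tau> k) *\<^sub>R (P (y + \<tau> k *\<^sub>R d) - P y))"
  note rs = recovery_sequence[OF \<tau>, where d = d]
  have ws: "ws \<longlonglongrightarrow> J d" "P y + \<tau> k *\<^sub>R ws k \<in> dom_fun \<phi>"
    "(\<lambda>k. (\<phi>r (P y + \<tau> k *\<^sub>R ws k) - \<phi>r (P y) - \<tau> k * (G y \<bullet> ws k)) / (1 / 2 * (\<tau> k)\<^sup>2)) \<longlonglongrightarrow> H d \<bullet> J d" for k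
    unfolding ws_def by (rule rs)+
  have "(\<lambda>k. second_diff_quotient \<phi> (P y) (G y) (\<tau> k) (ws k)) \<longlonglongrightarrow> ereal (H d \<bullet> J d)"
  proof -
    have "second_diff_quotient \<phi> (P y) (G y) (\<tau> k) (ws k)
      = ereal ((\<phi>r (P y + \<tau> k *\<^sub>R ws k) - \<phi>r (P y) - \<tau> k * (G y \<bullet> ws k)) / (1 / 2 * (\<tau> k)\<^sup>2))" for k
      by (intro second_diff_quotient_eq P_in ws(2))
    then show ?thesis using tendsto_ereal[OF ws(3)] by (simp only:)
  qed
  then show ?thesis using ws(1) by blast
qed

lemma D2_range: "D2 (J d) = ereal (H d \<bullet> J d)"
proof (rule antisym)
  show "ereal (H d \<bullet> J d) \<le> D2 (J d)" using D2_lower[of d "J d"] by (simp only: lower_bound_at_range)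
  show "D2 (J d) \<le> ereal (H d \<bullet> J d)"
  proof (rule ccontr)
    assume "\<not> ?thesis"
    then have "ereal (H d \<bullet> J d) < D2 (J d)" by simp
    then obtain b where b: "ereal (H d \<bullet> J d) < ereal b" "ereal b < D2 (J d)" using ereal_dense2 by blast
    define \<tau> where "\<tau> = (\<lambda>k. inverse (real (Suc k)))"
    have \<tau>: "\<And>k. \<tau> k > 0" "\<tau> \<longlonglongrightarrow> 0"
      unfolding \<tau>_def using LIMSEQ_inverse_real_of_nat by (simp_all del: of_nat_Suc)
    obtain ws where ws: "ws \<longlonglongrightarrow> J d" "(\<lambda>k. second_diff_quotient \<phi> (P y) (G y) (\<tau> k) (ws k)) \<longlonglongrightarrow> ereal (H d \<bullet> J d)"
      using quotient_recovery[OF \<tau>] by blast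
    have "\<forall>\<^sub>F z in at_right 0 \<times>\<^sub>F nhds (J d). ereal b < (case z of (\<tau>, u) \<Rightarrow> second_diff_quotient \<phi> (P y) (G y) \<tau> u)"
      using b(2) unfolding second_subderivative_def by (rule less_LiminfD)
    from eventually_compose_filterlim[OF this filterlim_at_right_prod_nhds[OF \<tau> ws(1)]]
    have "\<forall>\<^sub>F k in sequentially. ereal b < second_diff_quotient \<phi> (P y) (G y) (\<tau> k) (ws k)" by simp
    moreover have "\<forall>\<^sub>F k in sequentially. second_diff_quotient \<phi> (P y) (G y) (\<tau> k) (ws k) < ereal b"
      by (rule order_tendstoD(2)[OF ws(2) b(1)])
    ultimately have "\<forall>\<^sub>F k in sequentially. False" by eventually_elim auto
    then show False by simp
  qed
qed

lemma D2_off_range: "w \<notin> range J \<Longrightarrow> D2 w = \<infinity>"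
  by (rule ereal_top) (metis D2_lower lower_bound_off_range ereal_less_eq(3) order_trans)

lemma twice_epi: "twice_epi_differentiable \<phi> (P y) (G y)"
  unfolding twice_epi_differentiable_def
proof (intro allI impI, elim conjE)
  fix w and \<tau> :: "nat \<Rightarrow> real" assume \<tau>: "\<forall>k. \<tau> k > 0" "\<tau> \<longlonglongrightarrow> 0"
  show "\<exists>ws. ws \<longlonglongrightarrow> w \<and> (\<lambda>k. second_diff_quotient \<phi> (P y) (G y) (\<tau> k) (ws k)) \<longlonglongrightarrow> D2 w"
  proof (cases "w \<in> range J")
    case True
    then obtain d where d: "w = J d" by auto
    show ?thesis unfolding d D2_range using \<tau> by (intro quotient_recovery) auto
  next
    case False
    \<comment> \<open>An infinite joint lower limit forces the quotients to infinity along any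
      admissible sequence, so the constant sequence \<open>w\<close> serves.\<close>
    have "(\<lambda>k. second_diff_quotient \<phi> (P y) (G y) (\<tau> k) w) \<longlonglongrightarrow> \<infinity>"
      unfolding tendsto_PInfty
    proof
      fix r
      have "ereal r < D2 w" by (simp add: D2_off_range[OF False])
      then have "\<forall>\<^sub>F z in at_right 0 \<times>\<^sub>F nhds w. ereal r < (case z of (\<tau>, u) \<Rightarrow> second_diff_quotient \<phi> (P y) (G y) \<tau> u)"
        unfolding second_subderivative_def by (rule less_LiminfD)
      from eventually_compose_filterlim[OF this filterlim_at_right_prod_nhds[OF \<tau>(1)[rule_format] \<tau>(2) tendsto_const]]
      show "\<forall>\<^sub>F k in sequentially. ereal r < second_diff_quotient \<phi> (P y) (G y) (\<tau> k) w" by simp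
    qed
    then show ?thesis using D2_off_range[OF False] by (intro exI[of _ "\<lambda>_. w"]) simp
  qed
qed

lemma graph_regular_normal: "(H d, - J d) \<in> regular_normal_cone (gph_subdifferential \<phi>) (P y, G y)"
  unfolding regular_normal_cone_iff gph_subdifferential_eq
  using graph_normal[of _ d, unfolded case_prod_beta prod.collapse] by blast

end

section \<open>From positive semidefiniteness to convexity\<close>

text \<open>A linear right inverse \<open>K\<close> of \<open>J\<close> on its range chooses a
  preimage of \<open>w\<close> linearly, so the value at \<open>w\<close> becomes
  \<open>H (K w) \<bullet> w\<close>, a quadratic form restricted to a subspace.\<close>

lemma generalized_quadratic_form_of_linear:
  fixes J H :: "real ^ 'n \<Rightarrow> real ^ 'n"
  assumes J: "linear J" and H: "linear H"
    and on: "\<And>d. q (J d) = ereal (H d \<bullet> J d)" and off: "\<And>w. w \<notin> range J \<Longrightarrow> q w = \<infinity>"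
  shows "generalized_quadratic_form q"
proof -
  obtain K where K: "linear K" "\<And>w. w \<in> range J \<Longrightarrow> J (K w) = w"
    using linear_exists_right_inverse_on[OF J subspace_UNIV] by blast
  define B where "B = matrix (\<lambda>w. H (K w))"
  have lin: "linear (\<lambda>w. H (K w))" using linear_compose[OF K(1) H] by (simp add: o_def)
  have B: "B *v w = H (K w)" for w unfolding B_def using matrix_vector_mul(2)[OF lin] by (rule fun_cong)
  \<comment> \<open>Symmetrizing the matrix leaves the quadratic form unchanged.\<close>
  define A where "A = (1 / 2) *\<^sub>R (B + transpose B)"
  have wA: "w \<bullet> (A *v w) = H (K w) \<bullet> w" for w
  proof -
    have "w \<bullet> (transpose B *v w) = w \<bullet> (B *v w)"
      by (metis dot_lmul_matrix inner_commute transpose_matrix_vector)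
    then show ?thesis
      by (simp add: A_def matrix_vector_mult_add_rdistrib scaleR_matrix_vector_assoc[symmetric] inner_add_right B inner_commute)
  qed
  have "transpose A = A"
    by (simp add: A_def transpose_def vec_eq_iff add.commute)
  moreover have "subspace (range J)" by (rule linear_subspace_image[OF J subspace_UNIV])
  moreover have "q = (\<lambda>w. ereal (w \<bullet> (A *v w)) + set_delta (range J) w)"
  proof
    fix w
    show "q w = ereal (w \<bullet> (A *v w)) + set_delta (range J) w"
    proof (cases "w \<in> range J")
      case True
      then show ?thesis using on[of "K w"] K(2)[OF True] by (simp add: wA set_delta_def)
    qed (simp add: off set_delta_def)
  qed
  ultimately show ?thesis unfolding generalized_quadratic_form_def by blast
qed

lemma convex_fun_of_generalized_psd:
  fixes \<phi> :: "real ^ 'n \<Rightarrow> ereal"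
  assumes wc: "ereal_weakly_convex \<phi> \<rho>"
    and psd: "\<And>x v. (x, v) \<in> gph_subdifferential \<phi> \<Longrightarrow> generalized_twice_differentiable \<phi> x v \<Longrightarrow>
      positive_semidefinite_map (combined_second_subdifferential \<phi> x v)"
  shows "convex_fun \<phi>"
proof -
  interpret ereal_weakly_convex \<phi> \<rho> by (rule wc)
  have approx: "\<exists>p\<in>dom_fun \<phi>. \<phi>r p + (norm (p - ((1 - t) *\<^sub>R x0 + t *\<^sub>R x1)))\<^sup>2 / (2 * \<mu>) \<le> (1 - t) * \<phi>r x0 + t * \<phi>r x1"
    if \<mu>: "\<mu> > 0" "\<mu> * \<rho> < 1" and x: "x0 \<in> dom_fun \<phi>" "x1 \<in> dom_fun \<phi>" and t: "0 < t" "t < 1" for \<mu> x0 x1 t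
  proof -
    interpret ereal_prox \<phi> \<rho> \<mu> by unfold_locales (rule \<mu>)+
    have "J d \<bullet> (d - J d) \<ge> 0" if J: "(P has_derivative J) (at y)" for y J d
    proof -
      interpret ereal_prox_differentiable \<phi> \<rho> \<mu> y J by unfold_locales (rule J)
      have "generalized_twice_differentiable \<phi> (P y) (G y)"
        unfolding generalized_twice_differentiable_def
        using twice_epi generalized_quadratic_form_of_linear[OF J_linear H_linear D2_range D2_off_range] by blast
      moreover have "(P y, G y) \<in> gph_subdifferential \<phi>" using P_gph by (simp add: gph_subdifferential_eq)
      ultimately have "positive_semidefinite_map (combined_second_subdifferential \<phi> (P y) (G y))" by (intro psd)
      moreover have "H d \<in> combined_second_subdifferential \<phi> (P y) (G y) (J d)"
        using graph_regular_normal by (simp add: combined_second_subdifferential_def)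
      ultimately have "H d \<bullet> J d \<ge> 0" unfolding positive_semidefinite_map_def by blast
      moreover have "d - J d = \<mu> *\<^sub>R H d" by (simp add: J_eq)
      ultimately show ?thesis using mu_pos by (simp add: inner_commute)
    qed
    then have "(G y - G z) \<bullet> (y - z) \<ge> 0" for y z by (rule monotone_of_derivative)
    from env_convex_imp_approx[OF this x t] show ?thesis .
  qed
  have "\<phi> ((1 - t) *\<^sub>R x + t *\<^sub>R y) \<le> ereal (1 - t) * \<phi> x + ereal t * \<phi> y" if t: "0 < t" "t < 1" for x y t
  proof (cases "x \<in> dom_fun \<phi> \<and> y \<in> dom_fun \<phi>")
    case True
    then have xy: "x \<in> dom_fun \<phi>" "y \<in> dom_fun \<phi>" by auto
    have d: "(1 - t) *\<^sub>R x + t *\<^sub>R y \<in> dom_fun \<phi>" by (rule conv[OF xy t])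
    have "\<phi>r ((1 - t) *\<^sub>R x + t *\<^sub>R y) \<le> (1 - t) * \<phi>r x + t * \<phi>r y"
      by (rule le_of_prox_approximation[OF d]) (rule approx[OF _ _ xy t])
    then have "\<phi> ((1 - t) *\<^sub>R x + t *\<^sub>R y) \<le> ereal ((1 - t) * \<phi>r x + t * \<phi>r y)"
      using d by (simp add: phi_le_iff)
    also have "\<dots> = ereal (1 - t) * \<phi> x + ereal t * \<phi> y"
    proof -
      obtain a b where "\<phi> x = ereal a" "\<phi> y = ereal b" using phi_eq[OF xy(1)] phi_eq[OF xy(2)] by blast
      then show ?thesis by simp
    qed
    finally show ?thesis .
  next
    case False
    then have "ereal (1 - t) * \<phi> x + ereal t * \<phi> y = \<infinity>"
      using t no_minf[of x] no_minf[of y] phi_infinite[of x] phi_infinite[of y]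
      by (cases "\<phi> x"; cases "\<phi> y") (auto simp: dom_fun_def)
    then show ?thesis by (simp only: ereal_less_eq(1))
  qed
  then show ?thesis by (simp add: convex_fun_def s_convex_def)
qed

section \<open>From convexity to positive semidefiniteness\<close>

lemma regular_graph_normal_psd:
  assumes wc: "ereal_weakly_convex \<phi> 0"
    and gph: "(x, v) \<in> gph_subdifferential \<phi>" and N: "(z, - w) \<in> regular_normal_cone (gph_subdifferential \<phi>) (x, v)"
  shows "z \<bullet> w \<ge> 0"
proof -
  interpret ereal_prox \<phi> 0 1
    by (rule ereal_prox.intro[OF wc]) (unfold_locales, auto)
  obtain y where y: "x = P y" "v = G y" using gph by (auto simp: gph_subdifferential_eq gph_eq)
  define p where "p = z - w"
  have GP: "G a = a - P a" for a by (simp add: G_def)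
  have key: "(norm p)\<^sup>2 \<le> norm (z + w) * norm p + 6 * \<epsilon> * norm p" if \<epsilon>: "\<epsilon> > 0" for \<epsilon>
  proof -
    obtain s where s: "s > 0" "\<And>q. q \<in> gph \<Longrightarrow> norm (q - (x, v)) < s \<Longrightarrow> (z, - w) \<bullet> (q - (x, v)) \<le> \<epsilon> * norm (q - (x, v))"
      using N \<epsilon> unfolding regular_normal_cone_iff gph_subdifferential_eq by blast
    \<comment> \<open>The graph point moves by at most \<open>3 * (t * norm p)\<close>;
      \<open>C\<close> and \<open>t\<close> keep this below \<open>s\<close>, also when
      \<open>p = 0\<close>.\<close>
    define C where "C = 3 * norm p + 1"
    define t where "t = s / 2 / C"
    have C: "C > 0" by (simp add: C_def add_nonneg_pos)
    have t: "t > 0" using s C by (simp add: t_def)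
    have "t * C = s / 2" using C by (simp add: t_def)
    moreover have "t * C = 3 * (t * norm p) + t" by (simp add: C_def distrib_left)
    ultimately have ts: "3 * (t * norm p) < s" using t s(1) by linarith
    define q where "q = P (y + t *\<^sub>R p) - P y"
    have g: "G (y + t *\<^sub>R p) - G y = t *\<^sub>R p - q" by (simp add: GP q_def)
    have firm: "(norm q)\<^sup>2 \<le> t * (p \<bullet> q)" using P_inner[of "y + t *\<^sub>R p" y] by (simp add: q_def)
    have "(norm (q - (t / 2) *\<^sub>R p))\<^sup>2 = (norm q)\<^sup>2 - t * (p \<bullet> q) + (t / 2)\<^sup>2 * (norm p)\<^sup>2"
      unfolding power2_norm_eq_inner
      by (simp add: inner_diff_left inner_diff_right inner_commute power2_eq_square)
    then have "(norm (q - (t / 2) *\<^sub>R p))\<^sup>2 \<le> (t / 2 * norm p)\<^sup>2"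
      using firm unfolding power_mult_distrib by linarith
    \<comment> \<open>Firm nonexpansiveness places \<open>q\<close> in the ball with centre
      \<open>(t / 2) *\<^sub>R p\<close> and radius \<open>t / 2 * norm p\<close>, half of the
      trivial displacement.\<close>
    then have half: "norm (q - (t / 2) *\<^sub>R p) \<le> t / 2 * norm p"
      by (rule power2_le_imp_le) (use t in simp)
    have nq: "norm q \<le> t * norm p"
      using norm_triangle_ineq[of "q - (t / 2) *\<^sub>R p" "(t / 2) *\<^sub>R p"] half t by simp
    have ng: "norm (t *\<^sub>R p - q) \<le> 2 * (t * norm p)"
      using norm_triangle_ineq4[of "t *\<^sub>R p" q] nq t by simp
    have nN: "norm (q, t *\<^sub>R p - q) \<le> 3 * (t * norm p)"
      using norm_Pair_le[of q "t *\<^sub>R p - q"] nq ng by linarith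
    have diff: "(P (y + t *\<^sub>R p), G (y + t *\<^sub>R p)) - (x, v) = (q, t *\<^sub>R p - q)"
      by (simp add: y q_def GP)
    have "(z, - w) \<bullet> (q, t *\<^sub>R p - q) \<le> \<epsilon> * norm (q, t *\<^sub>R p - q)"
      using s(2)[OF P_gph[of "y + t *\<^sub>R p"]] nN ts unfolding diff by linarith
    also have "\<dots> \<le> \<epsilon> * (3 * (t * norm p))" using nN \<epsilon> by (intro mult_left_mono) auto
    finally have a: "(z + w) \<bullet> q - t * (w \<bullet> p) \<le> 3 * \<epsilon> * (t * norm p)"
      by (simp add: inner_add_left inner_diff_right)
    have "\<bar>(z + w) \<bullet> (q - (t / 2) *\<^sub>R p)\<bar> \<le> norm (z + w) * norm (q - (t / 2) *\<^sub>R p)"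
      by (rule Cauchy_Schwarz_ineq2)
    also have "\<dots> \<le> norm (z + w) * (t / 2 * norm p)" using half by (intro mult_left_mono) auto
    finally have b: "(z + w) \<bullet> q \<ge> t / 2 * ((z + w) \<bullet> p) - norm (z + w) * (t / 2 * norm p)"
      unfolding inner_diff_right inner_scaleR_right by linarith
    \<comment> \<open>Uses \<open>p = (z + w) - 2 *\<^sub>R w\<close>. Doubling the bound
      \<open>3 * \<epsilon>\<close> from \<open>a\<close> is the origin of the constant 6.\<close>
    have "t * (norm p)\<^sup>2 = t * ((z + w) \<bullet> p) - 2 * (t * (w \<bullet> p))"
      by (simp add: p_def power2_norm_eq_inner inner_add_left inner_diff_left algebra_simps)
    also have "\<dots> \<le> t * (norm (z + w) * norm p + 6 * \<epsilon> * norm p)" using a b by (simp add: algebra_simps)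
    finally show ?thesis using t by simp
  qed
  have "norm p \<le> norm (z + w)"
  proof (cases "p = 0")
    case False
    show ?thesis
    proof (rule field_le_epsilon)
      fix e :: real assume "e > 0"
      then have "(norm p)\<^sup>2 \<le> norm (z + w) * norm p + 6 * (e / 6) * norm p" by (intro key) simp
      then have "norm p * norm p \<le> (norm (z + w) + e) * norm p"
        by (simp add: power2_eq_square distrib_right)
      then show "norm p \<le> norm (z + w) + e" using False by simp
    qed
  qed simp
  then have "(norm (z - w))\<^sup>2 \<le> (norm (z + w))\<^sup>2" by (simp add: p_def power_mono)
  then show ?thesis
    unfolding power2_norm_eq_inner
    by (simp add: inner_add_left inner_add_right inner_diff_left inner_diff_right inner_commute)
qed

lemma limiting_second_subdifferential_psd:
  assumes wc: "ereal_weakly_convex \<phi> 0"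
  shows "positive_semidefinite_map (limiting_second_subdifferential \<phi> x v)"
  unfolding positive_semidefinite_map_def
proof (intro allI ballI)
  fix w z assume "z \<in> limiting_second_subdifferential \<phi> x v w"
  then obtain q u where q: "\<And>k. q k \<in> gph_subdifferential \<phi>" and u: "u \<longlonglongrightarrow> (z, - w)"
    "\<And>k. u k \<in> regular_normal_cone (gph_subdifferential \<phi>) (q k)"
    unfolding limiting_second_subdifferential_def limiting_normal_cone_def by auto
  have "fst (u k) \<bullet> (- snd (u k)) \<ge> 0" for k
    using q[of k] u(2)[of k]
    by (intro regular_graph_normal_psd[OF wc, of "fst (q k)" "snd (q k)"]) auto
  moreover have "(\<lambda>k. fst (u k) \<bullet> (- snd (u k))) \<longlonglongrightarrow> z \<bullet> (- (- w))"
    using tendsto_fst[OF u(1)] tendsto_snd[OF u(1)] by (intro tendsto_intros) auto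
  ultimately have "z \<bullet> (- (- w)) \<ge> 0" by (intro LIMSEQ_le_const) auto
  then show "z \<bullet> w \<ge> 0" by simp
qed

lemma psd_combined_of_limiting:
  assumes "(x, v) \<in> gph_subdifferential \<phi>"
    and "positive_semidefinite_map (limiting_second_subdifferential \<phi> x v)"
  shows "positive_semidefinite_map (combined_second_subdifferential \<phi> x v)"
  using assms(2) regular_subset_limiting_normal_cone[OF assms(1)]
  unfolding positive_semidefinite_map_def combined_second_subdifferential_def limiting_second_subdifferential_def
  by blast

theorem theorem3p9:
  fixes \<phi> :: "real ^ 'n \<Rightarrow> ereal"
  assumes no_minus_infinity: "\<And>x. \<phi> x \<noteq> -\<infinity>"
    and proper: "proper_fun \<phi>"
    and lsc: "lower_semicontinuous \<phi>"
    and weakly: "weakly_convex \<phi>"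
  shows
    "(convex_fun \<phi> \<longleftrightarrow>
        (\<forall>(x, v)\<in>gph_subdifferential \<phi>.
            positive_semidefinite_map (combined_second_subdifferential \<phi> x v))) \<and>
     (convex_fun \<phi> \<longleftrightarrow>
        (\<forall>(x, v)\<in>gph_subdifferential \<phi>. twice_epi_differentiable \<phi> x v \<longrightarrow>
            positive_semidefinite_map (combined_second_subdifferential \<phi> x v))) \<and>
     (convex_fun \<phi> \<longleftrightarrow>
        (\<forall>(x, v)\<in>gph_subdifferential \<phi>. generalized_twice_differentiable \<phi> x v \<longrightarrow>
            positive_semidefinite_map (combined_second_subdifferential \<phi> x v))) \<and>
     (convex_fun \<phi> \<longleftrightarrow>
        (\<forall>(x, v)\<in>gph_subdifferential \<phi>.
            positive_semidefinite_map (limiting_second_subdifferential \<phi> x v))) \<and>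
     (convex_fun \<phi> \<longleftrightarrow>
        (\<forall>(x, v)\<in>gph_subdifferential \<phi>. twice_epi_differentiable \<phi> x v \<longrightarrow>
            positive_semidefinite_map (limiting_second_subdifferential \<phi> x v))) \<and>
     (convex_fun \<phi> \<longleftrightarrow>
        (\<forall>(x, v)\<in>gph_subdifferential \<phi>. generalized_twice_differentiable \<phi> x v \<longrightarrow>
            positive_semidefinite_map (limiting_second_subdifferential \<phi> x v)))"
proof -
  obtain s where s: "s < 0" "s_convex s \<phi>" using weakly by (auto simp: weakly_convex_def)
  have wc: "ereal_weakly_convex \<phi> (- s)"
    by unfold_locales (use assms s in auto)
  have lim: "positive_semidefinite_map (limiting_second_subdifferential \<phi> x v)" if "convex_fun \<phi>" for x v
  proof (rule limiting_second_subdifferential_psd)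
    show "ereal_weakly_convex \<phi> 0"
      by unfold_locales (use assms that in \<open>auto simp: convex_fun_def\<close>)
  qed
  have comb: "positive_semidefinite_map (combined_second_subdifferential \<phi> x v)"
    if "convex_fun \<phi>" "(x, v) \<in> gph_subdifferential \<phi>" for x v
    by (rule psd_combined_of_limiting[OF that(2) lim[OF that(1)]])
  have convC: "convex_fun \<phi>"
    if "\<And>x v. (x, v) \<in> gph_subdifferential \<phi> \<Longrightarrow> generalized_twice_differentiable \<phi> x v \<Longrightarrow>
      positive_semidefinite_map (combined_second_subdifferential \<phi> x v)"
    using convex_fun_of_generalized_psd[OF wc that] .
  have convL: "convex_fun \<phi>"
    if "\<And>x v. (x, v) \<in> gph_subdifferential \<phi> \<Longrightarrow> generalized_twice_differentiable \<phi> x v \<Longrightarrow>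
      positive_semidefinite_map (limiting_second_subdifferential \<phi> x v)"
    by (rule convC) (rule psd_combined_of_limiting, assumption, rule that)
  have epi: "twice_epi_differentiable \<phi> x v" if "generalized_twice_differentiable \<phi> x v" for x v
    using that by (simp add: generalized_twice_differentiable_def)
  have all: "(\<forall>(x, v)\<in>gph_subdifferential \<phi>. Q x v) \<longleftrightarrow> (\<forall>x v. (x, v) \<in> gph_subdifferential \<phi> \<longrightarrow> Q x v)"
    for Q by auto
  show ?thesis
    \<comment> \<open>Fewer pairs or a smaller normal cone weaken a condition. So \<open>lim\<close>
      and \<open>comb\<close> derive all six from convexity, and the two generalized versions,
      reached through \<open>epi\<close>, lead back.\<close>
    unfolding all using convC convL lim comb epi by (intro conjI iffI; blast)
qed

end
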